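(* There exists a finite inverse temperature $\beta^*$ such that for every $\beta$ with $\infty\geq\beta>\beta^*$ the following holds. Let $\nu$ be a translation invariant EA$_\beta$ spin glass distribution on $\mathbb Z^2$ (for $\beta=\infty$: a translation invariant ground state). Then $\nu$-almost surely every connected component of the subgraph of $(\mathbb Z^2)^*$ formed by the unsatisfied dual edges is finite.
   Context: $\mathbb Z^2$ is the square lattice (edges between vertices at $\ell_1$-distance $1$); $(\mathbb Z^2)^*=(\tfrac12,\tfrac12)+\mathbb Z^2$ is its dual, each dual edge $e^*$ being identified with the unique edge $e$ of $\mathbb Z^2$ crossing it. Interactions are $w:E(\mathbb Z^2)\to\mathbb R$; spins are $\sigma:\mathbb Z^2\to\{-1,+1\}$. For a finite subgraph $C$, let $C^c$ be the subgraph on $\mathbb Z^2\setminus V(C)$, $\partial C^c$ the vertices of $C^c$ having a neighbour in $C$, and $\bar C=C\cup\partial C^c$. For boundary conditions $\tau\in\{\pm1\}^{V(\partial C^c)}$, let $\Omega^{C,\tau}$ be the spin configurations on $\bar C$ agreeing with $\tau$ on $\partial C^c$, $\mathcal H^{C,\tau}_w(\sigma)=-\sum w_{xy}\sigma_x\sigma_y$ (sum over neighbouring pairs $x,y\in V(\bar C)$), and $\mathbb P^{C,\tau}_{w,\beta}(\sigma)\propto\exp(-\beta\mathcal H^{C,\tau}_w(\sigma))$ on $\Omega^{C,\tau}$. An EA$_\beta$ spin glass distribution ($0\le\beta<\infty$) is a joint law of $(w,\sigma)$ such that $(w_e)$ are i.i.d. standard normal and, for every finite subgraph $C$, the conditional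 law of $\sigma_{\bar C}$ given $\sigma_{C^c}$ and $w$ is $\mathbb P^{C,\sigma_{\partial C^c}}_{w,\beta}$. A ground state is a joint law of $(w,\sigma)$ with $w$ i.i.d. standard normal such that a.s., for every finite $C$, $\sigma_C$ is the unique minimizer of $\mathcal H^{C,\tau}_w$ given $\tau=\sigma_{\partial C^c}$. Translation invariance refers to the diagonal action of $\mathbb Z^2$ translations on $(w,\sigma)$. An edge $e=\{i,j\}$ and its dual $e^*$ are unsatisfied if $w_e\sigma_i\sigma_j<0$. *)

theory Defs
  imports "HOL-Probability.Probability"
begin

type_synonym vert = "int \<times> int"

text \<open>Edges of Z^2: (x, False) is the edge from x to x + (1,0),
  (x, True) is the edge from x to x + (0,1).  This is a bijection with E(Z^2).\<close>
type_synonym edge = "vert \<times> bool"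

definition lat_adj :: "vert \<Rightarrow> vert \<Rightarrow> bool" where
  "lat_adj x y \<longleftrightarrow> \<bar>fst x - fst y\<bar> + \<bar>snd x - snd y\<bar> = 1"

definition end1 :: "edge \<Rightarrow> vert" where
  "end1 e = fst e"

definition end2 :: "edge \<Rightarrow> vert" where
  "end2 e = (if snd e then (fst (fst e), snd (fst e) + 1) else (fst (fst e) + 1, snd (fst e)))"

text \<open>Dual vertex (a,b) stands for the point (a+1/2, b+1/2) of (Z^2)^*.
  The dual edge e^* crossing e has the following two dual endpoints.\<close>
definition dual_ends :: "edge \<Rightarrow> vert set" where
  "dual_ends e = (if snd e then {(fst (fst e) - 1, snd (fst e)), fst e}
                           else {(fst (fst e), snd (fst e) - 1), fst e})"

definition closure_set :: "vert set \<Rightarrow> vert set" where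
  "closure_set V = V \<union> {y. y \<notin> V \<and> (\<exists>x\<in>V. lat_adj x y)}"

definition hamiltonian :: "(edge \<Rightarrow> real) \<Rightarrow> vert set \<Rightarrow> (vert \<Rightarrow> int) \<Rightarrow> real" where
  "hamiltonian w V \<sigma> =
     - (\<Sum>e\<in>{e. end1 e \<in> closure_set V \<and> end2 e \<in> closure_set V}.
          w e * real_of_int (\<sigma> (end1 e) * \<sigma> (end2 e)))"

definition configs :: "vert set \<Rightarrow> (vert \<Rightarrow> int) set" where
  "configs V = (\<Pi>\<^sub>E x\<in>V. {-1, 1})"

text \<open>Finite volume Gibbs weight of the configuration \<eta> on V, with boundary
  condition taken from \<sigma> (only \<sigma> on the outer boundary matters).\<close>
definition gibbs :: "real \<Rightarrow> (edge \<Rightarrow> real) \<Rightarrow> vert set \<Rightarrow> (vert \<Rightarrow> int) \<Rightarrow> (vert \<Rightarrow> int) \<Rightarrow> real" where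
  "gibbs \<beta> w V \<sigma> \<eta> =
     exp (- \<beta> * hamiltonian w V (override_on \<sigma> \<eta> V)) /
     (\<Sum>\<eta>'\<in>configs V. exp (- \<beta> * hamiltonian w V (override_on \<sigma> \<eta>' V)))"

definition W_space :: "(edge \<Rightarrow> real) measure" where
  "W_space = PiM UNIV (\<lambda>_. borel)"

definition S_space :: "(vert \<Rightarrow> int) measure" where
  "S_space = PiM UNIV (\<lambda>_. count_space {-1, 1})"

definition Omega :: "((edge \<Rightarrow> real) \<times> (vert \<Rightarrow> int)) measure" where
  "Omega = W_space \<Otimes>\<^sub>M S_space"

definition iid_normal_law :: "((edge \<Rightarrow> real) \<times> (vert \<Rightarrow> int)) measure \<Rightarrow> bool" where
  "iid_normal_law \<nu> \<longleftrightarrow>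
     prob_space \<nu> \<and> sets \<nu> = sets Omega \<and>
     prob_space.indep_vars \<nu> (\<lambda>_. borel) (\<lambda>e p. fst p e) UNIV \<and>
     (\<forall>e. distr \<nu> borel (\<lambda>p. fst p e) = std_normal_distribution)"

definition outside_event :: "vert set \<Rightarrow> ((edge \<Rightarrow> real) \<times> (vert \<Rightarrow> int)) set \<Rightarrow> bool" where
  "outside_event V A \<longleftrightarrow> A \<in> sets Omega \<and>
     (\<forall>p\<in>space Omega. \<forall>q\<in>space Omega. fst p = fst q \<and> (\<forall>x. x \<notin> V \<longrightarrow> snd p x = snd q x)
        \<longrightarrow> (p \<in> A \<longleftrightarrow> q \<in> A))"

text \<open>EA_\<beta> spin glass distribution: the conditional law of \<sigma> on V given w and
  \<sigma> off V is the finite-volume Gibbs measure (DLR condition), for every finite V.\<close>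
definition EA_spin_glass :: "real \<Rightarrow> ((edge \<Rightarrow> real) \<times> (vert \<Rightarrow> int)) measure \<Rightarrow> bool" where
  "EA_spin_glass \<beta> \<nu> \<longleftrightarrow> 0 \<le> \<beta> \<and> iid_normal_law \<nu> \<and>
     (\<forall>V A \<eta>. finite V \<longrightarrow> outside_event V A \<longrightarrow> \<eta> \<in> configs V \<longrightarrow>
        emeasure \<nu> (A \<inter> {p \<in> space Omega. \<forall>x\<in>V. snd p x = \<eta> x}) =
        (\<integral>\<^sup>+ p\<in>A. ennreal (gibbs \<beta> (fst p) V (snd p) \<eta>) \<partial>\<nu>))"

definition ground_state :: "((edge \<Rightarrow> real) \<times> (vert \<Rightarrow> int)) measure \<Rightarrow> bool" where
  "ground_state \<nu> \<longleftrightarrow> iid_normal_law \<nu> \<and>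
     (AE p in \<nu>. \<forall>V. finite V \<longrightarrow> (\<forall>\<eta>\<in>configs V. \<eta> \<noteq> restrict (snd p) V \<longrightarrow>
        hamiltonian (fst p) V (snd p) < hamiltonian (fst p) V (override_on (snd p) \<eta> V)))"

definition shift :: "vert \<Rightarrow> (edge \<Rightarrow> real) \<times> (vert \<Rightarrow> int) \<Rightarrow> (edge \<Rightarrow> real) \<times> (vert \<Rightarrow> int)" where
  "shift a p = ((\<lambda>(x, b). fst p ((fst x + fst a, snd x + snd a), b)),
                (\<lambda>x. snd p (fst x + fst a, snd x + snd a)))"

definition translation_invariant :: "((edge \<Rightarrow> real) \<times> (vert \<Rightarrow> int)) measure \<Rightarrow> bool" where
  "translation_invariant \<nu> \<longleftrightarrow> (\<forall>a. distr \<nu> Omega (shift a) = \<nu>)"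

definition unsatisfied :: "(edge \<Rightarrow> real) \<Rightarrow> (vert \<Rightarrow> int) \<Rightarrow> edge \<Rightarrow> bool" where
  "unsatisfied w \<sigma> e \<longleftrightarrow> w e * real_of_int (\<sigma> (end1 e) * \<sigma> (end2 e)) < 0"

definition unsat_rel :: "(edge \<Rightarrow> real) \<Rightarrow> (vert \<Rightarrow> int) \<Rightarrow> (vert \<times> vert) set" where
  "unsat_rel w \<sigma> = {(u, v). \<exists>e. unsatisfied w \<sigma> e \<and> dual_ends e = {u, v}}"

definition unsat_component :: "(edge \<Rightarrow> real) \<Rightarrow> (vert \<Rightarrow> int) \<Rightarrow> vert \<Rightarrow> vert set" where
  "unsat_component w \<sigma> u = {v. (u, v) \<in> (unsat_rel w \<sigma>)\<^sup>*}"

end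

theory Submission
  imports Defs
begin

text \<open>
  The argument is a Peierls estimate: the expected number of self-avoiding dual paths of length \<open>n\<close>
  from a given point all of whose edges are unsatisfied tends to \<open>0\<close>, and an infinite component
  would contain such a path for every \<open>n\<close>.

  Two dual paths \<open>\<pi>\<close> and \<open>\<rho>\<close> with the same ends differ by the boundary of a finite set of vertices, and
  flipping that set shows that, given \<open>w\<close>, the path \<open>\<pi>\<close> is unsatisfied with probability at most
  \<open>exp (- 2 \<beta> (\<bar>w\<bar>(\<pi>) - \<bar>w\<bar>(\<rho>)))\<close>.  So only nearly geodesic paths of the first passage metric \<open>\<bar>w\<bar>\<close> count, and
  for large \<open>\<beta>\<close> the expected number of these is at most \<open>(1 + \<epsilon>) ^ n\<close>: shrink the weights along \<open>\<pi>\<close> by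
  a constant factor, at a cost of another constant factor per edge, and compare \<open>\<pi>\<close> with the minimiser of the new weights.

  On the other hand the signs of \<open>w\<close> are independent of \<open>\<bar>w\<bar>\<close>.  If \<open>\<pi>\<close> passes through a frustrated plaquette
  whose two remaining edges have dominating weights, then \<open>\<pi>\<close> cannot be unsatisfied at low cost.
  Since the bound above increases in the weights off \<open>\<pi>\<close>, conditioning on it only makes such plaquettes more
  likely (Harris' inequality), and with linearly many disjoint places along \<open>\<pi>\<close> one gains a factor
  \<open>(1 - \<delta>) ^ k\<close> with \<open>k\<close> proportional to \<open>n\<close> and \<open>\<delta>\<close> independent of \<open>\<beta>\<close>.
\<close>

subsection \<open>Gaussian couplings\<close>

text \<open>Neither bound suffices alone: the count of nearly geodesic paths still grows, if slowly,
  and the plaquette bound cannot beat the number of all paths. Both dominate the same conditional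
  probability given \<open>w\<close>, hence so does their minimum, which is at most their geometric
  mean; each then enters with half its exponent, and this is where \<open>2 * \<beta>\<close> turns
  into \<beta>. The count works because each \<open>w\<close> has just one minimiser \<rho> of the
  shrunk weights: the probabilities of the events \<open>geo P \<rho>\<close> sum to at most one,
  and for fixed \<rho> a path pays a small factor \<psi> for every edge off \<rho>, which beats the
  entropy of leaving \<rho>. The plaquette gain needs ordinary weights around the spot. Paths with
  too few such spots are handled by a union bound over all paths, which fixes the threshold
  \<open>t\<close>. The order of choice is \<open>t\<close>, then \<delta> (a function of
  \<open>t\<close> only), then the growth rate \<eta> allowed by \<delta>, and \<beta> last.\<close>

abbreviation "normal \<equiv> std_normal_distribution"

lemma prob_space_normal: "prob_space normal"
  by (rule prob_space_normal_density) simp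

definition gauss :: "(edge \<Rightarrow> real) measure" where
  "gauss = PiM UNIV (\<lambda>_. normal)"

lemma sets_gauss [measurable_cong]: "sets gauss = sets W_space"
  unfolding gauss_def W_space_def by (intro sets_PiM_cong) auto

lemma space_gauss [simp]: "space gauss = UNIV"
  by (simp add: gauss_def space_PiM)

lemma space_W_space [simp]: "space W_space = UNIV"
  by (simp add: W_space_def space_PiM)

lemma prob_space_gauss: "prob_space gauss"
  unfolding gauss_def by (rule prob_space_PiM) (rule prob_space_normal)

lemma measurable_coord [measurable]: "(\<lambda>w. w e) \<in> borel_measurable W_space"
  unfolding W_space_def by measurable

lemma measurable_W_spaceI:
  assumes "\<And>e. (\<lambda>x. f x e) \<in> borel_measurable M"
  shows "f \<in> measurable M W_space"
  unfolding W_space_def by (rule measurable_PiM_single') (use assms in auto)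

lemma measurable_update [measurable (raw)]:
  assumes [measurable]: "f \<in> measurable M W_space" "g \<in> borel_measurable M"
  shows "(\<lambda>x. (f x)(i := g x)) \<in> measurable M W_space"
  by (rule measurable_W_spaceI) (auto simp: fun_upd_def)

lemma distr_coupling_law:
  assumes "iid_normal_law \<nu>"
  shows "distr \<nu> W_space fst = gauss"
proof -
  interpret prob_space \<nu> using assms by (simp add: iid_normal_law_def)
  have ind: "indep_vars (\<lambda>_. borel) (\<lambda>e p. fst p e) UNIV"
    and law: "\<And>e. distr \<nu> borel (\<lambda>p. fst p e) = normal"
    using assms by (auto simp: iid_normal_law_def)
  have "distr \<nu> (\<Pi>\<^sub>M e\<in>UNIV. borel) (\<lambda>p. \<lambda>e\<in>UNIV. fst p e) = (\<Pi>\<^sub>M e\<in>UNIV. distr \<nu> borel (\<lambda>p. fst p e))"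
    using ind indep_vars_iff_distr_eq_PiM'[of UNIV "\<lambda>e p. fst p e" "\<lambda>_. borel"]
    unfolding indep_vars_def by blast
  then show ?thesis by (simp add: law gauss_def W_space_def restrict_def)
qed

text \<open>Redrawing one coupling preserves the product law. The product estimates below thereby
  reduce to one-variable inequalities, uniform in the other couplings and applied edge by
  edge.\<close>

lemma nn_integral_resample:
  assumes [measurable]: "f \<in> borel_measurable W_space"
  shows "(\<integral>\<^sup>+w. f w \<partial>gauss) = (\<integral>\<^sup>+w. (\<integral>\<^sup>+y. f (w(i := y)) \<partial>normal) \<partial>gauss)"
proof -
  interpret G: prob_space gauss by (rule prob_space_gauss)
  interpret N: prob_space normal by (rule prob_space_normal)
  interpret P: pair_sigma_finite normal gauss ..
  have "distr (normal \<Otimes>\<^sub>M gauss) gauss (\<lambda>(x, X). X(i := x)) = gauss"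
    unfolding gauss_def
    using distr_pair_PiM_eq_PiM[where I=UNIV and M="\<lambda>_. normal" and i'=i] prob_space_normal
    by simp
  then have "(\<integral>\<^sup>+w. f w \<partial>gauss) = (\<integral>\<^sup>+w. f w \<partial>distr (normal \<Otimes>\<^sub>M gauss) gauss (\<lambda>(x, X). X(i := x)))"
    by simp
  also have "\<dots> = (\<integral>\<^sup>+z. f ((snd z)(i := fst z)) \<partial>(normal \<Otimes>\<^sub>M gauss))"
    by (subst nn_integral_distr) (auto simp: split_beta')
  also have "\<dots> = (\<integral>\<^sup>+w. (\<integral>\<^sup>+y. f (w(i := y)) \<partial>normal) \<partial>gauss)"
    by (subst P.nn_integral_snd[symmetric]) auto
  finally show ?thesis .
qed

lemma nn_integral_resample_mono:
  assumes [measurable]: "f \<in> borel_measurable W_space" "g \<in> borel_measurable W_space"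
    and "\<And>w. (\<integral>\<^sup>+y. f (w(i := y)) \<partial>normal) \<le> c * (\<integral>\<^sup>+y. g (w(i := y)) \<partial>normal)"
  shows "(\<integral>\<^sup>+w. f w \<partial>gauss) \<le> c * (\<integral>\<^sup>+w. g w \<partial>gauss)"
proof -
  interpret N: prob_space normal by (rule prob_space_normal)
  have "(\<integral>\<^sup>+w. f w \<partial>gauss) = (\<integral>\<^sup>+w. (\<integral>\<^sup>+y. f (w(i := y)) \<partial>normal) \<partial>gauss)"
    by (rule nn_integral_resample) auto
  also have "\<dots> \<le> (\<integral>\<^sup>+w. c * (\<integral>\<^sup>+y. g (w(i := y)) \<partial>normal) \<partial>gauss)"
    by (intro nn_integral_mono assms)
  also have "\<dots> = c * (\<integral>\<^sup>+w. (\<integral>\<^sup>+y. g (w(i := y)) \<partial>normal) \<partial>gauss)"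
    by (rule nn_integral_cmult) measurable
  also have "\<dots> = c * (\<integral>\<^sup>+w. g w \<partial>gauss)"
    by (subst nn_integral_resample[where i=i and f=g]) auto
  finally show ?thesis .
qed

section \<open>Correlation inequalities for one variable\<close>

lemma (in prob_space) nn_integral_anticorrelated:
  assumes [measurable]: "S \<in> events" "G \<in> borel_measurable M"
    and le: "\<And>x y. x \<in> S \<Longrightarrow> y \<in> space M - S \<Longrightarrow> G x \<le> G y"
  shows "(\<integral>\<^sup>+x. G x * indicator S x \<partial>M) \<le> emeasure M S * (\<integral>\<^sup>+x. G x \<partial>M)"
proof -
  let ?T = "space M - S"
  \<comment> \<open>The infimum off \<open>S\<close> separates the values: \<open>G\<close> is at
    most \<open>c\<close> on \<open>S\<close> and at least \<open>c\<close> off it. If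
    \<open>S\<close> is the whole space then \<open>c\<close> is \<top>, and its product with the
    mass 0 of \<open>?T\<close> is 0.\<close>
  define c where "c = (INF y\<in>?T. G y)"
  have 1: "emeasure M S + emeasure M ?T = 1"
    by (subst plus_emeasure) (use sets.sets_into_space[OF assms(1)] emeasure_space_1 in \<open>auto simp: Un_absorb1\<close>)
  have a: "(\<integral>\<^sup>+x. G x * indicator S x \<partial>M) \<le> c * emeasure M S"
  proof -
    have "(\<integral>\<^sup>+x. G x * indicator S x \<partial>M) \<le> (\<integral>\<^sup>+x. c * indicator S x \<partial>M)"
      by (intro nn_integral_mono) (auto simp: indicator_def c_def intro!: INF_greatest le)
    then show ?thesis by (simp add: nn_integral_cmult_indicator)
  qed
  have b: "c * emeasure M ?T \<le> (\<integral>\<^sup>+x. G x * indicator ?T x \<partial>M)"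
  proof -
    have "(\<integral>\<^sup>+x. c * indicator ?T x \<partial>M) \<le> (\<integral>\<^sup>+x. G x * indicator ?T x \<partial>M)"
      by (intro nn_integral_mono) (auto simp: indicator_def c_def intro!: INF_lower)
    then show ?thesis by (simp add: nn_integral_cmult_indicator)
  qed
  have split: "(\<integral>\<^sup>+x. G x \<partial>M) = (\<integral>\<^sup>+x. G x * indicator S x \<partial>M) + (\<integral>\<^sup>+x. G x * indicator ?T x \<partial>M)"
    by (subst nn_integral_add[symmetric]) (auto intro!: nn_integral_cong simp: indicator_def)
  have "(\<integral>\<^sup>+x. G x * indicator S x \<partial>M)
      = (emeasure M S + emeasure M ?T) * (\<integral>\<^sup>+x. G x * indicator S x \<partial>M)"
    by (simp add: 1)
  also have "\<dots> = emeasure M S * (\<integral>\<^sup>+x. G x * indicator S x \<partial>M)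
      + emeasure M ?T * (\<integral>\<^sup>+x. G x * indicator S x \<partial>M)"
    by (simp add: distrib_right)
  also have "emeasure M ?T * (\<integral>\<^sup>+x. G x * indicator S x \<partial>M) \<le> emeasure M ?T * (c * emeasure M S)"
    by (intro mult_left_mono a) simp
  also have "\<dots> = emeasure M S * (c * emeasure M ?T)" by (simp add: ac_simps)
  also have "\<dots> \<le> emeasure M S * (\<integral>\<^sup>+x. G x * indicator ?T x \<partial>M)"
    by (intro mult_left_mono b) simp
  finally show ?thesis
    by (simp add: split distrib_left add_left_mono)
qed

lemma (in prob_space) nn_integral_correlated:
  assumes [measurable]: "S \<in> events" "G \<in> borel_measurable M"
    and le: "\<And>x y. x \<in> S \<Longrightarrow> y \<in> space M - S \<Longrightarrow> G y \<le> G x"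
  shows "emeasure M S * (\<integral>\<^sup>+x. G x \<partial>M) \<le> (\<integral>\<^sup>+x. G x * indicator S x \<partial>M)"
proof -
  let ?T = "space M - S"
  define c where "c = (SUP y\<in>?T. G y)"
  have 1: "emeasure M S + emeasure M ?T = 1"
    by (subst plus_emeasure) (use sets.sets_into_space[OF assms(1)] emeasure_space_1 in \<open>auto simp: Un_absorb1\<close>)
  have a: "c * emeasure M S \<le> (\<integral>\<^sup>+x. G x * indicator S x \<partial>M)"
  proof -
    have "(\<integral>\<^sup>+x. c * indicator S x \<partial>M) \<le> (\<integral>\<^sup>+x. G x * indicator S x \<partial>M)"
      by (intro nn_integral_mono) (auto simp: indicator_def c_def intro!: SUP_least le)
    then show ?thesis by (simp add: nn_integral_cmult_indicator)
  qed
  have b: "(\<integral>\<^sup>+x. G x * indicator ?T x \<partial>M) \<le> c * emeasure M ?T"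
  proof -
    have "(\<integral>\<^sup>+x. G x * indicator ?T x \<partial>M) \<le> (\<integral>\<^sup>+x. c * indicator ?T x \<partial>M)"
      by (intro nn_integral_mono) (auto simp: indicator_def c_def intro!: SUP_upper)
    then show ?thesis by (simp add: nn_integral_cmult_indicator)
  qed
  have split: "(\<integral>\<^sup>+x. G x \<partial>M) = (\<integral>\<^sup>+x. G x * indicator S x \<partial>M) + (\<integral>\<^sup>+x. G x * indicator ?T x \<partial>M)"
    by (subst nn_integral_add[symmetric]) (auto intro!: nn_integral_cong simp: indicator_def)
  have "emeasure M S * (\<integral>\<^sup>+x. G x * indicator ?T x \<partial>M) \<le> emeasure M S * (c * emeasure M ?T)"
    by (intro mult_left_mono b) simp
  also have "\<dots> = emeasure M ?T * (c * emeasure M S)" by (simp add: ac_simps)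
  also have "\<dots> \<le> emeasure M ?T * (\<integral>\<^sup>+x. G x * indicator S x \<partial>M)"
    by (intro mult_left_mono a) simp
  finally have "emeasure M S * (\<integral>\<^sup>+x. G x \<partial>M) \<le> emeasure M S * (\<integral>\<^sup>+x. G x * indicator S x \<partial>M)
      + emeasure M ?T * (\<integral>\<^sup>+x. G x * indicator S x \<partial>M)"
    by (simp add: split distrib_left add_left_mono)
  also have "\<dots> = (\<integral>\<^sup>+x. G x * indicator S x \<partial>M)"
    by (simp add: distrib_right[symmetric] 1)
  finally show ?thesis .
qed

lemma nn_integral_normal_uminus:
  assumes [measurable]: "f \<in> borel_measurable borel"
  shows "(\<integral>\<^sup>+x. f (- x) \<partial>normal) = (\<integral>\<^sup>+x. f x \<partial>normal)"
proof -
  have "(\<integral>\<^sup>+x. f x \<partial>normal) = (\<integral>\<^sup>+x. ennreal (std_normal_density x) * f x \<partial>lborel)"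
    by (subst nn_integral_density) auto
  also have "\<dots> = (\<integral>\<^sup>+x. ennreal (std_normal_density (- x)) * f (- x) \<partial>lborel)"
    by (subst nn_integral_real_affine[where c="-1" and t=0]) auto
  also have "\<dots> = (\<integral>\<^sup>+x. f (- x) \<partial>normal)"
    by (subst nn_integral_density) (auto simp: std_normal_density_def)
  finally show ?thesis ..
qed

text \<open>The substitution costs the Jacobian \<open>1 / c\<close>, and the density at
  \<open>x / c\<close> is at most the density at \<open>x\<close> because
  \<open>c \<le> 1\<close>.\<close>

lemma nn_integral_normal_scale:
  assumes [measurable]: "f \<in> borel_measurable borel" and c: "0 < c" "c \<le> 1"
  shows "(\<integral>\<^sup>+x. f (c * x) \<partial>normal) \<le> ennreal (1 / c) * (\<integral>\<^sup>+x. f x \<partial>normal)"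
proof -
  have dens: "std_normal_density (x / c) \<le> std_normal_density x" for x
  proof -
    have "x\<^sup>2 \<le> (x / c)\<^sup>2"
    proof -
      have "c\<^sup>2 \<le> 1" using c by (simp add: power_le_one)
      then have "x\<^sup>2 * c\<^sup>2 \<le> x\<^sup>2" by (simp add: mult_left_le)
      then show ?thesis using c by (simp add: power_divide pos_le_divide_eq)
    qed
    then show ?thesis by (simp add: std_normal_density_def divide_right_mono)
  qed
  have "(\<integral>\<^sup>+x. f (c * x) \<partial>normal) = (\<integral>\<^sup>+x. ennreal (std_normal_density x) * f (c * x) \<partial>lborel)"
    by (subst nn_integral_density) auto
  also have "\<dots> = ennreal (1 / c) * (\<integral>\<^sup>+x. ennreal (std_normal_density (x / c)) * f x \<partial>lborel)"
    using c by (subst nn_integral_real_affine[where c="1/c" and t=0]) auto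
  also have "\<dots> \<le> ennreal (1 / c) * (\<integral>\<^sup>+x. ennreal (std_normal_density x) * f x \<partial>lborel)"
    by (intro mult_left_mono nn_integral_mono mult_right_mono ennreal_leI dens) auto
  also have "\<dots> = ennreal (1 / c) * (\<integral>\<^sup>+x. f x \<partial>normal)"
    by (subst nn_integral_density) auto
  finally show ?thesis .
qed

text \<open>A function increasing in \<open>\<bar>x\<bar>\<close> is positively correlated with the
  tail event, and evenness divides the tail integral equally between the two signs. The parameter
  \<open>b\<close> leaves the demanded sign open, so that it can later depend on other
  couplings.\<close>

lemma nn_integral_normal_half_tail:
  fixes f :: "real \<Rightarrow> ennreal"
  assumes [measurable]: "f \<in> borel_measurable borel"
    and mono: "\<And>x y. \<bar>x\<bar> \<le> \<bar>y\<bar> \<Longrightarrow> f x \<le> f y" and T: "0 \<le> T"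
  shows "ennreal (1/2) * emeasure normal {x. T < \<bar>x\<bar>} * (\<integral>\<^sup>+x. f x \<partial>normal)
    \<le> (\<integral>\<^sup>+x. f x * indicator {x. T < \<bar>x\<bar> \<and> (x < 0 \<longleftrightarrow> b)} x \<partial>normal)"
proof -
  interpret N: prob_space normal by (rule prob_space_normal)
  let ?I = "\<lambda>b. \<integral>\<^sup>+x. f x * indicator {x. T < \<bar>x\<bar> \<and> (x < 0 \<longleftrightarrow> b)} x \<partial>normal"
  have even: "f (- x) = f x" for x
    using mono[of x "-x"] mono[of "-x" x] by (simp add: order.antisym)
  have "?I (\<not> b) = (\<integral>\<^sup>+x. f (- x) * indicator {x. T < \<bar>x\<bar> \<and> (x < 0 \<longleftrightarrow> \<not> b)} (- x) \<partial>normal)"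
    by (subst nn_integral_normal_uminus) auto
  also have "\<dots> = ?I b"
    using T by (intro nn_integral_cong) (auto simp: even indicator_def)
  finally have sym: "?I (\<not> b) = ?I b" .
  have "emeasure normal {x. T < \<bar>x\<bar>} * (\<integral>\<^sup>+x. f x \<partial>normal)
      \<le> (\<integral>\<^sup>+x. f x * indicator {x. T < \<bar>x\<bar>} x \<partial>normal)"
    by (rule N.nn_integral_correlated) (auto intro!: mono)
  also have "\<dots> = ?I b + ?I (\<not> b)"
    by (subst nn_integral_add[symmetric]) (auto intro!: nn_integral_cong simp: indicator_def)
  also have "\<dots> = 2 * ?I b" by (simp add: sym mult_2)
  finally have "ennreal (1/2) * (emeasure normal {x. T < \<bar>x\<bar>} * (\<integral>\<^sup>+x. f x \<partial>normal))
      \<le> ennreal (1/2) * (2 * ?I b)"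
    by (rule mult_left_mono) simp
  also have "ennreal (1/2) * (2 * ?I b) = (ennreal (1/2) * ennreal 2) * ?I b"
    by (simp add: mult.assoc)
  also have "ennreal (1/2) * ennreal 2 = 1"
    by (subst ennreal_mult[symmetric]) auto
  finally show ?thesis by (simp add: mult.assoc)
qed

lemma nn_integral_gauss_scale:
  assumes [measurable]: "f \<in> borel_measurable W_space" and "finite A" and c: "0 < c" "c \<le> 1"
  shows "(\<integral>\<^sup>+w. f (\<lambda>e. if e \<in> A then c * w e else w e) \<partial>gauss)
    \<le> ennreal (1 / c) ^ card A * (\<integral>\<^sup>+w. f w \<partial>gauss)"
  using \<open>finite A\<close>
proof (induction A)
  case empty
  then show ?case by simp
next
  case (insert i A)
  define s where "s = (\<lambda>A (w :: edge \<Rightarrow> real) e. if e \<in> A then c * w e else w e)"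
  have s[measurable]: "s A \<in> measurable W_space W_space" for A
    by (rule measurable_W_spaceI) (auto simp: s_def)
  have "(\<integral>\<^sup>+w. f (s (insert i A) w) \<partial>gauss) \<le> ennreal (1 / c) * (\<integral>\<^sup>+w. f (s A w) \<partial>gauss)"
  proof (rule nn_integral_resample_mono[where i = i])
    fix w
    have "s (insert i A) (w(i := y)) = s A (w(i := c * y))" for y
      using insert by (auto simp: s_def)
    then show "(\<integral>\<^sup>+y. f (s (insert i A) (w(i := y))) \<partial>normal)
        \<le> ennreal (1 / c) * (\<integral>\<^sup>+y. f (s A (w(i := y))) \<partial>normal)"
      using c by (simp add: nn_integral_normal_scale[where f="\<lambda>y. f (s A (w(i := y)))"])
  qed auto
  also have "\<dots> \<le> ennreal (1 / c) * (ennreal (1 / c) ^ card A * (\<integral>\<^sup>+w. f w \<partial>gauss))"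
    using insert by (intro mult_left_mono) (auto simp: s_def)
  finally show ?case using insert by (simp add: s_def mult.assoc)
qed

text \<open>Harris' inequality, one edge at a time: in the absolute weight of an edge of
  \<open>K\<close> the factor \<open>G\<close> decreases while the event \<open>S\<close> increases,
  so integrating that edge out splits off its factor. In the application \<open>S\<close> says that
  a path \<rho> is the minimiser and \<open>K\<close> consists of edges off \<rho>.\<close>

lemma nn_integral_gauss_prod_le:
  assumes [measurable]: "G \<in> borel_measurable borel" "S \<in> sets W_space" and "finite K"
    and G: "\<And>x y. \<bar>x\<bar> \<le> \<bar>y\<bar> \<Longrightarrow> G y \<le> G x"
    and S: "\<And>w e y. w \<in> S \<Longrightarrow> e \<in> K \<Longrightarrow> \<bar>w e\<bar> \<le> \<bar>y\<bar> \<Longrightarrow> w(e := y) \<in> S"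
  shows "(\<integral>\<^sup>+w. (\<Prod>e\<in>K. G (w e)) * indicator S w \<partial>gauss)
    \<le> (\<integral>\<^sup>+x. G x \<partial>normal) ^ card K * emeasure gauss S"
  using \<open>finite K\<close> S
proof (induction K)
  case empty
  then show ?case by (simp add: sets_gauss)
next
  case (insert i K)
  interpret N: prob_space normal by (rule prob_space_normal)
  have "(\<integral>\<^sup>+w. (\<Prod>e\<in>insert i K. G (w e)) * indicator S w \<partial>gauss)
      \<le> (\<integral>\<^sup>+x. G x \<partial>normal) * (\<integral>\<^sup>+w. (\<Prod>e\<in>K. G (w e)) * indicator S w \<partial>gauss)"
  proof (rule nn_integral_resample_mono[where i = i])
    fix w
    define S' where "S' = {y. w(i := y) \<in> S}"
    have S': "S' \<in> sets borel"
    proof -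
      have "(\<lambda>y. w(i := y)) \<in> borel \<rightarrow>\<^sub>M W_space"
        by (rule measurable_W_spaceI) (simp add: fun_upd_def)
      from measurable_sets[OF this assms(2)] show ?thesis
        by (simp add: S'_def vimage_def)
    qed
    have GS: "(\<lambda>y. G y * indicator S' y) \<in> borel_measurable normal"
      using borel_measurable_times_ennreal[OF assms(1) borel_measurable_indicator[OF S']] by simp
    have anti: "(\<integral>\<^sup>+y. G y * indicator S' y \<partial>normal) \<le> emeasure normal S' * (\<integral>\<^sup>+y. G y \<partial>normal)"
    proof (rule N.nn_integral_anticorrelated)
      show "S' \<in> N.events" "G \<in> borel_measurable normal" using S' assms(1) by simp_all
      fix x y assume xy: "x \<in> S'" "y \<in> space normal - S'"
      have "\<not> \<bar>x\<bar> \<le> \<bar>y\<bar>"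
      proof
        assume "\<bar>x\<bar> \<le> \<bar>y\<bar>"
        have "w(i := x) \<in> S" "w(i := y) \<notin> S" using xy by (auto simp only: S'_def)
        moreover have "(w(i := x))(i := y) \<in> S"
          by (rule insert.prems(1)[OF calculation(1), of i]) (simp, simp add: \<open>\<bar>x\<bar> \<le> \<bar>y\<bar>\<close>)
        ultimately show False by (simp only: fun_upd_upd)
      qed
      then show "G x \<le> G y" by (intro G[OF less_imp_le]) (simp only: not_le)
    qed
    have "(\<integral>\<^sup>+y. (\<Prod>e\<in>insert i K. G ((w(i := y)) e)) * indicator S (w(i := y)) \<partial>normal)
        = (\<integral>\<^sup>+y. (\<Prod>e\<in>K. G (w e)) * (G y * indicator S' y) \<partial>normal)"
    proof (rule nn_integral_cong)
      fix y
      have "(\<Prod>e\<in>K. G ((w(i := y)) e)) = (\<Prod>e\<in>K. G (w e))"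
        using insert.hyps by (intro prod.cong) auto
      then show "(\<Prod>e\<in>insert i K. G ((w(i := y)) e)) * indicator S (w(i := y))
          = (\<Prod>e\<in>K. G (w e)) * (G y * indicator S' y)"
        using insert.hyps by (simp add: S'_def indicator_def mult.commute)
    qed
    also have "\<dots> = (\<Prod>e\<in>K. G (w e)) * (\<integral>\<^sup>+y. G y * indicator S' y \<partial>normal)"
      by (rule nn_integral_cmult[OF GS])
    also have "\<dots> \<le> (\<Prod>e\<in>K. G (w e)) * (emeasure normal S' * (\<integral>\<^sup>+y. G y \<partial>normal))"
      by (rule mult_left_mono[OF anti]) simp
    also have "\<dots> = (\<integral>\<^sup>+y. G y \<partial>normal) * ((\<Prod>e\<in>K. G (w e)) * emeasure normal S')"
      by (simp only: ac_simps)
    also have "(\<Prod>e\<in>K. G (w e)) * emeasure normal S' = (\<integral>\<^sup>+y. (\<Prod>e\<in>K. G (w e)) * indicator S' y \<partial>normal)"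
      by (rule nn_integral_cmult_indicator[symmetric]) (simp add: S')
    also have "(\<integral>\<^sup>+y. (\<Prod>e\<in>K. G (w e)) * indicator S' y \<partial>normal)
        = (\<integral>\<^sup>+y. (\<Prod>e\<in>K. G ((w(i := y)) e)) * indicator S (w(i := y)) \<partial>normal)"
    proof (rule nn_integral_cong)
      fix y
      have "(\<Prod>e\<in>K. G ((w(i := y)) e)) = (\<Prod>e\<in>K. G (w e))"
        using insert.hyps by (intro prod.cong) auto
      then show "(\<Prod>e\<in>K. G (w e)) * indicator S' y
          = (\<Prod>e\<in>K. G ((w(i := y)) e)) * indicator S (w(i := y))"
        by (simp add: S'_def indicator_def)
    qed
    finally show "(\<integral>\<^sup>+y. (\<Prod>e\<in>insert i K. G ((w(i := y)) e)) * indicator S (w(i := y)) \<partial>normal)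
        \<le> (\<integral>\<^sup>+y. G y \<partial>normal) * (\<integral>\<^sup>+y. (\<Prod>e\<in>K. G ((w(i := y)) e)) * indicator S (w(i := y)) \<partial>normal)" .
  qed auto
  also have "\<dots> \<le> (\<integral>\<^sup>+x. G x \<partial>normal) * ((\<integral>\<^sup>+x. G x \<partial>normal) ^ card K * emeasure gauss S)"
    by (intro mult_left_mono insert.IH) (use insert.prems in blast, simp)
  finally show ?case using insert.hyps by (simp add: mult.assoc)
qed

lemma emeasure_gauss_all_large:
  assumes "finite K"
  shows "emeasure gauss {w. \<forall>e\<in>K. t < \<bar>w e\<bar>} \<le> emeasure normal {x. t < \<bar>x\<bar>} ^ card K"
  using assms
proof (induction K)
  case empty
  interpret prob_space gauss by (rule prob_space_gauss)
  show ?case using emeasure_space_1 by simp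
next
  case (insert i K)
  interpret N: prob_space normal by (rule prob_space_normal)
  have m[measurable]: "{w. \<forall>e\<in>K. t < \<bar>w e\<bar>} \<in> sets W_space" if "finite K" for K
  proof -
    have "Measurable.pred W_space (\<lambda>w. \<forall>e\<in>K. t < \<bar>w e\<bar>)" using that by measurable
    then show ?thesis by (simp add: pred_def)
  qed
  have "(\<integral>\<^sup>+w. indicator {w. \<forall>e\<in>insert i K. t < \<bar>w e\<bar>} w \<partial>gauss)
      \<le> emeasure normal {x. t < \<bar>x\<bar>} * (\<integral>\<^sup>+w. indicator {w. \<forall>e\<in>K. t < \<bar>w e\<bar>} w \<partial>gauss)"
  proof (rule nn_integral_resample_mono[where i = i])
    fix w
    have "(\<integral>\<^sup>+y. indicator {w. \<forall>e\<in>insert i K. t < \<bar>w e\<bar>} (w(i := y)) \<partial>normal)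
        = (\<integral>\<^sup>+y. indicator {w. \<forall>e\<in>K. t < \<bar>w e\<bar>} w * indicator {x. t < \<bar>x\<bar>} y \<partial>normal)"
      using insert by (intro nn_integral_cong) (auto simp: indicator_def)
    also have "\<dots> = indicator {w. \<forall>e\<in>K. t < \<bar>w e\<bar>} w * emeasure normal {x. t < \<bar>x\<bar>}"
      by (rule nn_integral_cmult_indicator) auto
    also have "\<dots> = emeasure normal {x. t < \<bar>x\<bar>} *
        (\<integral>\<^sup>+y. indicator {w. \<forall>e\<in>K. t < \<bar>w e\<bar>} w \<partial>normal)"
      using N.emeasure_space_1 by (simp add: mult.commute)
    also have "(\<integral>\<^sup>+y. indicator {w. \<forall>e\<in>K. t < \<bar>w e\<bar>} w \<partial>normal)
        = (\<integral>\<^sup>+y. (indicator {w. \<forall>e\<in>K. t < \<bar>w e\<bar>} (w(i := y)) :: ennreal) \<partial>normal)"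
      using insert by (intro nn_integral_cong) (auto simp: indicator_def)
    finally show "(\<integral>\<^sup>+y. indicator {w. \<forall>e\<in>insert i K. t < \<bar>w e\<bar>} (w(i := y)) \<partial>normal)
       \<le> emeasure normal {x. t < \<bar>x\<bar>} *
         (\<integral>\<^sup>+y. indicator {w. \<forall>e\<in>K. t < \<bar>w e\<bar>} (w(i := y)) \<partial>normal)" by (rule eq_refl)
  qed (use insert in auto)
  also have "(\<integral>\<^sup>+w. indicator {w. \<forall>e\<in>K. t < \<bar>w e\<bar>} w \<partial>gauss) \<le> emeasure normal {x. t < \<bar>x\<bar>} ^ card K"
    using insert.IH insert.hyps by (simp add: sets_gauss)
  finally show ?case
    using insert.hyps m[of "insert i K"] nn_integral_indicator[of "{w. \<forall>e\<in>insert i K. t < \<bar>w e\<bar>}" gauss]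
    by (simp add: sets_gauss mult_left_mono)
qed

text \<open>Kept out of the measurability prover from here on: the pattern \<open>w e\<close> matches every application.\<close>

declare measurable_coord [measurable del] measurable_update [measurable del]

subsection \<open>The dual lattice\<close>

definition cut :: "vert set \<Rightarrow> edge set" where
  "cut V = {e. (end1 e \<in> V) \<noteq> (end2 e \<in> V)}"

text \<open>The edge crossed by the dual step from \<open>p\<close> to \<open>q\<close>, meaningful
  for adjacent arguments. Dual vertices sit at half-integer shifts, so \<open>max\<close> picks the
  lattice line lying between the two.\<close>

definition dedge :: "vert \<Rightarrow> vert \<Rightarrow> edge" where
  "dedge p q = (if snd p = snd q then ((max (fst p) (fst q), snd p), True)
                else ((fst p, max (snd p) (snd q)), False))"

lemma dual_ends_dedge: "lat_adj p q \<Longrightarrow> dual_ends (dedge p q) = {p, q}"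
  by (cases p; cases q) (auto simp: dual_ends_def dedge_def lat_adj_def max_def)

lemma dedge_commute: "lat_adj p q \<Longrightarrow> dedge p q = dedge q p"
  by (cases p; cases q) (auto simp: dedge_def lat_adj_def max_def)

lemma lat_adj_commute: "lat_adj p q \<longleftrightarrow> lat_adj q p"
  by (auto simp: lat_adj_def)

lemma lat_adj_neq: "lat_adj p q \<Longrightarrow> p \<noteq> q"
  by (auto simp: lat_adj_def)

lemma dual_ends_cases: obtains p q where "lat_adj p q" "dual_ends e = {p, q}" "e = dedge p q"
proof (cases e)
  case (Pair x b)
  show thesis
  proof (cases b)
    case True
    with Pair show thesis
      by (intro that[of "(fst x - 1, snd x)" x])
        (auto simp: dual_ends_def dedge_def lat_adj_def max_def prod_eq_iff)
  next
    case False
    with Pair show thesis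
      by (intro that[of "(fst x, snd x - 1)" x])
        (auto simp: dual_ends_def dedge_def lat_adj_def max_def prod_eq_iff)
  qed
qed

lemma dual_ends_eqD:
  assumes "dual_ends e = {p, q}"
  shows "lat_adj p q \<and> e = dedge p q"
proof -
  obtain p' q' where *: "lat_adj p' q'" "dual_ends e = {p', q'}" "e = dedge p' q'"
    by (rule dual_ends_cases)
  then have "(p = p' \<and> q = q') \<or> (p = q' \<and> q = p')"
    using assms lat_adj_neq by (auto simp: doubleton_eq_iff)
  then show ?thesis using * dedge_commute[of p' q'] lat_adj_commute[of p' q'] by auto
qed

lemma dedge_inject: "lat_adj x y \<Longrightarrow> lat_adj x z \<Longrightarrow> dedge x y = dedge x z \<longleftrightarrow> y = z"
  using dual_ends_dedge[of x y] dual_ends_dedge[of x z] by (auto simp: doubleton_eq_iff)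

subsection \<open>Even sets of dual edges are cuts\<close>

text \<open>Odd degree of the dual vertex \<open>(a, b)\<close> in \<open>Z\<close>, as an exclusive
  or over the four sides of the plaquette with lower left corner \<open>(a, b)\<close>.\<close>

fun dual_parity :: "edge set \<Rightarrow> vert \<Rightarrow> bool" where
  "dual_parity Z (a, b) \<longleftrightarrow>
    (((a, b), False) \<in> Z) \<noteq> ((((a, b + 1), False) \<in> Z) \<noteq>
    ((((a, b), True) \<in> Z) \<noteq> (((a + 1, b), True) \<in> Z)))"

text \<open>\<open>V\<close> consists of the vertices whose horizontal ray to the right meets
  \<open>Z\<close> an odd number of times. Crossing a horizontal edge changes this parity exactly if
  the edge is in \<open>Z\<close>; for vertical edges the same follows from evenness at the
  plaquettes.\<close>

lemma even_is_cut:
  assumes "finite Z" and even: "\<And>q. \<not> dual_parity Z q"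
  shows "\<exists>V. finite V \<and> cut V = Z"
proof -
  define R where "R x y = odd (card {k. x \<le> k \<and> ((k, y), False) \<in> Z})" for x y
  have "finite ((\<lambda>e. \<bar>fst (fst e)\<bar>) ` Z \<union> (\<lambda>e. \<bar>snd (fst e)\<bar>) ` Z)"
    using assms by auto
  then obtain M where "\<And>k. k \<in> (\<lambda>e. \<bar>fst (fst e)\<bar>) ` Z \<union> (\<lambda>e. \<bar>snd (fst e)\<bar>) ` Z \<Longrightarrow> k \<le> M"
    using bdd_above_finite[unfolded bdd_above_def] by metis
  then have M: "\<bar>x\<bar> \<le> M" "\<bar>y\<bar> \<le> M" if "((x, y), b) \<in> Z" for x y b
    using that by force+
  have fin: "finite {k. x \<le> k \<and> ((k, y), False) \<in> Z}" for x y
    by (rule finite_subset[of _ "{-M..M}"]) (use M in force, simp)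
  have step: "R x y = ((((x, y), False) \<in> Z) \<noteq> R (x + 1) y)" for x y
  proof -
    have "{k. x \<le> k \<and> ((k, y), False) \<in> Z} =
        (if ((x, y), False) \<in> Z then insert x {k. x + 1 \<le> k \<and> ((k, y), False) \<in> Z}
         else {k. x + 1 \<le> k \<and> ((k, y), False) \<in> Z})"
      by (auto simp: order.order_iff_strict)
    then show ?thesis using fin[of "x + 1" y] by (simp add: R_def)
  qed
  have right: "\<not> R x y" if "M < x" for x y
  proof -
    have "{k. x \<le> k \<and> ((k, y), False) \<in> Z} = {}" using that M by force
    then show ?thesis unfolding R_def by (metis card.empty even_zero)
  qed
  have top: "\<not> R x y" if "M < y" for x y
  proof -
    have "{k. x \<le> k \<and> ((k, y), False) \<in> Z} = {}" using that M by force
    then show ?thesis unfolding R_def by (metis card.empty even_zero)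
  qed
  \<comment> \<open>Induction leftwards from a column beyond \<open>M\<close>, where both sides are
    false. The plaquette \<open>(i - 1, y)\<close> has an even number of sides in \<open>Z\<close>,
    which carries the equivalence over one column.\<close>
  have vert: "(R x y \<noteq> R x (y + 1)) \<longleftrightarrow> ((x, y), True) \<in> Z" for x y
  proof (cases "M < x")
    case True
    then show ?thesis using right M[of x y True] by fastforce
  next
    case False
    then have "x \<le> M + 1" by simp
    then show ?thesis
    proof (induction x rule: int_le_induct)
      case base
      then show ?case using right[of "M + 1"] M[of "M + 1" y True] by auto
    next
      case (step i)
      then show ?case
        using step even[of "(i - 1, y)"] \<open>\<And>y x. R x y = ((((x, y), False) \<in> Z) \<noteq> R (x + 1) y)\<close>[of "i - 1"]
        by auto
    qed
  qed
  \<comment> \<open>A column left of the box contains no vertical edge of \<open>Z\<close>, so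
    \<open>R\<close> keeps on it the value that it has above the box.\<close>
  have left: "\<not> R x y" if "x < - M" for x y
  proof (cases "M < y")
    case True
    then show ?thesis by (rule top)
  next
    case False
    then have "y \<le> M + 1" by simp
    then show ?thesis
    proof (induction y rule: int_le_induct)
      case base
      then show ?case by (intro top) simp
    next
      case (step i)
      then show ?case using vert[of x "i - 1"] M[of x "i - 1" True] that by auto
    qed
  qed
  have bottom: "\<not> R x y" if "y < - M" for x y
  proof (cases "M < x")
    case True
    then show ?thesis by (rule right)
  next
    case False
    then have "x \<le> M + 1" by simp
    then show ?thesis
    proof (induction x rule: int_le_induct)
      case base
      then show ?case by (intro right) simp
    next
      case (step i)
      have "((i - 1, y), False) \<notin> Z" using M[of "i - 1" y False] that by auto
      with step show ?case
        using \<open>\<And>y x. R x y = ((((x, y), False) \<in> Z) \<noteq> R (x + 1) y)\<close>[of "i - 1" y] by simp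
    qed
  qed
  define V where "V = {p. R (fst p) (snd p)}"
  have "V \<subseteq> {-M..M} \<times> {-M..M}"
  proof
    fix p assume "p \<in> V"
    then have "R (fst p) (snd p)" by (simp add: V_def)
    then show "p \<in> {-M..M} \<times> {-M..M}"
      using left[of "fst p" "snd p"] right[of "fst p" "snd p"] top[of "snd p" "fst p"]
        bottom[of "snd p" "fst p"] by (cases p) force
  qed
  then have "finite V" by (rule finite_subset) simp
  moreover have "cut V = Z"
  proof -
    have "e \<in> cut V \<longleftrightarrow> e \<in> Z" for e
    proof -
      obtain x y b where e: "e = ((x, y), b)" by (metis surj_pair)
      show ?thesis
        using step[of x y] vert[of x y]
        by (cases b) (auto simp: e cut_def V_def end1_def end2_def)
    qed
    then show ?thesis by blast
  qed
  ultimately show ?thesis by blast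
qed

subsection \<open>Self-avoiding dual paths\<close>

fun pedges :: "vert list \<Rightarrow> edge set" where
  "pedges (p # q # ps) = insert (dedge p q) (pedges (q # ps))"
| "pedges _ = {}"

definition dpath :: "vert list \<Rightarrow> bool" where
  "dpath \<pi> \<longleftrightarrow> \<pi> \<noteq> [] \<and> distinct \<pi> \<and> successively lat_adj \<pi>"

lemma finite_pedges [simp]: "finite (pedges \<pi>)"
  by (induction \<pi> rule: pedges.induct) auto

lemma dual_ends_pedges: "successively lat_adj \<pi> \<Longrightarrow> e \<in> pedges \<pi> \<Longrightarrow> dual_ends e \<subseteq> set \<pi>"
  by (induction \<pi> rule: pedges.induct) (auto simp: dual_ends_dedge)

lemma dpath_Cons2:
  "dpath (p # q # ps) \<longleftrightarrow> lat_adj p q \<and> p \<notin> set (q # ps) \<and> dpath (q # ps)"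
  by (auto simp: dpath_def)

lemma dedge_notin_pedges:
  "dpath (p # q # ps) \<Longrightarrow> dedge p q \<notin> pedges (q # ps)"
  using dual_ends_pedges[of "q # ps" "dedge p q"] dual_ends_dedge[of p q]
  by (auto simp: dpath_def)

lemma card_pedges: "dpath \<pi> \<Longrightarrow> card (pedges \<pi>) = length \<pi> - 1"
proof (induction \<pi> rule: pedges.induct)
  case (1 p q ps)
  then show ?case using dedge_notin_pedges[of p q ps] by (simp add: dpath_Cons2)
qed auto

lemma dual_parity_insert:
  "e \<notin> Z \<Longrightarrow> dual_parity (insert e Z) q \<longleftrightarrow> dual_parity Z q \<noteq> (q \<in> dual_ends e)"
proof -
  obtain a b x y d where "q = (a, b)" "e = ((x, y), d)" by (metis surj_pair)
  then show "e \<notin> Z \<Longrightarrow> ?thesis" by (cases d) (auto simp: dual_ends_def)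
qed

lemma dual_parity_sym_diff:
  "dual_parity (sym_diff A B) q \<longleftrightarrow> dual_parity A q \<noteq> dual_parity B q"
  by (cases q) auto

text \<open>Inner vertices have degree two and the ends degree one. The exclusive or also covers the
  path with a single vertex, whose two ends coincide.\<close>

lemma dual_parity_pedges:
  "dpath \<pi> \<Longrightarrow> dual_parity (pedges \<pi>) q \<longleftrightarrow> (q = hd \<pi>) \<noteq> (q = last \<pi>)"
proof (induction \<pi> rule: pedges.induct)
  case (1 p p' ps)
  then have "dual_parity (pedges (p' # ps)) q \<longleftrightarrow> (q = p') \<noteq> (q = last (p' # ps))"
    and "dual_ends (dedge p p') = {p, p'}" and "p \<noteq> last (p' # ps)" "p \<noteq> p'"
    using last_in_set[of "p' # ps"] by (auto simp: dpath_Cons2 dual_ends_dedge simp del: last_in_set)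
  then show ?case
    using dedge_notin_pedges[OF 1(2)] by (auto simp: dual_parity_insert)
next
  case ("2_2" p)
  then show ?case by (cases q) simp
qed (auto simp: dpath_def)

lemma dpath_cut:
  assumes "dpath \<pi>" "dpath \<rho>" "hd \<pi> = hd \<rho>" "last \<pi> = last \<rho>"
  obtains V where "finite V" "cut V = sym_diff (pedges \<pi>) (pedges \<rho>)"
proof -
  have "\<exists>V. finite V \<and> cut V = sym_diff (pedges \<pi>) (pedges \<rho>)"
    by (rule even_is_cut) (use assms in \<open>auto simp: dual_parity_sym_diff dual_parity_pedges simp del: dual_parity.simps\<close>)
  with that show thesis by blast
qed

lemma pedges_append: "pedges (xs @ p # ys) = pedges (xs @ [p]) \<union> pedges (p # ys)"
  by (induction xs rule: pedges.induct) auto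

text \<open>By self-avoidance \<open>p\<close> is visited once, so only the step into it and the
  step out of it touch it.\<close>

lemma pedges_incident:
  assumes "dpath (xs @ p # ys)" "e \<in> pedges (xs @ p # ys)" "p \<in> dual_ends e"
  shows "xs \<noteq> [] \<and> e = dedge (last xs) p \<or> ys \<noteq> [] \<and> e = dedge p (hd ys)"
proof -
  have "e \<in> pedges (xs @ [p]) \<or> e \<in> pedges (p # ys)"
    using assms(2) by (subst (asm) pedges_append) auto
  then show ?thesis
  proof
    assume e: "e \<in> pedges (xs @ [p])"
    show ?thesis
    proof (cases xs rule: rev_cases)
      case (snoc zs z)
      then have "e \<in> pedges (zs @ [z]) \<or> e = dedge z p"
        using e by (auto simp: pedges_append[of zs z "[p]"])
      moreover have "e \<notin> pedges (zs @ [z])"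
        using dual_ends_pedges[of "zs @ [z]" e] assms(1,3)
        by (auto simp: dpath_def snoc successively_append_iff)
      ultimately show ?thesis using snoc by simp
    qed (use e in simp)
  next
    assume e: "e \<in> pedges (p # ys)"
    show ?thesis
    proof (cases ys)
      case (Cons z zs)
      then have "e \<in> pedges (z # zs) \<or> e = dedge p z"
        using e by auto
      moreover have "e \<notin> pedges (z # zs)"
        using dual_ends_pedges[of "z # zs" e] assms(1,3)
        by (auto simp: dpath_def Cons successively_append_iff)
      ultimately show ?thesis using Cons by simp
    qed (use e in simp)
  qed
qed

subsection \<open>Counting\<close>

text \<open>Here \<open>n\<close> counts steps, hence the list has \<open>n + 1\<close>
  vertices.\<close>

definition saws :: "vert \<Rightarrow> nat \<Rightarrow> vert list set" where
  "saws u n = {\<pi>. dpath \<pi> \<and> hd \<pi> = u \<and> length \<pi> = Suc n}"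

lemma lat_adj_nbrs: "{z. lat_adj x z} = {(fst x + 1, snd x), (fst x - 1, snd x), (fst x, snd x + 1), (fst x, snd x - 1)}"
  by (cases x) (auto simp: lat_adj_def)

lemma finite_nbrs [simp]: "finite {z. lat_adj x z}"
  by (simp add: lat_adj_nbrs)

lemma card_nbrs: "card {z. lat_adj x z} = 4"
  by (simp add: lat_adj_nbrs)

lemma sum_UNION_le:
  fixes f :: "'a \<Rightarrow> real"
  assumes "finite I" "\<And>i. i \<in> I \<Longrightarrow> finite (A i)" "\<And>x. 0 \<le> f x"
  shows "sum f (\<Union>i\<in>I. A i) \<le> (\<Sum>i\<in>I. sum f (A i))"
  using assms(1,2)
proof (induction I)
  case (insert i I)
  have "sum f (A i \<union> (\<Union>i\<in>I. A i)) \<le> sum f (A i) + sum f (\<Union>i\<in>I. A i)"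
    using insert assms(3) by (subst sum_Un) (auto intro!: sum_nonneg)
  then show ?case using insert by fastforce
qed simp

lemma saws_0: "saws u 0 = {[u]}"
  by (auto simp: saws_def dpath_def length_Suc_conv)

lemma saws_Suc: "saws u (Suc n) \<subseteq> (\<Union>z\<in>{z. lat_adj u z}. (#) u ` saws z n)"
proof
  fix \<pi> assume "\<pi> \<in> saws u (Suc n)"
  then have *: "dpath \<pi>" "hd \<pi> = u" "length \<pi> = Suc (Suc n)" by (auto simp: saws_def)
  then obtain z zs where "\<pi> = u # z # zs" by (cases \<pi>; cases "tl \<pi>") auto
  with * show "\<pi> \<in> (\<Union>z\<in>{z. lat_adj u z}. (#) u ` saws z n)"
    by (intro UN_I[of z] image_eqI[of _ _ "z # zs"]) (simp_all add: saws_def dpath_Cons2)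
qed

lemma finite_saws [simp]: "finite (saws u n)"
proof (induction n arbitrary: u)
  case (Suc n)
  then show ?case by (intro finite_subset[OF saws_Suc]) auto
qed (simp add: saws_0)

lemma card_saws: "card (saws u n) \<le> 4 ^ n"
proof (induction n arbitrary: u)
  case (Suc n)
  have "card (saws u (Suc n)) \<le> card (\<Union>z\<in>{z. lat_adj u z}. (#) u ` saws z n)"
    by (intro card_mono saws_Suc) auto
  also have "\<dots> \<le> (\<Sum>z\<in>{z. lat_adj u z}. card ((#) u ` saws z n))"
    by (intro card_UN_le) simp
  also have "\<dots> \<le> (\<Sum>z\<in>{z. lat_adj u z}. 4 ^ n)"
    by (intro sum_mono order_trans[OF card_image_le]) (auto simp: Suc)
  also have "\<dots> = 4 ^ Suc n" by (simp add: card_nbrs)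
  finally show ?case .
qed (simp add: saws_0)

lemma saws_last: "\<pi> \<in> saws u n \<Longrightarrow> \<bar>fst (last \<pi>) - fst u\<bar> + \<bar>snd (last \<pi>) - snd u\<bar> \<le> int n"
proof (induction n arbitrary: u \<pi>)
  case (Suc n)
  then obtain z \<rho> where z: "lat_adj u z" and \<rho>: "\<rho> \<in> saws z n" "\<pi> = u # \<rho>"
    using saws_Suc[of u n] by blast
  then have "last \<pi> = last \<rho>" by (auto simp: saws_def)
  with Suc.IH[OF \<rho>(1)] z show ?case by (auto simp: lat_adj_def)
qed (auto simp: saws_0)

text \<open>The comparison of paths requires common end points; this shows that fixing the last
  vertex costs only a polynomial factor.\<close>

lemma card_saws_last: "card (last ` saws u n) \<le> (2 * n + 1) ^ 2"
proof -
  let ?B = "{fst u - int n..fst u + int n} \<times> {snd u - int n..snd u + int n}"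
  have "last ` saws u n \<subseteq> ?B"
  proof
    fix v assume "v \<in> last ` saws u n"
    then have "\<bar>fst v - fst u\<bar> + \<bar>snd v - snd u\<bar> \<le> int n" using saws_last by blast
    then show "v \<in> ?B" by (cases v) auto
  qed
  then have "card (last ` saws u n) \<le> card ?B" by (intro card_mono) auto
  also have "card ?B = (2 * n + 1) ^ 2"
  proof -
    have "card {a - int n..a + int n} = 2 * n + 1" for a
      by (simp add: nat_eq_iff)
    then show ?thesis by (simp add: card_cartesian_product power2_eq_square del: card_atLeastAtMost_int)
  qed
  finally show ?thesis .
qed

lemma dpath_degree_le_2:
  assumes "dpath \<rho>"
  shows "card {z. lat_adj x z \<and> dedge x z \<in> pedges \<rho>} \<le> 2"
proof (cases "x \<in> set \<rho>")
  case True
  then obtain xs ys where \<rho>: "\<rho> = xs @ x # ys" by (meson split_list)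
  have "{z. lat_adj x z \<and> dedge x z \<in> pedges \<rho>} \<subseteq> {last xs, hd ys}"
  proof
    fix z assume z: "z \<in> {z. lat_adj x z \<and> dedge x z \<in> pedges \<rho>}"
    then have de: "dual_ends (dedge x z) = {x, z}" by (simp add: dual_ends_dedge)
    have "xs \<noteq> [] \<and> dedge x z = dedge (last xs) x \<or> ys \<noteq> [] \<and> dedge x z = dedge x (hd ys)"
      using assms z de by (intro pedges_incident) (auto simp: \<rho>)
    moreover have "xs \<noteq> [] \<Longrightarrow> lat_adj (last xs) x" "ys \<noteq> [] \<Longrightarrow> lat_adj x (hd ys)"
      using assms by (auto simp: \<rho> dpath_def successively_append_iff successively_Cons)
    ultimately show "z \<in> {last xs, hd ys}"
      using z dedge_inject[of x z] dedge_commute lat_adj_commute by (metis insertCI mem_Collect_eq)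
  qed
  then have "card {z. lat_adj x z \<and> dedge x z \<in> pedges \<rho>} \<le> card {last xs, hd ys}"
    by (intro card_mono) auto
  also have "\<dots> \<le> 2" by (simp add: card_insert_if)
  finally show ?thesis .
next
  case False
  have "{z. lat_adj x z \<and> dedge x z \<in> pedges \<rho>} = {}"
    using False assms dual_ends_pedges[of \<rho>] dual_ends_dedge[of x] by (fastforce simp: dpath_def)
  then show ?thesis by (metis card.empty zero_le)
qed

text \<open>A step inside \<open>\<rho>\<close> is forced unless the preceding step was outside \<open>\<rho>\<close>, in which case it
  can be taken in two directions; this is the reason for the two cases in the bound.\<close>

lemma sum_saws_outside_step:
  fixes \<psi> :: real
  assumes \<rho>: "dpath \<rho>" and \<psi>: "0 \<le> \<psi>" and yx: "lat_adj y x"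
  shows "(\<Sum>\<pi> | \<pi> \<in> saws x n \<and> y \<notin> set \<pi>. \<psi> ^ card (pedges \<pi> - pedges \<rho>))
    \<le> (if dedge y x \<in> pedges \<rho> then 1 else 2) * (1 + 6 * \<psi>) ^ n"
  using yx
proof (induction n arbitrary: x y)
  case 0
  have "{\<pi>. \<pi> \<in> saws x 0 \<and> y \<notin> set \<pi>} = {[x]}"
    using lat_adj_neq[OF 0] by (auto simp: saws_0)
  then show ?case by simp
next
  case (Suc n)
  let ?L = "1 + 6 * \<psi>"
  let ?S = "\<lambda>y x n. {\<pi>. \<pi> \<in> saws x n \<and> y \<notin> set \<pi>}"
  let ?g = "\<lambda>\<pi>. \<psi> ^ card (pedges \<pi> - pedges \<rho>)"
  let ?Z = "{z. lat_adj x z \<and> z \<noteq> y}"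
  let ?R = "{z. lat_adj x z \<and> dedge x z \<in> pedges \<rho>}"
  have finZ: "finite ?Z" and finR: "finite ?R"
    by (rule finite_subset[OF _ finite_nbrs[of x]], blast)+
  have sub: "?S y x (Suc n) \<subseteq> (\<Union>z\<in>?Z. (#) x ` ?S x z n)"
  proof
    fix \<pi> assume \<pi>: "\<pi> \<in> ?S y x (Suc n)"
    then obtain z \<sigma> where z: "lat_adj x z" "\<sigma> \<in> saws z n" "\<pi> = x # \<sigma>"
      using saws_Suc[of x n] by blast
    then have "z \<in> set \<sigma>" by (cases \<sigma>) (auto simp: saws_def)
    moreover have "x \<notin> set \<sigma>" "y \<notin> set \<sigma>" using \<pi> z by (auto simp: saws_def dpath_def)
    ultimately show "\<pi> \<in> (\<Union>z\<in>?Z. (#) x ` ?S x z n)" using z by blast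
  qed
  have g: "?g (x # \<sigma>) = (if dedge x z \<in> pedges \<rho> then 1 else \<psi>) * ?g \<sigma>"
    if "lat_adj x z" "\<sigma> \<in> ?S x z n" for z \<sigma>
  proof -
    have "\<sigma> = z # tl \<sigma>" using that(2) by (auto simp: saws_def dpath_def)
    then obtain \<sigma>' where \<sigma>: "\<sigma> = z # \<sigma>'" by blast
    have "dpath (x # z # \<sigma>')" using that by (auto simp: \<sigma> saws_def dpath_def)
    from dedge_notin_pedges[OF this] show ?thesis
      by (simp add: \<sigma> insert_Diff_if)
  qed
  have bound: "(\<Sum>\<pi>\<in>?S y x (Suc n). ?g \<pi>)
      \<le> (\<Sum>z\<in>?Z. if z \<in> ?R then ?L ^ n else 2 * \<psi> * ?L ^ n)"
  proof -
    have "(\<Sum>\<pi>\<in>?S y x (Suc n). ?g \<pi>) \<le> (\<Sum>\<pi>\<in>(\<Union>z\<in>?Z. (#) x ` ?S x z n). ?g \<pi>)"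
      by (intro sum_mono2 sub) (use finZ \<psi> in auto)
    also have "\<dots> \<le> (\<Sum>z\<in>?Z. \<Sum>\<pi>\<in>(#) x ` ?S x z n. ?g \<pi>)"
      by (intro sum_UNION_le) (use finZ \<psi> in auto)
    also have "\<dots> \<le> (\<Sum>z\<in>?Z. if z \<in> ?R then ?L ^ n else 2 * \<psi> * ?L ^ n)"
    proof (rule sum_mono)
      fix z assume z: "z \<in> ?Z"
      have "(\<Sum>\<pi>\<in>(#) x ` ?S x z n. ?g \<pi>) = (\<Sum>\<sigma>\<in>?S x z n. ?g (x # \<sigma>))"
        by (subst sum.reindex) auto
      also have "\<dots> = (if dedge x z \<in> pedges \<rho> then 1 else \<psi>) * (\<Sum>\<sigma>\<in>?S x z n. ?g \<sigma>)"
        unfolding sum_distrib_left by (intro sum.cong g) (use z in auto)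
      also have "\<dots> \<le> (if dedge x z \<in> pedges \<rho> then 1 else \<psi>) *
          ((if dedge x z \<in> pedges \<rho> then 1 else 2) * ?L ^ n)"
        by (intro mult_left_mono Suc.IH) (use z \<psi> in auto)
      also have "\<dots> = (if z \<in> ?R then ?L ^ n else 2 * \<psi> * ?L ^ n)"
        using z by simp
      finally show "(\<Sum>\<pi>\<in>(#) x ` ?S x z n. ?g \<pi>) \<le> (if z \<in> ?R then ?L ^ n else 2 * \<psi> * ?L ^ n)" .
    qed
    finally show ?thesis .
  qed
  also have "\<dots> = (\<Sum>z\<in>?Z \<inter> ?R. ?L ^ n) + (\<Sum>z\<in>?Z - ?R. 2 * \<psi> * ?L ^ n)"
    by (subst sum.If_cases[OF finZ]) (simp add: Diff_eq Collect_neg_eq)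
  also have "\<dots> = (card (?Z \<inter> ?R) + 2 * \<psi> * card (?Z - ?R)) * ?L ^ n"
    by (simp add: algebra_simps)
  \<comment> \<open>The 6 is 3 times 2: three directions other than back to \<open>y\<close>, each
    with the factor 2 that the induction hypothesis gives after a step off \<rho>. Within \<rho> the
    degree at \<open>x\<close> is at most two, and an arrival along \<rho> uses up one of the two
    edges.\<close>
  also have "\<dots> \<le> ((if dedge y x \<in> pedges \<rho> then 1 else 2) + 6 * \<psi>) * ?L ^ n"
  proof (intro mult_right_mono add_mono)
    have yx': "lat_adj x y" "dedge x y = dedge y x"
      using Suc.prems by (simp_all add: lat_adj_commute dedge_commute)
    have R: "card ?R \<le> 2" by (rule dpath_degree_le_2[OF \<rho>])
    have "card (?Z \<inter> ?R) \<le> (if dedge y x \<in> pedges \<rho> then 1 else 2)"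
    proof (cases "dedge y x \<in> pedges \<rho>")
      case True
      then have "y \<in> ?R" using yx' by simp
      then have "card (?R - {y}) \<le> 1" using R finR by (simp add: card_Diff_singleton)
      moreover have "?Z \<inter> ?R = ?R - {y}" by auto
      ultimately show ?thesis using True by simp
    next
      case False
      have "card (?Z \<inter> ?R) \<le> card ?R" by (intro card_mono finR) auto
      then show ?thesis using R False by simp
    qed
    then show "real (card (?Z \<inter> ?R)) \<le> (if dedge y x \<in> pedges \<rho> then 1 else 2)"
      by (cases "dedge y x \<in> pedges \<rho>") auto
    have "?Z = {z. lat_adj x z} - {y}" by auto
    then have "card ?Z = 3" using yx' by (simp add: card_Diff_singleton card_nbrs)
    then have "card (?Z - ?R) \<le> 3" using card_mono[OF finZ, of "?Z - ?R"] by auto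
    then have "real (card (?Z - ?R)) \<le> 3" by simp
    then have "2 * \<psi> * real (card (?Z - ?R)) \<le> 2 * \<psi> * 3" using \<psi> by (intro mult_left_mono) auto
    then show "2 * \<psi> * real (card (?Z - ?R)) \<le> 6 * \<psi>" by simp
  qed (use \<psi> in auto)
  also have "\<dots> \<le> (if dedge y x \<in> pedges \<rho> then 1 else 2) * ?L * ?L ^ n"
    using \<psi> by (intro mult_right_mono) (auto simp: algebra_simps)
  finally show ?case by (simp add: mult.assoc)
qed

text \<open>The first step has no predecessor and is estimated crudely: four directions, each with
  the factor 2 of the previous bound, give the 8.\<close>

lemma sum_saws_outside:
  fixes \<psi> :: real
  assumes \<rho>: "dpath \<rho>" and \<psi>: "0 \<le> \<psi>" "\<psi> \<le> 1"
  shows "(\<Sum>\<pi>\<in>saws u n. \<psi> ^ card (pedges \<pi> - pedges \<rho>)) \<le> 8 * (1 + 6 * \<psi>) ^ n"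
proof (cases n)
  case 0
  then show ?thesis by (simp add: saws_0)
next
  case (Suc m)
  let ?g = "\<lambda>\<pi>. \<psi> ^ card (pedges \<pi> - pedges \<rho>)"
  let ?S = "\<lambda>y x n. {\<pi>. \<pi> \<in> saws x n \<and> y \<notin> set \<pi>}"
  have sub: "saws u n \<subseteq> (\<Union>z\<in>{z. lat_adj u z}. (#) u ` ?S u z m)"
  proof
    fix \<pi> assume \<pi>: "\<pi> \<in> saws u n"
    then obtain z \<sigma> where z: "lat_adj u z" "\<sigma> \<in> saws z m" "\<pi> = u # \<sigma>"
      using saws_Suc[of u m] Suc by blast
    moreover have "u \<notin> set \<sigma>" using \<pi> z by (auto simp: saws_def dpath_def)
    ultimately show "\<pi> \<in> (\<Union>z\<in>{z. lat_adj u z}. (#) u ` ?S u z m)" by blast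
  qed
  have "(\<Sum>\<pi>\<in>saws u n. ?g \<pi>) \<le> (\<Sum>\<pi>\<in>(\<Union>z\<in>{z. lat_adj u z}. (#) u ` ?S u z m). ?g \<pi>)"
    by (intro sum_mono2 sub) (use \<psi> in auto)
  also have "\<dots> \<le> (\<Sum>z\<in>{z. lat_adj u z}. \<Sum>\<pi>\<in>(#) u ` ?S u z m. ?g \<pi>)"
    by (intro sum_UNION_le) (use \<psi> in auto)
  also have "\<dots> \<le> (\<Sum>z\<in>{z. lat_adj u z}. 2 * (1 + 6 * \<psi>) ^ m)"
  proof (rule sum_mono)
    fix z assume z: "z \<in> {z. lat_adj u z}"
    have "(\<Sum>\<pi>\<in>(#) u ` ?S u z m. ?g \<pi>) = (\<Sum>\<sigma>\<in>?S u z m. ?g (u # \<sigma>))"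
      by (subst sum.reindex) auto
    also have "\<dots> \<le> (\<Sum>\<sigma>\<in>?S u z m. ?g \<sigma>)"
    proof (intro sum_mono power_decreasing card_mono)
      fix \<sigma> assume "\<sigma> \<in> ?S u z m"
      then show "pedges \<sigma> - pedges \<rho> \<subseteq> pedges (u # \<sigma>) - pedges \<rho>"
        by (cases \<sigma>) (auto simp: saws_def)
    qed (use \<psi> in auto)
    also have "\<dots> \<le> (if dedge u z \<in> pedges \<rho> then 1 else 2) * (1 + 6 * \<psi>) ^ m"
      using z by (intro sum_saws_outside_step \<rho> \<psi>) auto
    also have "\<dots> \<le> 2 * (1 + 6 * \<psi>) ^ m" using \<psi> by (intro mult_right_mono) auto
    finally show "(\<Sum>\<pi>\<in>(#) u ` ?S u z m. ?g \<pi>) \<le> 2 * (1 + 6 * \<psi>) ^ m" .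
  qed
  also have "\<dots> = 8 * (1 + 6 * \<psi>) ^ m" by (simp add: card_nbrs)
  also have "\<dots> \<le> 8 * (1 + 6 * \<psi>) ^ n"
    using \<psi> Suc by (intro mult_left_mono power_increasing) auto
  finally show ?thesis .
qed

subsection \<open>Flipping a finite region\<close>

abbreviation satis :: "(edge \<Rightarrow> real) \<Rightarrow> (vert \<Rightarrow> int) \<Rightarrow> edge \<Rightarrow> real" where
  "satis w \<sigma> e \<equiv> w e * real_of_int (\<sigma> (end1 e) * \<sigma> (end2 e))"

definition flipped :: "vert set \<Rightarrow> (vert \<Rightarrow> int) \<Rightarrow> vert \<Rightarrow> int" where
  "flipped V \<sigma> x = (if x \<in> V then - \<sigma> x else \<sigma> x)"

lemma lat_adj_ends: "lat_adj (end1 e) (end2 e)"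
  by (auto simp: lat_adj_def end1_def end2_def)

lemma finite_closure_set: "finite V \<Longrightarrow> finite (closure_set V)"
proof -
  assume "finite V"
  have fin: "finite {y. lat_adj x y}" for x
  proof (rule finite_subset)
    show "{y. lat_adj x y} \<subseteq> {fst x - 1..fst x + 1} \<times> {snd x - 1..snd x + 1}"
      by (auto simp: lat_adj_def)
  qed simp
  have sub: "closure_set V \<subseteq> V \<union> (\<Union>x\<in>V. {y. lat_adj x y})"
    by (auto simp: closure_set_def)
  show ?thesis
    by (intro finite_subset[OF sub] finite_UnI finite_UN_I fin) fact+
qed

lemma finite_closure_edges:
  assumes "finite V"
  shows "finite {e. end1 e \<in> closure_set V \<and> end2 e \<in> closure_set V}"
  by (rule finite_subset[of _ "closure_set V \<times> UNIV"])
    (use finite_closure_set[OF assms] in \<open>auto simp: end1_def\<close>)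

lemma cut_subset_closure_edges: "cut V \<subseteq> {e. end1 e \<in> closure_set V \<and> end2 e \<in> closure_set V}"
proof
  fix e assume "e \<in> cut V"
  moreover have "lat_adj (end2 e) (end1 e)" "lat_adj (end1 e) (end2 e)"
    using lat_adj_ends[of e] lat_adj_commute by auto
  ultimately show "e \<in> {e. end1 e \<in> closure_set V \<and> end2 e \<in> closure_set V}"
    by (auto simp: closure_set_def cut_def)
qed

text \<open>Exactly the edges with one end in \<open>V\<close> change sign, and the closure of
  \<open>V\<close> contains both ends of each of them.\<close>

lemma hamiltonian_flipped:
  assumes "finite V"
  shows "hamiltonian w V (flipped V \<sigma>) = hamiltonian w V \<sigma> + 2 * (\<Sum>e\<in>cut V. satis w \<sigma> e)"
proof -
  let ?B = "{e. end1 e \<in> closure_set V \<and> end2 e \<in> closure_set V}"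
  have "satis w (flipped V \<sigma>) e = satis w \<sigma> e - (if e \<in> cut V then 2 * satis w \<sigma> e else 0)" for e
    by (auto simp: flipped_def cut_def)
  then have "(\<Sum>e\<in>?B. satis w (flipped V \<sigma>) e) = (\<Sum>e\<in>?B. satis w \<sigma> e) - (\<Sum>e\<in>?B. if e \<in> cut V then 2 * satis w \<sigma> e else 0)"
    by (simp add: sum_subtractf)
  also have "(\<Sum>e\<in>?B. if e \<in> cut V then 2 * satis w \<sigma> e else 0) = 2 * (\<Sum>e\<in>cut V. satis w \<sigma> e)"
    using cut_subset_closure_edges[of V]
    by (subst sum.inter_restrict[symmetric, OF finite_closure_edges[OF assms]])
      (simp add: sum_distrib_left Int_absorb1)
  finally show ?thesis by (simp add: hamiltonian_def)
qed

lemma space_Omega: "space Omega = {p. \<forall>x. snd p x \<in> {-1, 1}}"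
  by (auto simp: Omega_def space_pair_measure S_space_def space_PiM PiE_UNIV_domain Pi_iff simp del: split_paired_All)

lemma spin_cases: "p \<in> space Omega \<Longrightarrow> snd p x = - 1 \<or> snd p x = 1"
  unfolding space_Omega by blast

lemma measurable_fst_Omega [measurable]: "fst \<in> measurable Omega W_space"
  unfolding Omega_def by measurable

lemma measurable_coupling [measurable]: "(\<lambda>p. fst p e) \<in> borel_measurable Omega"
  by (rule measurable_compose[OF measurable_fst_Omega measurable_coord])

lemma measurable_spin [measurable]: "(\<lambda>p. snd p x) \<in> measurable Omega (count_space {-1, 1})"
  unfolding Omega_def S_space_def by measurable

lemma measurable_spin_borel [measurable]: "(\<lambda>p. real_of_int (snd p x)) \<in> borel_measurable Omega"
proof -
  have "real_of_int \<in> measurable (count_space {-1, 1}) borel" by simp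
  from measurable_compose[OF measurable_spin this] show ?thesis .
qed

lemma measurable_satis [measurable]: "(\<lambda>p. satis (fst p) (snd p) e) \<in> borel_measurable Omega"
  by simp

lemma measurable_override:
  assumes "\<eta> \<in> configs V"
  shows "(\<lambda>p. (fst p, override_on (snd p) \<eta> V)) \<in> measurable Omega Omega"
proof -
  have "(\<lambda>p. override_on (snd p) \<eta> V) \<in> measurable Omega S_space"
    unfolding S_space_def
  proof (rule measurable_PiM_single')
    show "(\<lambda>p. override_on (snd p) \<eta> V i) \<in> measurable Omega (count_space {-1, 1})" for i
    proof (cases "i \<in> V")
      case True
      then have "\<eta> i \<in> {-1, 1}" using assms by (auto simp: configs_def)
      then show ?thesis using True by simp
    qed simp
    show "(\<lambda>p i. override_on (snd p) \<eta> V i) \<in> space Omega \<rightarrow> (\<Pi>\<^sub>E i\<in>UNIV. space (count_space {-1, 1}))"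
      using assms by (auto simp: space_Omega configs_def override_on_def PiE_iff)
  qed
  then show ?thesis unfolding Omega_def
    by (intro measurable_Pair) (simp_all add: Omega_def[symmetric])
qed

lemma finite_configs: "finite V \<Longrightarrow> finite (configs V)"
  unfolding configs_def by (rule finite_PiE) auto

lemma measurable_hamiltonian_override:
  "(\<lambda>p. hamiltonian (fst p) V (override_on (snd p) \<eta> V)) \<in> borel_measurable Omega"
proof -
  have [measurable]: "(\<lambda>p. real_of_int (override_on (snd p) \<eta> V x)) \<in> borel_measurable Omega" for x
    by (cases "x \<in> V") simp_all
  show ?thesis unfolding hamiltonian_def by simp
qed

lemma measurable_gibbs [measurable]: "(\<lambda>p. gibbs \<beta> (fst p) V (snd p) \<eta>) \<in> borel_measurable Omega"
  unfolding gibbs_def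
  by (intro borel_measurable_divide borel_measurable_sum borel_measurable_exp borel_measurable_times
      borel_measurable_const measurable_compose[OF measurable_hamiltonian_override]) measurable

text \<open>The weight \<open>exp (- 2 \<beta> x)\<close> paid for a configuration whose energy drops by \<open>2 x\<close> when a
  finite region is flipped.  A ground state satisfies this for every \<open>\<beta>\<close>.\<close>

definition flip_bound :: "real \<Rightarrow> ((edge \<Rightarrow> real) \<times> (vert \<Rightarrow> int)) measure \<Rightarrow> bool" where
  "flip_bound \<beta> \<nu> \<longleftrightarrow> (\<forall>V E x A. finite V \<longrightarrow> E \<in> sets Omega \<longrightarrow> A \<in> sets W_space \<longrightarrow>
     x \<in> borel_measurable W_space \<longrightarrow>
     (\<forall>p\<in>E. fst p \<in> A \<longrightarrow> (\<Sum>e\<in>cut V. satis (fst p) (snd p) e) \<le> - x (fst p)) \<longrightarrow>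
     emeasure \<nu> (E \<inter> {p \<in> space Omega. fst p \<in> A})
       \<le> (\<integral>\<^sup>+w. ennreal (exp (- 2 * \<beta> * x w)) * indicator A w \<partial>gauss))"

lemma nn_integral_coupling:
  assumes "iid_normal_law \<nu>" and [measurable]: "f \<in> borel_measurable W_space"
  shows "(\<integral>\<^sup>+p. f (fst p) \<partial>\<nu>) = (\<integral>\<^sup>+w. f w \<partial>gauss)"
proof -
  have [measurable_cong]: "sets \<nu> = sets Omega" using assms(1) by (simp add: iid_normal_law_def)
  show ?thesis
    by (subst distr_coupling_law[OF assms(1), symmetric]) (simp add: nn_integral_distr)
qed

text \<open>Minimality makes the cut sum nonnegative almost surely. Hence \<open>x \<le> 0\<close>
  on the event in question and the exponential weight is at least one.\<close>

lemma flip_bound_ground_state: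
  assumes "ground_state \<nu>" and \<beta>: "0 \<le> \<beta>"
  shows "flip_bound \<beta> \<nu>"
  unfolding flip_bound_def
proof (intro allI impI)
  fix V E and x :: "(edge \<Rightarrow> real) \<Rightarrow> real" and A
  assume "finite V" and [measurable]: "E \<in> sets Omega" "A \<in> sets W_space" "x \<in> borel_measurable W_space"
    and x: "\<forall>p\<in>E. fst p \<in> A \<longrightarrow> (\<Sum>e\<in>cut V. satis (fst p) (snd p) e) \<le> - x (fst p)"
  have law: "iid_normal_law \<nu>" and min: "AE p in \<nu>. \<forall>V. finite V \<longrightarrow> (\<forall>\<eta>\<in>configs V. \<eta> \<noteq> restrict (snd p) V \<longrightarrow>
        hamiltonian (fst p) V (snd p) < hamiltonian (fst p) V (override_on (snd p) \<eta> V))"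
    using assms by (auto simp: ground_state_def)
  have sets[measurable_cong]: "sets \<nu> = sets Omega" using law by (simp add: iid_normal_law_def)
  then have space: "space \<nu> = space Omega" by (rule sets_eq_imp_space_eq)
  have nonneg: "AE p in \<nu>. 0 \<le> (\<Sum>e\<in>cut V. satis (fst p) (snd p) e)"
    using min AE_space
  proof eventually_elim
    case (elim p)
    let ?\<eta> = "restrict (flipped V (snd p)) V"
    have \<eta>: "?\<eta> \<in> configs V"
      using elim(2) by (auto simp: configs_def space space_Omega flipped_def simp del: split_paired_All)
    have ov: "override_on (snd p) ?\<eta> V = flipped V (snd p)"
      by (auto simp: override_on_def flipped_def)
    show ?case
    proof (cases "?\<eta> = restrict (snd p) V")
      case True
      have "V = {}"
      proof (rule ccontr)
        assume "V \<noteq> {}"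
        then obtain y where "y \<in> V" by blast
        then have "snd p y = - snd p y" using fun_cong[OF True, of y] by (simp add: flipped_def)
        moreover have "snd p y = - 1 \<or> snd p y = 1" using elim(2) by (intro spin_cases) (simp add: space)
        ultimately show False by auto
      qed
      then show ?thesis by (simp add: cut_def)
    next
      case False
      from elim(1)[rule_format, OF \<open>finite V\<close> \<eta> this]
      show ?thesis by (simp add: ov hamiltonian_flipped[OF \<open>finite V\<close>])
    qed
  qed
  have "emeasure \<nu> (E \<inter> {p \<in> space Omega. fst p \<in> A})
      = (\<integral>\<^sup>+p. indicator (E \<inter> {p \<in> space Omega. fst p \<in> A}) p \<partial>\<nu>)"
    by (rule nn_integral_indicator[symmetric]) measurable
  also have "\<dots> \<le> (\<integral>\<^sup>+p. ennreal (exp (- 2 * \<beta> * x (fst p))) * indicator A (fst p) \<partial>\<nu>)"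
  proof (rule nn_integral_mono_AE)
    show "AE p in \<nu>. indicator (E \<inter> {p \<in> space Omega. fst p \<in> A}) p
        \<le> ennreal (exp (- 2 * \<beta> * x (fst p))) * indicator A (fst p)"
      using nonneg
    proof eventually_elim
      case (elim p)
      show ?case
      proof (cases "p \<in> E \<and> fst p \<in> A")
        case True
        then have "x (fst p) \<le> 0" using x elim by force
        then have "0 \<le> - 2 * \<beta> * x (fst p)" using \<beta> by (simp add: mult_nonneg_nonpos)
        then have "1 \<le> exp (- 2 * \<beta> * x (fst p))" by simp
        then show ?thesis using True by (simp add: indicator_def ennreal_ge_1)
      qed (auto simp: indicator_def)
    qed
  qed
  also have "\<dots> = (\<integral>\<^sup>+w. ennreal (exp (- 2 * \<beta> * x w)) * indicator A w \<partial>gauss)"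
    by (rule nn_integral_coupling[OF law, where f="\<lambda>w. ennreal (exp (- 2 * \<beta> * x w)) * indicator A w"]) measurable
  finally show "emeasure \<nu> (E \<inter> {p \<in> space Omega. fst p \<in> A})
      \<le> (\<integral>\<^sup>+w. ennreal (exp (- 2 * \<beta> * x w)) * indicator A w \<partial>gauss)" .
qed

lemma gibbs_nonneg: "0 \<le> gibbs \<beta> w V \<sigma> \<eta>"
  by (auto simp: gibbs_def intro!: divide_nonneg_nonneg sum_nonneg)

text \<open>The two weights have the same normalising sum, so their ratio is the Boltzmann factor of
  the energy difference.\<close>

lemma gibbs_flipped_le:
  assumes V: "finite V" and \<beta>: "0 \<le> \<beta>" and \<eta>: "\<eta> \<in> configs V"
    and le: "(\<Sum>e\<in>cut V. satis w (override_on \<sigma> \<eta> V) e) \<le> - x"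
  shows "gibbs \<beta> w V \<sigma> \<eta> \<le> exp (- 2 * \<beta> * x) * gibbs \<beta> w V \<sigma> (restrict (\<lambda>y. - \<eta> y) V)"
proof -
  let ?H = "\<lambda>\<eta>. hamiltonian w V (override_on \<sigma> \<eta> V)"
  have "override_on \<sigma> (restrict (\<lambda>y. - \<eta> y) V) V = flipped V (override_on \<sigma> \<eta> V)"
    by (auto simp: override_on_def flipped_def)
  then have "?H (restrict (\<lambda>y. - \<eta> y) V) \<le> ?H \<eta> - 2 * x"
    using hamiltonian_flipped[OF V, of w "override_on \<sigma> \<eta> V"] le by simp
  then have "\<beta> * ?H (restrict (\<lambda>y. - \<eta> y) V) \<le> \<beta> * (?H \<eta> - 2 * x)"
    using \<beta> by (rule mult_left_mono)
  then have "exp (- \<beta> * ?H \<eta>) \<le> exp (- 2 * \<beta> * x) * exp (- \<beta> * ?H (restrict (\<lambda>y. - \<eta> y) V))"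
    by (simp add: exp_add[symmetric] algebra_simps)
  then show ?thesis
    unfolding gibbs_def times_divide_eq_right by (intro divide_right_mono sum_nonneg) auto
qed

lemma sum_gibbs_reflected:
  assumes "finite V"
  shows "(\<Sum>\<eta>\<in>configs V. gibbs \<beta> w V \<sigma> (restrict (\<lambda>y. - \<eta> y) V)) = 1"
proof -
  let ?r = "\<lambda>\<eta>. restrict (\<lambda>y. - \<eta> y) V :: vert \<Rightarrow> int"
  have inv: "?r (?r \<eta>) = \<eta>" if "\<eta> \<in> configs V" for \<eta>
    using that by (auto simp: configs_def PiE_iff extensional_def restrict_def)
  have "bij_betw ?r (configs V) (configs V)"
    by (rule bij_betw_byWitness[where f' = ?r]) (use inv in blast, use inv in blast, auto simp: configs_def)
  then have "(\<Sum>\<eta>\<in>configs V. gibbs \<beta> w V \<sigma> (?r \<eta>)) = (\<Sum>\<eta>\<in>configs V. gibbs \<beta> w V \<sigma> \<eta>)"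
    by (rule sum.reindex_bij_betw)
  also have "\<dots> = 1"
  proof -
    have "(\<lambda>x\<in>V. 1) \<in> configs V" by (auto simp: configs_def)
    then have "configs V \<noteq> {}" by blast
    then have "0 < (\<Sum>\<eta>'\<in>configs V. exp (- \<beta> * hamiltonian w V (override_on \<sigma> \<eta>' V)))"
      using finite_configs[OF assms] by (intro sum_pos) auto
    then show ?thesis by (simp add: gibbs_def sum_divide_distrib[symmetric])
  qed
  finally show ?thesis .
qed

text \<open>Decompose according to the configuration \<eta> on \<open>V\<close> and compare each
  Gibbs weight with that of the reversed configuration. The reversed weights again sum to one, so
  the number of configurations does not enter the bound.\<close>

lemma flip_bound_EA_spin_glass:
  assumes EA: "EA_spin_glass \<beta> \<nu>"
  shows "flip_bound \<beta> \<nu>"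
  unfolding flip_bound_def
proof (intro allI impI)
  fix V E and x :: "(edge \<Rightarrow> real) \<Rightarrow> real" and A
  assume V: "finite V" and [measurable]: "E \<in> sets Omega" "A \<in> sets W_space" "x \<in> borel_measurable W_space"
    and x: "\<forall>p\<in>E. fst p \<in> A \<longrightarrow> (\<Sum>e\<in>cut V. satis (fst p) (snd p) e) \<le> - x (fst p)"
  have law: "iid_normal_law \<nu>" and \<beta>: "0 \<le> \<beta>"
    and DLR: "\<And>A \<eta>. outside_event V A \<Longrightarrow> \<eta> \<in> configs V \<Longrightarrow>
        emeasure \<nu> (A \<inter> {p \<in> space Omega. \<forall>x\<in>V. snd p x = \<eta> x}) =
        (\<integral>\<^sup>+ p\<in>A. ennreal (gibbs \<beta> (fst p) V (snd p) \<eta>) \<partial>\<nu>)"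
    using EA V by (auto simp: EA_spin_glass_def)
  have sets[measurable_cong]: "sets \<nu> = sets Omega" using law by (simp add: iid_normal_law_def)
  let ?r = "\<lambda>\<eta>. restrict (\<lambda>y. - \<eta> y) V :: vert \<Rightarrow> int"
  let ?c = "\<lambda>w. ennreal (exp (- 2 * \<beta> * x w))"
  let ?A = "{p \<in> space Omega. fst p \<in> A}"
  \<comment> \<open>Substituting \<eta> on \<open>V\<close> removes the dependence on the spins
    there, so the DLR condition applies; where the spins on \<open>V\<close> equal \<eta>, the event
    is the original one.\<close>
  define E' where "E' \<eta> = {p \<in> space Omega. (fst p, override_on (snd p) \<eta> V) \<in> E \<and> fst p \<in> A}" for \<eta>
  have out: "outside_event V (E' \<eta>)" if "\<eta> \<in> configs V" for \<eta>
    unfolding outside_event_def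
  proof (intro conjI ballI impI)
    note measurable_override[OF that, measurable]
    show "E' \<eta> \<in> sets Omega" unfolding E'_def by measurable
    fix p q assume "p \<in> space Omega" "q \<in> space Omega"
      and pq: "fst p = fst q \<and> (\<forall>x. x \<notin> V \<longrightarrow> snd p x = snd q x)"
    moreover have "override_on (snd p) \<eta> V = override_on (snd q) \<eta> V"
      using pq by (auto simp: override_on_def)
    ultimately show "p \<in> E' \<eta> \<longleftrightarrow> q \<in> E' \<eta>" by (simp add: E'_def)
  qed
  have meas: "E' \<eta> \<inter> {p \<in> space Omega. \<forall>x\<in>V. snd p x = \<eta> x} \<in> sets \<nu>" if "\<eta> \<in> configs V" for \<eta>
  proof -
    have "{p \<in> space Omega. snd p x = \<eta> x} \<in> sets Omega" for x
    proof -
      have "{p \<in> space Omega. real_of_int (snd p x) = real_of_int (\<eta> x)} \<in> sets Omega" by measurable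
      then show ?thesis by simp
    qed
    then have "{p \<in> space Omega. \<forall>x\<in>V. snd p x = \<eta> x} \<in> sets Omega"
      using V by (intro sets.sets_Collect_finite_All) auto
    moreover have "E' \<eta> \<in> sets Omega" using out[OF that] by (simp add: outside_event_def)
    ultimately show ?thesis by (simp add: sets)
  qed
  have one: "emeasure \<nu> (E' \<eta> \<inter> {p \<in> space Omega. \<forall>x\<in>V. snd p x = \<eta> x})
      \<le> (\<integral>\<^sup>+p. ?c (fst p) * ennreal (gibbs \<beta> (fst p) V (snd p) (?r \<eta>)) * indicator A (fst p) \<partial>\<nu>)"
    if "\<eta> \<in> configs V" for \<eta>
    unfolding DLR[OF out[OF that] that]
  proof (rule nn_integral_mono)
    fix p
    show "ennreal (gibbs \<beta> (fst p) V (snd p) \<eta>) * indicator (E' \<eta>) p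
        \<le> ?c (fst p) * ennreal (gibbs \<beta> (fst p) V (snd p) (?r \<eta>)) * indicator A (fst p)"
    proof (cases "p \<in> E' \<eta>")
      case True
      then have "(\<Sum>e\<in>cut V. satis (fst p) (override_on (snd p) \<eta> V) e) \<le> - x (fst p)"
        using x by (auto simp: E'_def)
      from gibbs_flipped_le[OF V \<beta> that this] True show ?thesis
        by (auto simp: E'_def ennreal_mult'[symmetric] intro!: ennreal_leI)
    qed simp
  qed
  have "emeasure \<nu> (E \<inter> ?A) \<le> emeasure \<nu> (\<Union>\<eta>\<in>configs V. E' \<eta> \<inter> {p \<in> space Omega. \<forall>x\<in>V. snd p x = \<eta> x})"
  proof (rule emeasure_mono)
    show "E \<inter> ?A \<subseteq> (\<Union>\<eta>\<in>configs V. E' \<eta> \<inter> {p \<in> space Omega. \<forall>x\<in>V. snd p x = \<eta> x})"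
    proof
      fix p assume p: "p \<in> E \<inter> ?A"
      let ?\<eta> = "restrict (snd p) V"
      have "override_on (snd p) ?\<eta> V = snd p" by (auto simp: override_on_def)
      moreover have "?\<eta> \<in> configs V" using p by (auto simp: space_Omega configs_def)
      ultimately show "p \<in> (\<Union>\<eta>\<in>configs V. E' \<eta> \<inter> {p \<in> space Omega. \<forall>x\<in>V. snd p x = \<eta> x})"
        using p by (intro UN_I[of ?\<eta>]) (auto simp: E'_def)
    qed
    show "(\<Union>\<eta>\<in>configs V. E' \<eta> \<inter> {p \<in> space Omega. \<forall>x\<in>V. snd p x = \<eta> x}) \<in> sets \<nu>"
      by (intro sets.finite_UN finite_configs V) (use meas in auto)
  qed
  also have "\<dots> \<le> (\<Sum>\<eta>\<in>configs V. emeasure \<nu> (E' \<eta> \<inter> {p \<in> space Omega. \<forall>x\<in>V. snd p x = \<eta> x}))"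
    by (intro emeasure_subadditive_finite finite_configs V) (use meas in auto)
  also have "\<dots> \<le> (\<Sum>\<eta>\<in>configs V. \<integral>\<^sup>+p. ?c (fst p) * ennreal (gibbs \<beta> (fst p) V (snd p) (?r \<eta>)) * indicator A (fst p) \<partial>\<nu>)"
    by (intro sum_mono one)
  also have "\<dots> = (\<integral>\<^sup>+p. (\<Sum>\<eta>\<in>configs V. ?c (fst p) * ennreal (gibbs \<beta> (fst p) V (snd p) (?r \<eta>)) * indicator A (fst p)) \<partial>\<nu>)"
    by (rule nn_integral_sum[symmetric]) measurable
  also have "\<dots> = (\<integral>\<^sup>+p. ?c (fst p) * indicator A (fst p) \<partial>\<nu>)"
  proof (rule nn_integral_cong)
    fix p
    have "(\<Sum>\<eta>\<in>configs V. ennreal (gibbs \<beta> (fst p) V (snd p) (?r \<eta>))) = 1"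
      by (subst sum_ennreal) (simp_all add: gibbs_nonneg sum_gibbs_reflected[OF V])
    then show "(\<Sum>\<eta>\<in>configs V. ?c (fst p) * ennreal (gibbs \<beta> (fst p) V (snd p) (?r \<eta>)) * indicator A (fst p))
        = ?c (fst p) * indicator A (fst p)"
      by (simp add: sum_distrib_right[symmetric] sum_distrib_left[symmetric])
  qed
  also have "\<dots> = (\<integral>\<^sup>+w. ?c w * indicator A w \<partial>gauss)"
    by (rule nn_integral_coupling[OF law, where f="\<lambda>w. ?c w * indicator A w"]) measurable
  finally show "emeasure \<nu> (E \<inter> ?A) \<le> (\<integral>\<^sup>+w. ?c w * indicator A w \<partial>gauss)" .
qed

subsection \<open>Conditional bounds\<close>

text \<open>The conditional probability of \<open>E\<close> given \<open>w\<close> is almost surely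
  at most \<open>u w\<close>, expressed by testing against all events of the couplings.\<close>

definition cond_bound where
  "cond_bound \<nu> E u \<longleftrightarrow> (\<forall>A\<in>sets W_space.
     emeasure \<nu> (E \<inter> {p \<in> space Omega. fst p \<in> A}) \<le> (\<integral>\<^sup>+w. u w * indicator A w \<partial>gauss))"

text \<open>\<open>flip_bound\<close> speaks of one fixed region \<open>V\<close>. A region that
  depends on \<open>w\<close> through finitely many cases is allowed by proving the bound on each
  case separately.\<close>

lemma cond_bound_partition:
  fixes B :: "'i \<Rightarrow> (edge \<Rightarrow> real) set"
  assumes sets: "sets \<nu> = sets Omega" and E[measurable]: "E \<in> sets Omega"
    and u[measurable]: "u \<in> borel_measurable W_space"
    and I: "finite I" and B[measurable]: "\<And>i. i \<in> I \<Longrightarrow> B i \<in> sets W_space"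
    and cover: "\<And>w. \<exists>i\<in>I. w \<in> B i" and disj: "disjoint_family_on B I"
    and bound: "\<And>i A. i \<in> I \<Longrightarrow> A \<in> sets W_space \<Longrightarrow> A \<subseteq> B i \<Longrightarrow>
      emeasure \<nu> (E \<inter> {p \<in> space Omega. fst p \<in> A}) \<le> (\<integral>\<^sup>+w. u w * indicator A w \<partial>gauss)"
  shows "cond_bound \<nu> E u"
  unfolding cond_bound_def
proof
  fix A assume A[measurable]: "A \<in> sets W_space"
  have meas: "E \<inter> {p \<in> space Omega. fst p \<in> A \<inter> B i} \<in> sets \<nu>" if "i \<in> I" for i
    using B[OF that] unfolding sets by measurable
  have "emeasure \<nu> (E \<inter> {p \<in> space Omega. fst p \<in> A})
      \<le> emeasure \<nu> (\<Union>i\<in>I. E \<inter> {p \<in> space Omega. fst p \<in> A \<inter> B i})"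
    by (rule emeasure_mono) (use cover meas I in blast, use meas I in blast)
  also have "\<dots> \<le> (\<Sum>i\<in>I. emeasure \<nu> (E \<inter> {p \<in> space Omega. fst p \<in> A \<inter> B i}))"
    by (intro emeasure_subadditive_finite I) (use meas in blast)
  also have "\<dots> \<le> (\<Sum>i\<in>I. \<integral>\<^sup>+w. u w * indicator (A \<inter> B i) w \<partial>gauss)"
    by (intro sum_mono bound) auto
  also have "\<dots> = (\<integral>\<^sup>+w. (\<Sum>i\<in>I. u w * indicator (A \<inter> B i) w) \<partial>gauss)"
    by (rule nn_integral_sum[symmetric]) (use B in measurable)
  also have "\<dots> \<le> (\<integral>\<^sup>+w. u w * indicator A w \<partial>gauss)"
  proof (rule nn_integral_mono)
    fix w
    obtain i where i: "i \<in> I" "w \<in> B i" using cover by blast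
    have "w \<notin> B j" if "j \<in> I" "j \<noteq> i" for j
      using disj i that by (auto simp: disjoint_family_on_def)
    then have "(\<Sum>i\<in>I. u w * indicator (A \<inter> B i) w) = (\<Sum>j\<in>I. if j = i then u w * indicator A w else 0)"
      using i by (intro sum.cong) (auto simp: indicator_def)
    then show "(\<Sum>i\<in>I. u w * indicator (A \<inter> B i) w) \<le> u w * indicator A w"
      using i I by simp
  qed
  finally show "emeasure \<nu> (E \<inter> {p \<in> space Omega. fst p \<in> A}) \<le> (\<integral>\<^sup>+w. u w * indicator A w \<partial>gauss)" .
qed

text \<open>Split the couplings according to which of the two bounds is smaller.\<close>

lemma cond_bound_min:
  assumes sets: "sets \<nu> = sets Omega" and E: "E \<in> sets Omega"
    and u[measurable]: "u \<in> borel_measurable W_space" and v[measurable]: "v \<in> borel_measurable W_space"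
    and cb: "cond_bound \<nu> E u" "cond_bound \<nu> E v"
  shows "cond_bound \<nu> E (\<lambda>w. min (u w) (v w))"
proof (rule cond_bound_partition[where I = "UNIV :: bool set" and B = "\<lambda>b. {w. (u w \<le> v w) = b}"])
  fix b :: bool
  have le: "{w \<in> space W_space. u w \<le> v w} \<in> sets W_space"
    by (rule borel_measurable_le[OF u v])
  have "{w \<in> space W_space. (u w \<le> v w) = b} \<in> sets W_space"
    using le sets.sets_Collect_neg[OF le] by (cases b) simp_all
  then show "{w. (u w \<le> v w) = b} \<in> sets W_space" by simp
  fix A assume A: "A \<in> sets W_space" "A \<subseteq> {w. (u w \<le> v w) = b}"
  have "(\<integral>\<^sup>+w. min (u w) (v w) * indicator A w \<partial>gauss) = (\<integral>\<^sup>+w. (if b then u w else v w) * indicator A w \<partial>gauss)"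
    using A(2) by (intro nn_integral_cong) (auto simp: indicator_def min_def)
  then show "emeasure \<nu> (E \<inter> {p \<in> space Omega. fst p \<in> A}) \<le> (\<integral>\<^sup>+w. min (u w) (v w) * indicator A w \<partial>gauss)"
    using cb A by (cases b) (auto simp: cond_bound_def)
qed (use sets E in \<open>auto simp: disjoint_family_on_def\<close>)

definition unsat_event :: "edge set \<Rightarrow> ((edge \<Rightarrow> real) \<times> (vert \<Rightarrow> int)) set" where
  "unsat_event S = {p \<in> space Omega. \<forall>e\<in>S. unsatisfied (fst p) (snd p) e}"

lemma sets_unsatisfied: "{p \<in> space Omega. unsatisfied (fst p) (snd p) e} \<in> sets Omega"
  unfolding unsatisfied_def by measurable

lemma sets_unsat_event: "finite S \<Longrightarrow> unsat_event S \<in> sets Omega"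
  unfolding unsat_event_def by (intro sets.sets_Collect_finite_All sets_unsatisfied)

lemma satis_abs:
  assumes "p \<in> space Omega"
  shows "\<bar>satis (fst p) (snd p) e\<bar> = \<bar>fst p e\<bar>"
  using spin_cases[OF assms, of "end1 e"] spin_cases[OF assms, of "end2 e"] by auto

section \<open>First passage lengths and minimising paths\<close>

definition len :: "(edge \<Rightarrow> real) \<Rightarrow> edge set \<Rightarrow> real" where
  "len w S = (\<Sum>e\<in>S. \<bar>w e\<bar>)"

lemma measurable_len [measurable]: "(\<lambda>w. len w S) \<in> borel_measurable W_space"
  unfolding len_def by (intro borel_measurable_sum borel_measurable_abs measurable_coord)

text \<open>Ties between paths of equal length are broken by an enumeration of all paths.\<close>

definition first_min :: "'a::countable set \<Rightarrow> ('a \<Rightarrow> real) \<Rightarrow> 'a \<Rightarrow> bool" where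
  "first_min P f \<rho> \<longleftrightarrow> \<rho> \<in> P \<and>
     (\<forall>\<pi>\<in>P. \<pi> \<noteq> \<rho> \<longrightarrow> f \<rho> < f \<pi> \<or> f \<rho> = f \<pi> \<and> to_nat \<rho> < to_nat \<pi>)"

lemma ex_first_min:
  assumes "finite P" "P \<noteq> {}"
  shows "\<exists>\<rho>. first_min P f \<rho>"
proof -
  let ?Q = "{\<rho>\<in>P. f \<rho> = Min (f ` P)}"
  have "Min (f ` P) \<in> f ` P" using assms by (intro Min_in) auto
  then obtain \<rho>0 where "\<rho>0 \<in> ?Q" by auto
  then obtain \<rho> where \<rho>: "\<rho> \<in> ?Q" "\<And>\<pi>. \<pi> \<in> ?Q \<Longrightarrow> to_nat \<rho> \<le> to_nat \<pi>"
    using ex_has_least_nat[of "\<lambda>\<rho>. \<rho> \<in> ?Q" \<rho>0 to_nat] by blast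
  have "f \<rho> < f \<pi> \<or> f \<rho> = f \<pi> \<and> to_nat \<rho> < to_nat \<pi>" if "\<pi> \<in> P" "\<pi> \<noteq> \<rho>" for \<pi>
  proof (cases "f \<pi> = f \<rho>")
    case True
    then have "to_nat \<rho> \<le> to_nat \<pi>" using \<rho> that by auto
    moreover have "to_nat \<rho> \<noteq> to_nat \<pi>" using that by simp
    ultimately show ?thesis using True by linarith
  next
    case False
    have "Min (f ` P) \<le> f \<pi>" using assms that by (intro Min_le) auto
    then show ?thesis using False \<rho>(1) by auto
  qed
  then have "first_min P f \<rho>" using \<rho>(1) unfolding first_min_def by blast
  then show ?thesis ..
qed

lemma first_min_unique: "first_min P f \<rho> \<Longrightarrow> first_min P f \<rho>' \<Longrightarrow> \<rho> = \<rho>'"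
  unfolding first_min_def by (metis less_asym less_irrefl)

lemma first_min_Min: "finite P \<Longrightarrow> first_min P f \<rho> \<Longrightarrow> Min (f ` P) = f \<rho>"
  unfolding first_min_def by (intro Min_eqI) force+

definition geo :: "vert list set \<Rightarrow> vert list \<Rightarrow> (edge \<Rightarrow> real) set" where
  "geo P \<rho> = {w. first_min P (\<lambda>\<pi>. len w (pedges \<pi>)) \<rho>}"

lemma sets_geo [measurable]: "finite P \<Longrightarrow> geo P \<rho> \<in> sets W_space"
proof -
  assume "finite P"
  moreover have [measurable]: "Measurable.pred W_space (\<lambda>w. len w S = len w T)" for S T
    unfolding pred_def by (intro borel_measurable_eq measurable_len)
  ultimately have "{w \<in> space W_space. first_min P (\<lambda>\<pi>. len w (pedges \<pi>)) \<rho>} \<in> sets W_space"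
    unfolding first_min_def by measurable
  then show ?thesis by (simp add: geo_def)
qed

definition excess :: "vert list set \<Rightarrow> vert list \<Rightarrow> (edge \<Rightarrow> real) \<Rightarrow> real" where
  "excess P \<pi> w = len w (pedges \<pi>) - Min ((\<lambda>\<rho>. len w (pedges \<rho>)) ` P)"

lemma len_diff:
  "finite S \<Longrightarrow> finite T \<Longrightarrow> len w S - len w T = len w (S - T) - len w (T - S)"
  unfolding len_def
  using sum.Int_Diff[of S "\<lambda>e. \<bar>w e\<bar>" T] sum.Int_Diff[of T "\<lambda>e. \<bar>w e\<bar>" S] by (simp add: Int_commute)

lemma measurable_excess [measurable]:
  assumes "finite P" "P \<noteq> {}"
  shows "excess P \<pi> \<in> borel_measurable W_space"
proof -
  have "(\<lambda>w. Min ((\<lambda>\<rho>. len w (pedges \<rho>)) ` Q)) \<in> borel_measurable W_space" if "finite Q" "Q \<noteq> {}" for Q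
    using that
  proof (induction Q rule: finite_ne_induct)
    case (insert \<rho> Q)
    then have [measurable]: "(\<lambda>w. Min ((\<lambda>\<rho>. len w (pedges \<rho>)) ` Q)) \<in> borel_measurable W_space" by simp
    show ?case using insert by simp
  qed simp
  then show ?thesis unfolding excess_def using assms by simp
qed

text \<open>Where \<rho> is the minimiser, flip the region between \<pi> and \<rho>: unsatisfied
  edges of \<pi> contribute minus their weight to the cut sum, edges of \<rho> at most their weight.
  The region varies with \<open>w\<close> through \<rho>, whence the partition by
  \<open>geo P\<close>.\<close>

lemma cond_bound_path:
  assumes flip: "flip_bound \<beta> \<nu>" and sets: "sets \<nu> = sets Omega"
    and P: "finite P" "\<pi> \<in> P" "\<And>\<rho>. \<rho> \<in> P \<Longrightarrow> dpath \<rho> \<and> hd \<rho> = hd \<pi> \<and> last \<rho> = last \<pi>"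
  shows "cond_bound \<nu> (unsat_event (pedges \<pi>)) (\<lambda>w. ennreal (exp (- 2 * \<beta> * excess P \<pi> w)))"
proof (rule cond_bound_partition[where I = P and B = "geo P"])
  have "P \<noteq> {}" using P by blast
  note [measurable] = measurable_excess[OF P(1) this]
  show "(\<lambda>w. ennreal (exp (- 2 * \<beta> * excess P \<pi> w))) \<in> borel_measurable W_space" by measurable
  show "\<exists>\<rho>\<in>P. w \<in> geo P \<rho>" for w
    using ex_first_min[OF P(1) \<open>P \<noteq> {}\<close>, of "\<lambda>\<pi>. len w (pedges \<pi>)"] by (auto simp: geo_def first_min_def)
  show "disjoint_family_on (geo P) P"
    using first_min_unique unfolding disjoint_family_on_def geo_def by blast
  fix \<rho> A assume \<rho>: "\<rho> \<in> P" and A: "A \<in> sets W_space" "A \<subseteq> geo P \<rho>"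
  obtain V where V: "finite V" "cut V = sym_diff (pedges \<pi>) (pedges \<rho>)"
    using dpath_cut[of \<pi> \<rho>] P(3)[OF \<rho>] P(3)[OF P(2)] by metis
  have "emeasure \<nu> (unsat_event (pedges \<pi>) \<inter> {p \<in> space Omega. fst p \<in> A})
      \<le> (\<integral>\<^sup>+w. ennreal (exp (- 2 * \<beta> * excess P \<pi> w)) * indicator A w \<partial>gauss)"
  proof (rule flip[unfolded flip_bound_def, rule_format, OF V(1) sets_unsat_event[OF finite_pedges] A(1)
        measurable_excess[OF P(1) \<open>P \<noteq> {}\<close>]])
    fix p assume p: "p \<in> unsat_event (pedges \<pi>)" "fst p \<in> A"
    then have sp: "p \<in> space Omega" by (simp add: unsat_event_def)
    let ?s = "satis (fst p) (snd p)"
    have "Min ((\<lambda>\<rho>. len (fst p) (pedges \<rho>)) ` P) = len (fst p) (pedges \<rho>)"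
      using p A(2) by (intro first_min_Min P) (auto simp: geo_def)
    then have ex: "excess P \<pi> (fst p) = len (fst p) (pedges \<pi> - pedges \<rho>) - len (fst p) (pedges \<rho> - pedges \<pi>)"
      by (simp add: excess_def len_diff[OF finite_pedges finite_pedges, of "fst p" \<pi> \<rho>])
    have "(\<Sum>e\<in>cut V. ?s e) = (\<Sum>e\<in>pedges \<pi> - pedges \<rho>. ?s e) + (\<Sum>e\<in>pedges \<rho> - pedges \<pi>. ?s e)"
      unfolding V(2) by (rule sum.union_disjoint) auto
    also have "\<dots> \<le> (\<Sum>e\<in>pedges \<pi> - pedges \<rho>. - \<bar>fst p e\<bar>) + (\<Sum>e\<in>pedges \<rho> - pedges \<pi>. \<bar>fst p e\<bar>)"
    proof (intro add_mono sum_mono)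
      fix e assume "e \<in> pedges \<pi> - pedges \<rho>"
      then have "?s e < 0" using p by (auto simp: unsat_event_def unsatisfied_def)
      then show "?s e \<le> - \<bar>fst p e\<bar>" using satis_abs[OF sp, of e] by linarith
    next
      fix e show "?s e \<le> \<bar>fst p e\<bar>" using satis_abs[OF sp, of e] by linarith
    qed
    also have "\<dots> = - excess P \<pi> (fst p)"
      by (simp add: ex len_def sum_negf)
    finally show "(\<Sum>e\<in>cut V. ?s e) \<le> - excess P \<pi> (fst p)" .
  qed
  then show "emeasure \<nu> (unsat_event (pedges \<pi>) \<inter> {p \<in> space Omega. fst p \<in> A})
      \<le> (\<integral>\<^sup>+w. ennreal (exp (- 2 * \<beta> * excess P \<pi> w)) * indicator A w \<partial>gauss)" .
qed (use P sets sets_unsat_event in auto)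

subsection \<open>Frustrated plaquettes along a path\<close>

definition plaq :: "vert \<Rightarrow> edge set" where
  "plaq p = {e. p \<in> dual_ends e}"

definition frustrated :: "vert \<Rightarrow> (edge \<Rightarrow> real) \<Rightarrow> bool" where
  "frustrated p w \<longleftrightarrow> odd (card {e \<in> plaq p. w e < 0})"

lemma plaq_eq: "plaq (a, b) = {((a, b), False), ((a, b + 1), False), ((a, b), True), ((a + 1, b), True)}"
  by (auto simp: plaq_def dual_ends_def split: if_splits)

lemma finite_plaq [simp]: "finite (plaq p)"
  by (cases p) (simp add: plaq_eq)

lemma cut_singleton: "cut {(a, b)} = {((a, b), False), ((a, b), True), ((a - 1, b), False), ((a, b - 1), True)}"
proof -
  have "e \<in> cut {(a, b)} \<longleftrightarrow> e \<in> {((a, b), False), ((a, b), True), ((a - 1, b), False), ((a, b - 1), True)}" for e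
    by (cases e rule: prod.exhaust; cases "fst e") (auto simp: cut_def end1_def end2_def split: if_splits)
  then show ?thesis by blast
qed

lemma finite_cut_singleton [simp]: "finite (cut {x})"
  by (cases x) (simp add: cut_singleton)

lemma card_cut_singleton: "card (cut {x}) = 4"
  by (cases x) (simp add: cut_singleton)

lemma prod_neg_iff_odd:
  fixes f :: "'a \<Rightarrow> real"
  assumes "finite S" "\<And>e. e \<in> S \<Longrightarrow> f e \<noteq> 0"
  shows "(\<Prod>e\<in>S. f e) < 0 \<longleftrightarrow> odd (card {e \<in> S. f e < 0})"
  using assms
proof (induction S)
  case (insert x S)
  have "prod f S < 0 \<or> 0 < prod f S" using insert by (auto simp: linorder_neq_iff[symmetric])
  moreover have "{e \<in> insert x S. f e < 0} = (if f x < 0 then insert x {e \<in> S. f e < 0} else {e \<in> S. f e < 0})"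
    by auto
  moreover have "f x < 0 \<or> 0 < f x" using insert.prems[of x] by auto
  ultimately show ?case using insert
    by (auto simp: mult_less_0_iff)
qed simp

text \<open>Every corner of a plaquette lies on two of its edges, so the spins drop out of the product.\<close>

lemma prod_satis_plaq:
  assumes "p \<in> space Omega"
  shows "(\<Prod>e\<in>plaq q. satis (fst p) (snd p) e) = (\<Prod>e\<in>plaq q. fst p e)"
proof -
  obtain a b where q: "q = (a, b)" by (cases q)
  have sq: "real_of_int (snd p x) * real_of_int (snd p x) = 1" for x
    using spin_cases[OF assms, of x] by auto
  let ?s = "\<lambda>x. real_of_int (snd p x)"
  have "(\<Prod>e\<in>plaq q. satis (fst p) (snd p) e) = (\<Prod>e\<in>plaq q. fst p e) *
    ((?s (a, b) * ?s (a, b)) * (?s (a + 1, b) * ?s (a + 1, b)) *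
     (?s (a, b + 1) * ?s (a, b + 1)) * (?s (a + 1, b + 1) * ?s (a + 1, b + 1)))"
    by (simp add: q plaq_eq end1_def end2_def ac_simps)
  then show ?thesis by (simp add: sq)
qed

text \<open>With the other three couplings fixed, the sign of one edge decides frustration, so
  redrawing a single coupling can produce it.\<close>

lemma frustrated_update:
  assumes "e \<in> plaq p"
  shows "frustrated p (w(e := y)) \<longleftrightarrow> (y < 0) \<noteq> odd (card {f \<in> plaq p - {e}. w f < 0})"
proof -
  have "{f \<in> plaq p. (w(e := y)) f < 0} =
      (if y < 0 then insert e {f \<in> plaq p - {e}. w f < 0} else {f \<in> plaq p - {e}. w f < 0})"
    using assms by auto
  moreover have "finite {f \<in> plaq p - {e}. w f < 0}" by simp
  ultimately show ?thesis by (simp add: frustrated_def)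
qed

lemma sets_frustrated [measurable]: "Measurable.pred W_space (frustrated p)"
proof -
  \<comment> \<open>Parity becomes membership of a measurable real function in a countable
    set.\<close>
  have eq: "frustrated p w \<longleftrightarrow> (\<Sum>e\<in>plaq p. if w e < 0 then 1 else 0 :: real) \<in> real ` {k. odd k}" for w
    by (subst sum.inter_filter[symmetric]) (auto simp: frustrated_def)
  have "(\<lambda>w. \<Sum>e\<in>plaq p. if w e < 0 then 1 else 0 :: real) \<in> borel_measurable W_space"
    using measurable_coord by measurable
  moreover have "real ` {k. odd k} \<in> sets borel"
    by (rule sets.countable) auto
  ultimately have "(\<lambda>w. \<Sum>e\<in>plaq p. if w e < 0 then 1 else 0 :: real) -` (real ` {k. odd k}) \<inter> space W_space \<in> sets W_space"
    by (rule measurable_sets)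
  moreover have "{w \<in> space W_space. frustrated p w} =
      (\<lambda>w. \<Sum>e\<in>plaq p. if w e < 0 then 1 else 0 :: real) -` (real ` {k. odd k}) \<inter> space W_space"
    using eq by auto
  ultimately show ?thesis unfolding pred_def by metis
qed

lemma nn_integral_resample_mono':
  assumes [measurable]: "f \<in> borel_measurable W_space" "g \<in> borel_measurable W_space"
    and "\<And>w. c * (\<integral>\<^sup>+y. g (w(i := y)) \<partial>normal) \<le> (\<integral>\<^sup>+y. f (w(i := y)) \<partial>normal)"
  shows "c * (\<integral>\<^sup>+w. g w \<partial>gauss) \<le> (\<integral>\<^sup>+w. f w \<partial>gauss)"
proof -
  interpret N: prob_space normal by (rule prob_space_normal)
  note measurable_update[measurable (raw)]
  have "c * (\<integral>\<^sup>+w. g w \<partial>gauss) = c * (\<integral>\<^sup>+w. (\<integral>\<^sup>+y. g (w(i := y)) \<partial>normal) \<partial>gauss)"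
    by (subst nn_integral_resample[where i=i and f=g]) auto
  also have "\<dots> = (\<integral>\<^sup>+w. c * (\<integral>\<^sup>+y. g (w(i := y)) \<partial>normal) \<partial>gauss)"
    by (rule nn_integral_cmult[symmetric]) measurable
  also have "\<dots> \<le> (\<integral>\<^sup>+w. (\<integral>\<^sup>+y. f (w(i := y)) \<partial>normal) \<partial>gauss)"
    by (intro nn_integral_mono assms)
  also have "\<dots> = (\<integral>\<^sup>+w. f w \<partial>gauss)"
    by (subst nn_integral_resample[where i=i and f=f]) auto
  finally show ?thesis .
qed

text \<open>The sign demanded of \<open>w i\<close> may depend on the other couplings through
  \<open>b\<close>. Since \<open>F\<close> favours large \<open>\<bar>w i\<bar>\<close>, the demand
  costs no more than half the tail probability even under the weight \<open>F\<close>.\<close>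

lemma gauss_half_tail:
  assumes F[measurable]: "F \<in> borel_measurable W_space" and H[measurable]: "H \<in> borel_measurable W_space"
    and b[measurable]: "Measurable.pred W_space b" and T: "0 \<le> T"
    and F_mono: "\<And>w y y'. \<bar>y\<bar> \<le> \<bar>y'\<bar> \<Longrightarrow> F (w(i := y)) \<le> F (w(i := y'))"
    and H_indep: "\<And>w y. H (w(i := y)) = H w" and b_indep: "\<And>w y. b (w(i := y)) = b w"
  shows "ennreal (1/2) * emeasure normal {x. T < \<bar>x\<bar>} * (\<integral>\<^sup>+w. F w * H w \<partial>gauss)
    \<le> (\<integral>\<^sup>+w. F w * H w * indicator {w. T < \<bar>w i\<bar> \<and> (w i < 0 \<longleftrightarrow> b w)} w \<partial>gauss)"
proof (rule nn_integral_resample_mono'[where i = i])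
  have [measurable]: "(\<lambda>w. w i) \<in> borel_measurable W_space" by (rule measurable_coord)
  have "Measurable.pred W_space (\<lambda>w. T < \<bar>w i\<bar> \<and> (w i < 0 \<longleftrightarrow> b w))" by measurable
  then have [measurable]: "{w. T < \<bar>w i\<bar> \<and> (w i < 0 \<longleftrightarrow> b w)} \<in> sets W_space" by (simp add: pred_def)
  show "(\<lambda>w. F w * H w * indicator {w. T < \<bar>w i\<bar> \<and> (w i < 0 \<longleftrightarrow> b w)} w) \<in> borel_measurable W_space"
    by measurable
  fix w
  let ?f = "\<lambda>y. F (w(i := y)) * H w"
  have "(\<lambda>y. w(i := y)) \<in> borel \<rightarrow>\<^sub>M W_space"
    by (rule measurable_W_spaceI) (simp add: fun_upd_def)
  from measurable_compose[OF this F] have [measurable]: "(\<lambda>y. F (w(i := y))) \<in> borel_measurable borel" .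
  have "ennreal (1/2) * emeasure normal {x. T < \<bar>x\<bar>} * (\<integral>\<^sup>+y. ?f y \<partial>normal)
      \<le> (\<integral>\<^sup>+y. ?f y * indicator {x. T < \<bar>x\<bar> \<and> (x < 0 \<longleftrightarrow> b w)} y \<partial>normal)"
    by (rule nn_integral_normal_half_tail) (auto intro!: mult_right_mono F_mono T)
  then show "ennreal (1/2) * emeasure normal {x. T < \<bar>x\<bar>} * (\<integral>\<^sup>+y. F (w(i := y)) * H (w(i := y)) \<partial>normal)
      \<le> (\<integral>\<^sup>+y. F (w(i := y)) * H (w(i := y)) * indicator {w. T < \<bar>w i\<bar> \<and> (w i < 0 \<longleftrightarrow> b w)} (w(i := y)) \<partial>normal)"
    by (simp add: H_indep b_indep indicator_def)
qed (use F H in measurable)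

text \<open>At each spot \<open>p\<close> the path uses two of the four edges of the plaquette \<open>p\<close>; \<open>g p\<close> and \<open>h p\<close> are the
  other two.  If the weight of \<open>g p\<close> exceeds the sum of the other three weights at its endpoint \<open>x p\<close>,
  then flipping \<open>x p\<close> penalises \<open>g p\<close> for being unsatisfied; likewise for \<open>h p\<close> and \<open>y p\<close>.  In a frustrated
  plaquette one of the two must be unsatisfied when the path is.\<close>

locale spots =
  fixes Q :: "edge set" and S :: "vert set" and g h :: "vert \<Rightarrow> edge" and x y :: "vert \<Rightarrow> vert"
    and block :: "vert \<Rightarrow> edge set" and t :: real
  assumes fin: "finite S" "finite Q" and t: "0 \<le> t"
    and gh: "p \<in> S \<Longrightarrow> g p \<noteq> h p" "p \<in> S \<Longrightarrow> g p \<notin> Q" "p \<in> S \<Longrightarrow> h p \<notin> Q"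
      "p \<in> S \<Longrightarrow> g p \<in> plaq p" "p \<in> S \<Longrightarrow> h p \<in> plaq p"
    and plaq: "p \<in> S \<Longrightarrow> plaq p - {g p, h p} \<subseteq> Q" "p \<in> S \<Longrightarrow> even (card (plaq p - {g p, h p}))"
    and x: "p \<in> S \<Longrightarrow> g p \<in> cut {x p}" "p \<in> S \<Longrightarrow> h p \<notin> cut {x p}"
    and y: "p \<in> S \<Longrightarrow> h p \<in> cut {y p}" "p \<in> S \<Longrightarrow> g p \<notin> cut {y p}"
    and block: "p \<in> S \<Longrightarrow> cut {x p} \<subseteq> block p" "p \<in> S \<Longrightarrow> cut {y p} \<subseteq> block p"
      "p \<in> S \<Longrightarrow> plaq p \<subseteq> block p" "p \<in> S \<Longrightarrow> finite (block p)" "p \<in> S \<Longrightarrow> card (block p) \<le> 16"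
    and disj: "disjoint_family_on block S"
begin

definition tame :: "vert \<Rightarrow> (edge \<Rightarrow> real) \<Rightarrow> bool" where
  "tame p w \<longleftrightarrow> (\<forall>e\<in>block p - {g p, h p}. \<bar>w e\<bar> \<le> t)"

text \<open>The other three edges at \<open>x p\<close> or \<open>y p\<close> weigh at most
  \<open>3 * t\<close> together, so an unsatisfied dominating edge makes the cut sum at most
  -1.\<close>

definition kill :: "vert \<Rightarrow> (edge \<Rightarrow> real) \<Rightarrow> bool" where
  "kill p w \<longleftrightarrow> tame p w \<and> 3 * t + 1 < \<bar>w (g p)\<bar> \<and> 3 * t + 1 < \<bar>w (h p)\<bar> \<and> frustrated p w"

lemma pred_tame [measurable]: "p \<in> S \<Longrightarrow> Measurable.pred W_space (tame p)"
  unfolding tame_def using block(4) measurable_coord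
  by (intro pred_intros_finite) auto

lemma pred_kill [measurable]: "p \<in> S \<Longrightarrow> Measurable.pred W_space (kill p)"
proof -
  assume [measurable]: "p \<in> S"
  have [measurable]: "(\<lambda>w. w (g p)) \<in> borel_measurable W_space" "(\<lambda>w. w (h p)) \<in> borel_measurable W_space"
    by (rule measurable_coord)+
  show ?thesis unfolding kill_def by measurable
qed

text \<open>A frustrated plaquette without vanishing weights has an odd number of unsatisfied edges,
  while its edges on the path account for an even number. Zero weights are excluded because the
  edges of \<open>Q\<close> are strictly unsatisfied and the other two are large.\<close>

lemma unsat_at_kill:
  assumes q: "q \<in> S" and p: "p \<in> unsat_event Q" and kill: "kill q (fst p)"
  shows "satis (fst p) (snd p) (g q) < 0 \<or> satis (fst p) (snd p) (h q) < 0"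
proof (rule ccontr)
  let ?s = "satis (fst p) (snd p)"
  assume neg: "\<not> ?thesis"
  have sp: "p \<in> space Omega" using p by (simp add: unsat_event_def)
  have neg': "?s e < 0" if "e \<in> plaq q - {g q, h q}" for e
    using p plaq(1)[OF q] that by (auto simp: unsat_event_def unsatisfied_def)
  have nz: "?s e \<noteq> 0" if "e \<in> plaq q" for e
  proof (cases "e = g q \<or> e = h q")
    case True
    then have "0 < \<bar>fst p e\<bar>" using kill t by (auto simp: kill_def)
    then show ?thesis using satis_abs[OF sp, of e] by auto
  next
    case False
    then show ?thesis using neg'[of e] that by auto
  qed
  then have "fst p e \<noteq> 0" if "e \<in> plaq q" for e using that satis_abs[OF sp, of e] by fastforce
  then have "(\<Prod>e\<in>plaq q. fst p e) < 0"
    using kill by (subst prod_neg_iff_odd) (auto simp: kill_def frustrated_def)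
  then have "(\<Prod>e\<in>plaq q. ?s e) < 0" by (simp only: prod_satis_plaq[OF sp])
  then have "odd (card {e \<in> plaq q. ?s e < 0})"
    using nz by (subst (asm) prod_neg_iff_odd) auto
  moreover have "{e \<in> plaq q. ?s e < 0} = plaq q - {g q, h q}"
    using neg neg' by auto
  ultimately show False using plaq(2)[OF q] by simp
qed

lemma sum_satis_kill:
  assumes q: "q \<in> S" and sp: "p \<in> space Omega" and kill: "kill q (fst p)"
  shows "satis (fst p) (snd p) (g q) < 0 \<Longrightarrow> (\<Sum>e\<in>cut {x q}. satis (fst p) (snd p) e) \<le> - 1"
    and "satis (fst p) (snd p) (h q) < 0 \<Longrightarrow> (\<Sum>e\<in>cut {y q}. satis (fst p) (snd p) e) \<le> - 1"
proof -
  let ?s = "satis (fst p) (snd p)"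
  have gen: "(\<Sum>e\<in>cut {z}. ?s e) \<le> - 1"
    if "e0 \<in> cut {z}" "?s e0 < 0" "3 * t + 1 < \<bar>fst p e0\<bar>" "cut {z} - {e0} \<subseteq> block q - {g q, h q}" for z e0
  proof -
    have "(\<Sum>e\<in>cut {z}. ?s e) = ?s e0 + (\<Sum>e\<in>cut {z} - {e0}. ?s e)"
      using that by (subst sum.remove[of _ e0]) auto
    also have "(\<Sum>e\<in>cut {z} - {e0}. ?s e) \<le> (\<Sum>e\<in>cut {z} - {e0}. t)"
    proof (rule sum_mono)
      fix e assume "e \<in> cut {z} - {e0}"
      then have "\<bar>fst p e\<bar> \<le> t" using that kill by (auto simp: kill_def tame_def)
      then show "?s e \<le> t" using satis_abs[OF sp, of e] by linarith
    qed
    also have "\<dots> = 3 * t" using that by (simp add: card_Diff_singleton card_cut_singleton)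
    finally show ?thesis using that satis_abs[OF sp, of e0] by linarith
  qed
  show "?s (g q) < 0 \<Longrightarrow> (\<Sum>e\<in>cut {x q}. ?s e) \<le> - 1"
    using x[OF q] block(1)[OF q] kill by (intro gen[of "g q"]) (auto simp: kill_def)
  show "?s (h q) < 0 \<Longrightarrow> (\<Sum>e\<in>cut {y q}. ?s e) \<le> - 1"
    using y[OF q] block(2)[OF q] kill by (intro gen[of "h q"]) (auto simp: kill_def)
qed

definition kills :: "(edge \<Rightarrow> real) \<Rightarrow> vert set" where
  "kills w = {p \<in> S. kill p w}"

lemma sets_kills: "J \<subseteq> S \<Longrightarrow> {w. kills w = J} \<in> sets W_space"
proof -
  assume "J \<subseteq> S"
  then have "{w. kills w = J} = {w \<in> space W_space. \<forall>p\<in>S. kill p w \<longleftrightarrow> p \<in> J}"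
    by (auto simp: kills_def)
  also have "\<dots> \<in> sets W_space"
    using fin by measurable
  finally show ?thesis .
qed

lemma measurable_kill_power: "(\<lambda>w. ennreal (r ^ card (kills w))) \<in> borel_measurable W_space"
proof -
  have kills_S: "kills w \<subseteq> S" for w by (auto simp: kills_def)
  have "(\<lambda>w. ennreal (r ^ card (kills w))) = (\<lambda>w. \<Sum>J\<in>Pow S. ennreal (r ^ card J) * indicator {w. kills w = J} w)"
    using fin kills_S by (auto simp: indicator_def of_bool_def if_distrib[of "\<lambda>u. _ * u"] cong: if_cong)
  also have "\<dots> \<in> borel_measurable W_space"
    using sets_kills by (intro borel_measurable_sum borel_measurable_times_ennreal borel_measurable_indicator) auto
  finally show ?thesis .
qed

text \<open>Stars inside disjoint blocks share no edge, so no two chosen vertices are adjacent and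
  the energy changes of a simultaneous flip add up.\<close>

lemma cut_choice:
  assumes J: "J \<subseteq> S" and z: "\<And>p. p \<in> J \<Longrightarrow> z p = x p \<or> z p = y p"
  shows "cut (z ` J) = (\<Union>p\<in>J. cut {z p})" "disjoint_family_on (\<lambda>p. cut {z p}) J"
proof -
  have sub: "cut {z p} \<subseteq> block p" if "p \<in> J" for p
  proof -
    have "p \<in> S" using J that by blast
    from block(1,2)[OF this] show ?thesis using z[OF that] by metis
  qed
  show disj': "disjoint_family_on (\<lambda>p. cut {z p}) J"
    using disj sub J unfolding disjoint_family_on_def by blast
  have neq: "end1 e \<noteq> end2 e" for e using lat_adj_neq lat_adj_ends by blast
  show "cut (z ` J) = (\<Union>p\<in>J. cut {z p})"
  proof (intro set_eqI iffI)
    fix e assume "e \<in> cut (z ` J)"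
    then show "e \<in> (\<Union>p\<in>J. cut {z p})" using neq[of e] by (auto simp: cut_def)
  next
    fix e assume "e \<in> (\<Union>p\<in>J. cut {z p})"
    then obtain p where p: "p \<in> J" "e \<in> cut {z p}" by blast
    have "\<not> (end1 e \<in> z ` J \<and> end2 e \<in> z ` J)"
    proof
      assume "end1 e \<in> z ` J \<and> end2 e \<in> z ` J"
      then obtain q q' where qq: "q \<in> J" "q' \<in> J" "end1 e = z q" "end2 e = z q'" by blast
      then have "e \<in> cut {z q}" "e \<in> cut {z q'}" using neq[of e] by (auto simp: cut_def)
      moreover have "q \<noteq> q'" using qq neq[of e] by auto
      ultimately show False using disj' qq by (auto simp: disjoint_family_on_def)
    qed
    then show "e \<in> cut (z ` J)" using p by (auto simp: cut_def)
  qed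
qed

text \<open>Each killed spot contributes a factor 2 for the choice of an unsatisfied edge among
  \<open>g\<close> and \<open>h\<close>, and a factor \<open>exp (- 2 * \<beta>)\<close> for the
  flip of the matching corner. The set \<open>c\<close> below collects the spots at which
  \<open>g\<close> is chosen.\<close>

lemma cond_bound_kills:
  assumes flip: "flip_bound \<beta> \<nu>" and sets: "sets \<nu> = sets Omega"
  shows "cond_bound \<nu> (unsat_event Q) (\<lambda>w. ennreal ((2 * exp (- 2 * \<beta>)) ^ card (kills w)))"
proof (rule cond_bound_partition[where I = "Pow S" and B = "\<lambda>J. {w. kills w = J}"])
  have kills_S: "kills w \<subseteq> S" for w by (auto simp: kills_def)
  show "(\<lambda>w. ennreal ((2 * exp (- 2 * \<beta>)) ^ card (kills w))) \<in> borel_measurable W_space"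
    by (rule measurable_kill_power)
  show "\<exists>J\<in>Pow S. w \<in> {w. kills w = J}" for w using kills_S by auto
  show "disjoint_family_on (\<lambda>J. {w. kills w = J}) (Pow S)" by (auto simp: disjoint_family_on_def)
  fix J A assume J: "J \<in> Pow S" and A: "A \<in> sets W_space" "A \<subseteq> {w. kills w = J}"
  have finJ: "finite J" using J fin finite_subset by blast
  define z where "z c p = (if p \<in> c then x p else y p)" for c p
  define E where "E c = {p \<in> unsat_event Q. \<forall>q\<in>J. satis (fst p) (snd p) (if q \<in> c then g q else h q) < 0}" for c
  have E_sets: "E c \<in> sets Omega" for c
  proof -
    have "{p \<in> space Omega. \<forall>q\<in>J. satis (fst p) (snd p) (if q \<in> c then g q else h q) < 0} \<in> sets Omega"
      using finJ by (intro sets.sets_Collect_finite_All sets_unsatisfied[unfolded unsatisfied_def])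
    moreover have "E c = unsat_event Q \<inter> {p \<in> space Omega. \<forall>q\<in>J. satis (fst p) (snd p) (if q \<in> c then g q else h q) < 0}"
      by (auto simp: E_def unsat_event_def)
    ultimately show ?thesis using sets_unsat_event[OF fin(2)] by auto
  qed
  have A': "{p \<in> space Omega. fst p \<in> A} \<in> sets Omega" using A(1) by measurable
  have one: "emeasure \<nu> (E c \<inter> {p \<in> space Omega. fst p \<in> A})
      \<le> (\<integral>\<^sup>+w. ennreal (exp (- 2 * \<beta> * real (card J))) * indicator A w \<partial>gauss)" for c
  proof (rule flip[unfolded flip_bound_def, rule_format, of "z c ` J" "E c" A "\<lambda>_. real (card J)"])
    fix p assume p: "p \<in> E c" "fst p \<in> A"
    then have sp: "p \<in> space Omega" by (simp add: E_def unsat_event_def)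
    have k: "kill q (fst p)" if "q \<in> J" for q using that p(2) A(2) by (auto simp: kills_def)
    have "(\<Sum>e\<in>cut (z c ` J). satis (fst p) (snd p) e) = (\<Sum>q\<in>J. \<Sum>e\<in>cut {z c q}. satis (fst p) (snd p) e)"
      using cut_choice[of J "z c"] J finJ
      by (subst sum.UNION_disjoint[symmetric]) (auto simp: z_def disjoint_family_on_def)
    also have "\<dots> \<le> (\<Sum>q\<in>J. - 1)"
    proof (rule sum_mono)
      fix q assume q: "q \<in> J"
      then have "satis (fst p) (snd p) (if q \<in> c then g q else h q) < 0" using p(1) by (auto simp: E_def)
      then show "(\<Sum>e\<in>cut {z c q}. satis (fst p) (snd p) e) \<le> - 1"
        using sum_satis_kill[OF _ sp k[OF q]] q J by (cases "q \<in> c") (auto simp: z_def)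
    qed
    finally show "(\<Sum>e\<in>cut (z c ` J). satis (fst p) (snd p) e) \<le> - real (card J)" by simp
  qed (use finJ E_sets A in auto)
  have "emeasure \<nu> (unsat_event Q \<inter> {p \<in> space Omega. fst p \<in> A})
      \<le> emeasure \<nu> (\<Union>c\<in>Pow J. E c \<inter> {p \<in> space Omega. fst p \<in> A})"
  proof (rule emeasure_mono)
    show "unsat_event Q \<inter> {p \<in> space Omega. fst p \<in> A} \<subseteq> (\<Union>c\<in>Pow J. E c \<inter> {p \<in> space Omega. fst p \<in> A})"
    proof
      fix p assume p: "p \<in> unsat_event Q \<inter> {p \<in> space Omega. fst p \<in> A}"
      have "satis (fst p) (snd p) (g q) < 0 \<or> satis (fst p) (snd p) (h q) < 0" if "q \<in> J" for q
      proof (rule unsat_at_kill)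
        show "q \<in> S" using that J by auto
        show "kill q (fst p)" using that p A(2) by (auto simp: kills_def)
      qed (use p in simp)
      then have "p \<in> E {q \<in> J. satis (fst p) (snd p) (g q) < 0}"
        using p by (auto simp: E_def)
      then show "p \<in> (\<Union>c\<in>Pow J. E c \<inter> {p \<in> space Omega. fst p \<in> A})"
        by (intro UN_I[of "{q \<in> J. satis (fst p) (snd p) (g q) < 0}"] IntI) (use p in auto)
    qed
    show "(\<Union>c\<in>Pow J. E c \<inter> {p \<in> space Omega. fst p \<in> A}) \<in> sets \<nu>"
      unfolding sets by (intro sets.finite_UN sets.Int E_sets A') (simp add: finJ)
  qed
  also have "\<dots> \<le> (\<Sum>c\<in>Pow J. emeasure \<nu> (E c \<inter> {p \<in> space Omega. fst p \<in> A}))"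
  proof (intro emeasure_subadditive_finite)
    show "finite (Pow J)" using finJ by simp
    show "(\<lambda>c. E c \<inter> {p \<in> space Omega. fst p \<in> A}) ` Pow J \<subseteq> sets \<nu>"
      unfolding sets using E_sets A' by blast
  qed
  also have "\<dots> \<le> (\<Sum>c\<in>Pow J. \<integral>\<^sup>+w. ennreal (exp (- 2 * \<beta> * real (card J))) * indicator A w \<partial>gauss)"
    by (intro sum_mono one)
  also have "\<dots> = of_nat (2 ^ card J) * (\<integral>\<^sup>+w. ennreal (exp (- 2 * \<beta> * real (card J))) * indicator A w \<partial>gauss)"
    by (simp only: sum_constant card_Pow[OF finJ])
  also have "\<dots> = ennreal (2 ^ card J) * (ennreal (exp (- 2 * \<beta> * real (card J))) * emeasure gauss A)"
    using A(1) by (subst nn_integral_cmult_indicator) (simp_all add: sets_gauss ennreal_of_nat_eq_real_of_nat)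
  also have "\<dots> = ennreal (2 ^ card J * exp (- 2 * \<beta> * real (card J))) * emeasure gauss A"
    by (simp add: ennreal_mult mult.assoc)
  also have "2 ^ card J * exp (- 2 * \<beta> * real (card J)) = (2 * exp (- 2 * \<beta>)) ^ card J"
    using exp_of_nat_mult[of "card J" "- 2 * \<beta>"] by (simp only: power_mult_distrib mult.commute)
  also have "ennreal ((2 * exp (- 2 * \<beta>)) ^ card J) * emeasure gauss A
      = (\<integral>\<^sup>+w. ennreal ((2 * exp (- 2 * \<beta>)) ^ card J) * indicator A w \<partial>gauss)"
    using A(1) by (simp add: nn_integral_cmult_indicator sets_gauss)
  also have "\<dots> = (\<integral>\<^sup>+w. ennreal ((2 * exp (- 2 * \<beta>)) ^ card (kills w)) * indicator A w \<partial>gauss)"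
    using A(2) by (intro nn_integral_cong) (auto simp: indicator_def)
  finally show "emeasure \<nu> (unsat_event Q \<inter> {p \<in> space Omega. fst p \<in> A})
      \<le> (\<integral>\<^sup>+w. ennreal ((2 * exp (- 2 * \<beta>)) ^ card (kills w)) * indicator A w \<partial>gauss)" .
qed (use sets fin sets_unsat_event sets_kills in auto)

section \<open>Comparing killed spots with tame spots\<close>

lemma tame_update: "e \<notin> block p - {g p, h p} \<Longrightarrow> tame p (w(e := v)) = tame p w"
  by (auto simp: tame_def)

lemma frustrated_update_other: "e \<notin> plaq p \<Longrightarrow> frustrated p (w(e := v)) = frustrated p w"
proof -
  assume "e \<notin> plaq p"
  then have "{f \<in> plaq p. (w(e := v)) f < 0} = {f \<in> plaq p. w f < 0}" by auto
  then show ?thesis by (simp add: frustrated_def)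
qed

lemma kill_update:
  assumes "p \<in> S" "e \<notin> block p"
  shows "kill p (w(e := v)) = kill p w"
proof -
  have "e \<notin> plaq p" "e \<noteq> g p" "e \<noteq> h p" using assms block(3)[of p] gh(4,5)[of p] by auto
  then show ?thesis using assms(2) by (simp add: kill_def tame_update frustrated_update_other)
qed

lemma notin_other_block:
  assumes "p \<in> S" "q \<in> S" "p \<noteq> q"
  shows "g p \<notin> block q" "h p \<notin> block q"
proof -
  have "block p \<inter> block q = {}" using disj assms by (auto simp: disjoint_family_on_def)
  then show "g p \<notin> block q" "h p \<notin> block q"
    using block(3)[OF assms(1)] gh(4,5)[OF assms(1)] by auto
qed

definition tail :: real where
  "tail = measure normal {x. 3 * t + 1 < \<bar>x\<bar>}"

lemma emeasure_tail: "emeasure normal {x. 3 * t + 1 < \<bar>x\<bar>} = ennreal tail"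
proof -
  interpret prob_space normal by (rule prob_space_normal)
  show ?thesis by (simp add: tail_def emeasure_eq_measure)
qed

lemma tail_bounds: "0 \<le> tail" "tail \<le> 1"
proof -
  interpret prob_space normal by (rule prob_space_normal)
  show "0 \<le> tail" "tail \<le> 1" by (simp_all add: tail_def)
qed

lemma sets_tame: "p \<in> S \<Longrightarrow> {w. tame p w} \<in> sets W_space"
  using pred_tame[of p] by (simp add: pred_def)

lemma sets_kill: "p \<in> S \<Longrightarrow> {w. kill p w} \<in> sets W_space"
  using pred_kill[of p] by (simp add: pred_def)

text \<open>Tameness does not involve \<open>g p\<close> and \<open>h p\<close>, which lie off the
  path, where \<open>F\<close> is increasing. Redrawing first \<open>h p\<close> and then
  \<open>g p\<close> turns a tame spot into a killed one at the price \<open>tail / 2\<close>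
  each.\<close>

lemma kill_integral_ge:
  assumes F[measurable]: "F \<in> borel_measurable W_space"
    and mono: "\<And>w e v v'. e \<notin> Q \<Longrightarrow> \<bar>v\<bar> \<le> \<bar>v'\<bar> \<Longrightarrow> F (w(e := v)) \<le> F (w(e := v'))"
    and p: "p \<in> S" and H[measurable]: "H \<in> borel_measurable W_space"
    and Hg: "\<And>w v. H (w(g p := v)) = H w" and Hh: "\<And>w v. H (w(h p := v)) = H w"
  shows "ennreal ((tail / 2)\<^sup>2) * (\<integral>\<^sup>+w. F w * (H w * indicator {w. tame p w} w) \<partial>gauss)
    \<le> (\<integral>\<^sup>+w. F w * (H w * indicator {w. kill p w} w) \<partial>gauss)"
proof -
  let ?T = "3 * t + 1"
  let ?c = "ennreal (1/2) * emeasure normal {x. ?T < \<bar>x\<bar>}"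
  have c: "?c = ennreal (tail / 2)"
    unfolding emeasure_tail by (subst ennreal_mult[symmetric]) (use tail_bounds in auto)
  note [measurable] = sets_tame[OF p] sets_kill[OF p]
  define A where "A = {w :: edge \<Rightarrow> real. ?T < \<bar>w (h p)\<bar>}"
  have A[measurable]: "A \<in> sets W_space"
  proof -
    have [measurable]: "(\<lambda>w. w (h p)) \<in> borel_measurable W_space" by (rule measurable_coord)
    have "{w \<in> space W_space. ?T < \<bar>w (h p)\<bar>} \<in> sets W_space" by measurable
    then show ?thesis by (simp add: A_def)
  qed
  \<comment> \<open>\<open>b\<close> holds if a positive coupling at \<open>g p\<close> would leave
    the plaquette unfrustrated, that is, if \<open>g p\<close> must be negative.\<close>
  define b where "b w \<longleftrightarrow> \<not> frustrated p (w(g p := 1))" for w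
  have b[measurable]: "Measurable.pred W_space b"
  proof -
    have [measurable]: "(\<lambda>w. w(g p := 1)) \<in> W_space \<rightarrow>\<^sub>M W_space"
      by (rule measurable_update) auto
    show ?thesis unfolding b_def by measurable
  qed
  have b_indep: "b (w(g p := v)) = b w" for w v by (simp add: b_def)
  have b_frust: "(w (g p) < 0 \<longleftrightarrow> b w) \<longleftrightarrow> frustrated p w" for w
    using frustrated_update[OF gh(4)[OF p], of w 1] frustrated_update[OF gh(4)[OF p], of w "w (g p)"]
    by (auto simp: b_def)
  have tame_g: "indicator {w. tame p w} (w(g p := v)) = (indicator {w. tame p w} w :: ennreal)" for w v
    by (simp add: indicator_def tame_update)
  have tame_h: "indicator {w. tame p w} (w(h p := v)) = (indicator {w. tame p w} w :: ennreal)" for w v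
    by (simp add: indicator_def tame_update)
  have Ag: "indicator A (w(g p := v)) = (indicator A w :: ennreal)" for w v
    using gh(1)[OF p] by (simp add: indicator_def A_def)
  \<comment> \<open>The sign of \<open>h p\<close> is fixed arbitrarily, since the sign of
    \<open>g p\<close> can still produce frustration; only the size of \<open>h p\<close> is
    kept.\<close>
  have "?c * (\<integral>\<^sup>+w. F w * (H w * indicator {w. tame p w} w) \<partial>gauss)
      \<le> (\<integral>\<^sup>+w. F w * (H w * indicator {w. tame p w} w) *
          indicator {w. ?T < \<bar>w (h p)\<bar> \<and> (w (h p) < 0 \<longleftrightarrow> True)} w \<partial>gauss)"
    by (rule gauss_half_tail) (use t gh(3)[OF p] in \<open>auto intro!: mono simp: Hh tame_h\<close>)
  also have "\<dots> \<le> (\<integral>\<^sup>+w. F w * (H w * indicator {w. tame p w} w * indicator A w) \<partial>gauss)"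
    by (intro nn_integral_mono) (auto simp: indicator_def A_def mult.assoc)
  finally have 1: "?c * (?c * (\<integral>\<^sup>+w. F w * (H w * indicator {w. tame p w} w) \<partial>gauss))
      \<le> ?c * (\<integral>\<^sup>+w. F w * (H w * indicator {w. tame p w} w * indicator A w) \<partial>gauss)"
    by (rule mult_left_mono) simp
  also have "\<dots> \<le> (\<integral>\<^sup>+w. F w * (H w * indicator {w. tame p w} w * indicator A w) *
          indicator {w. ?T < \<bar>w (g p)\<bar> \<and> (w (g p) < 0 \<longleftrightarrow> b w)} w \<partial>gauss)"
    by (rule gauss_half_tail[OF F _ b]) (use t gh(2)[OF p] in \<open>auto intro!: mono simp: Hg tame_g Ag b_indep\<close>)
  also have "\<dots> \<le> (\<integral>\<^sup>+w. F w * (H w * indicator {w. kill p w} w) \<partial>gauss)"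
    using b_frust by (intro nn_integral_mono) (auto simp: indicator_def A_def kill_def)
  finally have "?c * (?c * (\<integral>\<^sup>+w. F w * (H w * indicator {w. tame p w} w) \<partial>gauss))
      \<le> (\<integral>\<^sup>+w. F w * (H w * indicator {w. kill p w} w) \<partial>gauss)" .
  moreover have "ennreal ((tail / 2)\<^sup>2) = ?c * ?c"
    unfolding c power2_eq_square by (rule ennreal_mult) (use tail_bounds in auto)
  ultimately show ?thesis by (simp only: mult.assoc)
qed

definition kfac :: "real \<Rightarrow> vert \<Rightarrow> (edge \<Rightarrow> real) \<Rightarrow> ennreal" where
  "kfac \<theta> p w = (if kill p w then ennreal \<theta> else 1)"

definition tfac :: "real \<Rightarrow> vert \<Rightarrow> (edge \<Rightarrow> real) \<Rightarrow> ennreal" where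
  "tfac \<delta> p w = (if tame p w then ennreal (1 - \<delta>) else 1)"

lemma measurable_kfac [measurable]: "p \<in> S \<Longrightarrow> kfac \<theta> p \<in> borel_measurable W_space"
  unfolding kfac_def using pred_kill by measurable

lemma measurable_tfac [measurable]: "p \<in> S \<Longrightarrow> tfac \<delta> p \<in> borel_measurable W_space"
  unfolding tfac_def using pred_tame by measurable

text \<open>Both integrals are \<open>F * H\<close> minus a multiple of the killed or the tame part,
  and \<delta> is the multiple for which the previous comparison applies. The trade is against
  tameness, not the whole space, because bounded weights in the block need not be favoured by
  \<open>F\<close>.\<close>

lemma kill_integral_step:
  assumes F[measurable]: "F \<in> borel_measurable W_space" and F1: "\<And>w. F w \<le> 1"
    and mono: "\<And>w e v v'. e \<notin> Q \<Longrightarrow> \<bar>v\<bar> \<le> \<bar>v'\<bar> \<Longrightarrow> F (w(e := v)) \<le> F (w(e := v'))"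
    and p: "p \<in> S" and H[measurable]: "H \<in> borel_measurable W_space" and H1: "\<And>w. H w \<le> 1"
    and Hg: "\<And>w v. H (w(g p := v)) = H w" and Hh: "\<And>w v. H (w(h p := v)) = H w"
    and \<theta>: "0 \<le> \<theta>" "\<theta> \<le> 1" and \<delta>: "\<delta> = (1 - \<theta>) * (tail / 2)\<^sup>2"
  shows "(\<integral>\<^sup>+w. F w * (H w * kfac \<theta> p w) \<partial>gauss) \<le> (\<integral>\<^sup>+w. F w * (H w * tfac \<delta> p w) \<partial>gauss)"
proof -
  interpret G: prob_space gauss by (rule prob_space_gauss)
  note [measurable] = sets_tame[OF p] sets_kill[OF p] measurable_kfac[OF p] measurable_tfac[OF p]
  have \<delta>01: "0 \<le> \<delta>" "\<delta> \<le> 1"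
  proof -
    have "(tail / 2)\<^sup>2 \<le> 1" using tail_bounds by (simp add: power_le_one)
    then show "0 \<le> \<delta>" "\<delta> \<le> 1" using \<theta> unfolding \<delta> by (auto intro: mult_le_one)
  qed
  let ?K = "\<integral>\<^sup>+w. F w * (H w * indicator {w. kill p w} w) \<partial>gauss"
  let ?T = "\<integral>\<^sup>+w. F w * (H w * indicator {w. tame p w} w) \<partial>gauss"
  have "(\<integral>\<^sup>+w. F w * (H w * kfac \<theta> p w) \<partial>gauss) + ennreal (1 - \<theta>) * ?K = (\<integral>\<^sup>+w. F w * H w \<partial>gauss)"
  proof -
    have "F w * (H w * kfac \<theta> p w) + ennreal (1 - \<theta>) * (F w * (H w * indicator {w. kill p w} w)) = F w * H w" for w
    proof (cases "kill p w")
      case True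
      have "F w * (H w * ennreal \<theta>) + ennreal (1 - \<theta>) * (F w * H w) = (ennreal \<theta> + ennreal (1 - \<theta>)) * (F w * H w)"
        by (subst distrib_right) (simp only: mult.commute mult.left_commute)
      also have "ennreal \<theta> + ennreal (1 - \<theta>) = 1" using \<theta> by (subst ennreal_plus[symmetric]) auto
      finally show ?thesis using True by (simp add: kfac_def)
    qed (simp add: kfac_def)
    then show ?thesis
      by (subst nn_integral_cmult[symmetric], measurable, subst nn_integral_add[symmetric], measurable)
  qed
  moreover have "(\<integral>\<^sup>+w. F w * (H w * tfac \<delta> p w) \<partial>gauss) + ennreal \<delta> * ?T = (\<integral>\<^sup>+w. F w * H w \<partial>gauss)"
  proof -
    have "F w * (H w * tfac \<delta> p w) + ennreal \<delta> * (F w * (H w * indicator {w. tame p w} w)) = F w * H w" for w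
    proof (cases "tame p w")
      case True
      have "F w * (H w * ennreal (1 - \<delta>)) + ennreal \<delta> * (F w * H w) = (ennreal (1 - \<delta>) + ennreal \<delta>) * (F w * H w)"
        by (subst distrib_right) (simp only: mult.commute mult.left_commute)
      also have "ennreal (1 - \<delta>) + ennreal \<delta> = 1" using \<delta>01 by (subst ennreal_plus[symmetric]) auto
      finally show ?thesis using True by (simp add: tfac_def)
    qed (simp add: tfac_def)
    then show ?thesis
      by (subst nn_integral_cmult[symmetric], measurable, subst nn_integral_add[symmetric], measurable)
  qed
  moreover have "ennreal \<delta> * ?T \<le> ennreal (1 - \<theta>) * ?K"
  proof -
    have "ennreal \<delta> * ?T = ennreal (1 - \<theta>) * (ennreal ((tail / 2)\<^sup>2) * ?T)"
      using \<theta> by (simp add: \<delta> ennreal_mult mult.assoc)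
    also have "\<dots> \<le> ennreal (1 - \<theta>) * ?K"
      by (intro mult_left_mono kill_integral_ge F mono p H Hg Hh) auto
    finally show ?thesis .
  qed
  \<comment> \<open>Finiteness allows this term to be cancelled at the end.\<close>
  moreover have "ennreal \<delta> * ?T \<noteq> \<top>"
  proof -
    have "?T \<le> (\<integral>\<^sup>+w. 1 \<partial>gauss)"
      by (intro nn_integral_mono) (auto simp: indicator_def intro: mult_le_one F1 H1)
    also have "\<dots> = 1" using G.emeasure_space_1 by simp
    finally have "?T < \<top>" by (rule order.strict_trans1) simp
    then show ?thesis by (simp add: ennreal_mult_eq_top_iff)
  qed
  ultimately have fin: "ennreal \<delta> * ?T \<noteq> \<top>" and le: "ennreal \<delta> * ?T \<le> ennreal (1 - \<theta>) * ?K"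
    and eq: "(\<integral>\<^sup>+w. F w * (H w * kfac \<theta> p w) \<partial>gauss) + ennreal (1 - \<theta>) * ?K
      = (\<integral>\<^sup>+w. F w * (H w * tfac \<delta> p w) \<partial>gauss) + ennreal \<delta> * ?T"
    by simp_all
  have "ennreal \<delta> * ?T + (\<integral>\<^sup>+w. F w * (H w * kfac \<theta> p w) \<partial>gauss)
      \<le> ennreal (1 - \<theta>) * ?K + (\<integral>\<^sup>+w. F w * (H w * kfac \<theta> p w) \<partial>gauss)"
    by (rule add_right_mono[OF le])
  also have "\<dots> = ennreal \<delta> * ?T + (\<integral>\<^sup>+w. F w * (H w * tfac \<delta> p w) \<partial>gauss)"
    using eq by (simp only: add.commute)
  finally show ?thesis
    using fin by (simp add: ennreal_add_left_cancel_le)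
qed

lemma prod_kills: "(\<Prod>p\<in>S. kfac \<theta> p w) = ennreal \<theta> ^ card (kills w)"
  unfolding kfac_def kills_def by (subst prod.inter_filter[symmetric, OF fin(1)]) simp

text \<open>Spots move from \<open>A\<close> to \<open>B\<close> one by one. The factors of the
  other spots live on disjoint blocks, so redrawing \<open>g p\<close> and \<open>h p\<close> leaves
  them unchanged.\<close>

lemma kills_integral:
  assumes F[measurable]: "F \<in> borel_measurable W_space" and F1: "\<And>w. F w \<le> 1"
    and mono: "\<And>w e v v'. e \<notin> Q \<Longrightarrow> \<bar>v\<bar> \<le> \<bar>v'\<bar> \<Longrightarrow> F (w(e := v)) \<le> F (w(e := v'))"
    and \<theta>: "0 \<le> \<theta>" "\<theta> \<le> 1" and \<delta>: "\<delta> = (1 - \<theta>) * (tail / 2)\<^sup>2"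
  shows "(\<integral>\<^sup>+w. F w * ennreal \<theta> ^ card (kills w) \<partial>gauss) \<le> (\<integral>\<^sup>+w. F w * (\<Prod>p\<in>S. tfac \<delta> p w) \<partial>gauss)"
proof -
  have "(\<integral>\<^sup>+w. F w * ((\<Prod>p\<in>A. kfac \<theta> p w) * (\<Prod>p\<in>B. tfac \<delta> p w)) \<partial>gauss)
      \<le> (\<integral>\<^sup>+w. F w * (\<Prod>p\<in>A \<union> B. tfac \<delta> p w) \<partial>gauss)"
    if "finite A" "A \<inter> B = {}" "A \<union> B \<subseteq> S" for A B
    using that
  proof (induction A arbitrary: B)
    case (insert p A)
    then have p: "p \<in> S" and AB: "A \<subseteq> S" "B \<subseteq> S" "finite B" "p \<notin> B" "p \<notin> A"
      using finite_subset[of B S] fin by auto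
    define H where "H w = (\<Prod>q\<in>A. kfac \<theta> q w) * (\<Prod>q\<in>B. tfac \<delta> q w)" for w
    have upd: "H (w(e := v)) = H w" if "e = g p \<or> e = h p" for w e v
    proof -
      have "kfac \<theta> q (w(e := v)) = kfac \<theta> q w" "tfac \<delta> q (w(e := v)) = tfac \<delta> q w" if "q \<in> A \<union> B" for q
      proof -
        have "q \<in> S" "p \<noteq> q" using that AB by auto
        then have "e \<notin> block q"
          using notin_other_block[OF p \<open>q \<in> S\<close> \<open>p \<noteq> q\<close>] \<open>e = g p \<or> e = h p\<close> by metis
        then show "kfac \<theta> q (w(e := v)) = kfac \<theta> q w" "tfac \<delta> q (w(e := v)) = tfac \<delta> q w"
          using \<open>q \<in> S\<close> by (simp_all add: kfac_def tfac_def kill_update tame_update)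
      qed
      then show ?thesis unfolding H_def by simp
    qed
    have "(\<integral>\<^sup>+w. F w * ((\<Prod>p\<in>insert p A. kfac \<theta> p w) * (\<Prod>p\<in>B. tfac \<delta> p w)) \<partial>gauss)
        = (\<integral>\<^sup>+w. F w * (H w * kfac \<theta> p w) \<partial>gauss)"
      using insert AB by (intro nn_integral_cong) (simp add: H_def ac_simps)
    also have "\<dots> \<le> (\<integral>\<^sup>+w. F w * (H w * tfac \<delta> p w) \<partial>gauss)"
    proof (rule kill_integral_step[OF F F1 mono p _ _ _ _ \<theta> \<delta>])
      show "H \<in> borel_measurable W_space"
        unfolding H_def using AB measurable_kfac measurable_tfac
        by (intro borel_measurable_times_ennreal borel_measurable_prod_ennreal) auto
      have "0 \<le> \<delta>" using \<theta> by (simp add: \<delta>)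
      then show "H w \<le> 1" for w
        unfolding H_def using \<theta> by (intro mult_le_one prod_le_1) (auto simp: kfac_def tfac_def)
    qed (use upd in auto)
    also have "\<dots> = (\<integral>\<^sup>+w. F w * ((\<Prod>p\<in>A. kfac \<theta> p w) * (\<Prod>p\<in>insert p B. tfac \<delta> p w)) \<partial>gauss)"
      using AB by (intro nn_integral_cong) (simp add: H_def ac_simps)
    also have "\<dots> \<le> (\<integral>\<^sup>+w. F w * (\<Prod>p\<in>A \<union> insert p B. tfac \<delta> p w) \<partial>gauss)"
      using insert AB by (intro insert.IH) auto
    finally show ?case by simp
  qed simp
  from this[of S "{}"] fin show ?thesis by (simp add: prod_kills)
qed

text \<open>Each spot that is not tame has an edge heavier than \<open>t\<close> in its own block.
  Disjointness of the blocks makes \<open>k\<close> such edges distinct, and they form one of at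
  most \<open>2 ^ (16 * card S)\<close> subsets of the union of the blocks.\<close>

lemma many_not_tame:
  "emeasure gauss {w. k \<le> card {p \<in> S. \<not> tame p w}} \<le>
     ennreal (2 ^ (16 * card S)) * emeasure normal {x. t < \<bar>x\<bar>} ^ k"
proof -
  interpret G: prob_space gauss by (rule prob_space_gauss)
  let ?U = "\<Union>p\<in>S. block p"
  have finU: "finite ?U" using fin block by auto
  have cardU: "card ?U \<le> 16 * card S"
  proof -
    have "card ?U \<le> (\<Sum>p\<in>S. card (block p))" by (intro card_UN_le fin)
    also have "\<dots> \<le> (\<Sum>p\<in>S. 16)" by (intro sum_mono block)
    finally show ?thesis by simp
  qed
  let ?KK = "{K \<in> Pow ?U. card K = k}"
  let ?L = "\<lambda>K. {w :: edge \<Rightarrow> real. \<forall>e\<in>K. t < \<bar>w e\<bar>}"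
  have finK: "finite ?KK" using finU by simp
  have L: "?L K \<in> sets gauss" if "K \<in> ?KK" for K
  proof -
    have "finite K" using that finU finite_subset by blast
    then have "{w \<in> space W_space. \<forall>e\<in>K. t < \<bar>w e\<bar>} \<in> sets W_space"
      using measurable_coord by measurable
    then show ?thesis by (simp add: sets_gauss)
  qed
  have "emeasure gauss {w. k \<le> card {p \<in> S. \<not> tame p w}} \<le> emeasure gauss (\<Union>K\<in>?KK. ?L K)"
  proof (rule emeasure_mono)
    show "{w. k \<le> card {p \<in> S. \<not> tame p w}} \<subseteq> (\<Union>K\<in>?KK. ?L K)"
    proof
      fix w assume "w \<in> {w. k \<le> card {p \<in> S. \<not> tame p w}}"
      then obtain N where N: "N \<subseteq> {p \<in> S. \<not> tame p w}" "card N = k" "finite N"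
        by (auto elim: obtain_subset_with_card_n)
      have "\<forall>p\<in>N. \<exists>e. e \<in> block p \<and> t < \<bar>w e\<bar>"
        using N by (auto simp: tame_def not_le)
      then obtain c where c: "\<And>p. p \<in> N \<Longrightarrow> c p \<in> block p \<and> t < \<bar>w (c p)\<bar>" by metis
      have "inj_on c N"
      proof (rule inj_onI)
        fix p q assume pq: "p \<in> N" "q \<in> N" "c p = c q"
        show "p = q"
        proof (rule ccontr)
          assume "p \<noteq> q"
          moreover have "p \<in> S" "q \<in> S" using N pq by auto
          ultimately have "block p \<inter> block q = {}" using disj by (auto simp: disjoint_family_on_def)
          then show False using c[OF pq(1)] c[OF pq(2)] pq(3) by auto
        qed
      qed
      then have "card (c ` N) = k" using N by (simp add: card_image)
      moreover have "c ` N \<subseteq> ?U" using c N by blast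
      moreover have "w \<in> ?L (c ` N)" using c by auto
      ultimately show "w \<in> (\<Union>K\<in>?KK. ?L K)" by blast
    qed
    show "(\<Union>K\<in>?KK. ?L K) \<in> sets gauss" by (intro sets.finite_UN finK L)
  qed
  also have "\<dots> \<le> (\<Sum>K\<in>?KK. emeasure gauss (?L K))"
    by (intro emeasure_subadditive_finite finK) (use L in blast)
  also have "\<dots> \<le> (\<Sum>K\<in>?KK. emeasure normal {x. t < \<bar>x\<bar>} ^ k)"
  proof (rule sum_mono)
    fix K assume K: "K \<in> ?KK"
    then have "finite K" using finU finite_subset by blast
    from emeasure_gauss_all_large[OF this, of t] K
    show "emeasure gauss (?L K) \<le> emeasure normal {x. t < \<bar>x\<bar>} ^ k" by simp
  qed
  also have "\<dots> = of_nat (card ?KK) * emeasure normal {x. t < \<bar>x\<bar>} ^ k" by simp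
  also have "\<dots> \<le> ennreal (2 ^ (16 * card S)) * emeasure normal {x. t < \<bar>x\<bar>} ^ k"
  proof (rule mult_right_mono)
    have "card ?KK \<le> card (Pow ?U)" using finU by (intro card_mono) auto
    also have "\<dots> = 2 ^ card ?U" using finU by (rule card_Pow)
    also have "\<dots> \<le> 2 ^ (16 * card S)" using cardU by (intro power_increasing) auto
    finally have "real (card ?KK) \<le> real (2 ^ (16 * card S))" by (rule of_nat_mono)
    then show "of_nat (card ?KK) \<le> ennreal (2 ^ (16 * card S))"
      by (simp add: ennreal_of_nat_eq_real_of_nat)
  qed simp
  finally show ?thesis .
qed

text \<open>Half of the \<open>2 * k\<close> spots suffice: either at least \<open>k\<close> are
  tame and give the factor, or at least \<open>k\<close> are not, which is rare.\<close>

lemma tame_integral: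
  assumes F[measurable]: "F \<in> borel_measurable W_space" and F1: "\<And>w. F w \<le> 1"
    and \<delta>: "0 \<le> \<delta>" "\<delta> \<le> 1" and card: "card S = 2 * k"
  shows "(\<integral>\<^sup>+w. F w * (\<Prod>p\<in>S. tfac \<delta> p w) \<partial>gauss)
    \<le> ennreal (1 - \<delta>) ^ k * (\<integral>\<^sup>+w. F w \<partial>gauss)
      + ennreal (2 ^ (32 * k)) * emeasure normal {x. t < \<bar>x\<bar>} ^ k"
proof -
  let ?M = "{w. k \<le> card {p \<in> S. \<not> tame p w}}"
  have M[measurable]: "?M \<in> sets W_space"
  proof -
    have "(\<lambda>w. \<Sum>p\<in>S. if tame p w then 0 else 1 :: real) \<in> borel_measurable W_space"
      using pred_tame by (intro borel_measurable_sum) measurable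
    then have "{w \<in> space W_space. real k \<le> (\<Sum>p\<in>S. if tame p w then 0 else 1 :: real)} \<in> sets W_space"
      by measurable
    moreover have "(\<Sum>p\<in>S. if tame p w then 0 else 1 :: real) = real (card {p \<in> S. \<not> tame p w})" for w
      using sum.inter_filter[OF fin(1), of "\<lambda>_. 1 :: real" "\<lambda>p. \<not> tame p w"]
      by (simp add: if_distrib[of Not] cong: if_cong) (metis (mono_tags, lifting) sum.cong)
    ultimately show ?thesis by simp
  qed
  have "F w * (\<Prod>p\<in>S. tfac \<delta> p w) \<le> ennreal (1 - \<delta>) ^ k * F w + indicator ?M w" for w
  proof -
    have "(\<Prod>p\<in>S. tfac \<delta> p w) = ennreal (1 - \<delta>) ^ card {p \<in> S. tame p w}"
      unfolding tfac_def by (subst prod.inter_filter[symmetric, OF fin(1)]) simp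
    moreover have le1: "ennreal (1 - \<delta>) \<le> 1" using \<delta> by simp
    moreover have "k \<le> card {p \<in> S. tame p w}" if "w \<notin> ?M"
    proof -
      have "card S = card {p \<in> S. tame p w} + card {p \<in> S. \<not> tame p w}"
        using fin by (subst card_Un_disjoint[symmetric]) (auto intro!: arg_cong[where f=card])
      then show ?thesis using that card by simp
    qed
    ultimately have *: "w \<notin> ?M \<Longrightarrow> (\<Prod>p\<in>S. tfac \<delta> p w) \<le> ennreal (1 - \<delta>) ^ k" "(\<Prod>p\<in>S. tfac \<delta> p w) \<le> 1"
      by (auto intro: power_decreasing power_le_one)
    show ?thesis
    proof (cases "w \<in> ?M")
      case True
      have "F w * (\<Prod>p\<in>S. tfac \<delta> p w) \<le> 1" using F1 *(2) by (intro mult_le_one) auto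
      then show ?thesis using True by (intro add_increasing) auto
    next
      case False
      then show ?thesis using mult_left_mono[OF *(1)[OF False], of "F w"] by (simp add: mult.commute)
    qed
  qed
  then have "(\<integral>\<^sup>+w. F w * (\<Prod>p\<in>S. tfac \<delta> p w) \<partial>gauss)
      \<le> (\<integral>\<^sup>+w. ennreal (1 - \<delta>) ^ k * F w + indicator ?M w \<partial>gauss)"
    by (intro nn_integral_mono) auto
  also have "\<dots> = ennreal (1 - \<delta>) ^ k * (\<integral>\<^sup>+w. F w \<partial>gauss) + emeasure gauss ?M"
    by (subst nn_integral_add) (auto simp: nn_integral_cmult sets_gauss)
  also have "emeasure gauss ?M \<le> ennreal (2 ^ (32 * k)) * emeasure normal {x. t < \<bar>x\<bar>} ^ k"
    using many_not_tame[of k] card by (simp add: mult.assoc[symmetric])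
  finally show ?thesis by (simp add: add_left_mono)
qed

end

subsection \<open>The number of near-minimal paths\<close>

definition saws_to :: "vert \<Rightarrow> nat \<Rightarrow> vert \<Rightarrow> vert list set" where
  "saws_to u n v = {\<pi> \<in> saws u n. last \<pi> = v}"

lemma finite_saws_to [simp]: "finite (saws_to u n v)"
  by (simp add: saws_to_def)

lemma saws_to_dpath: "\<pi> \<in> saws_to u n v \<Longrightarrow> dpath \<pi> \<and> hd \<pi> = u \<and> last \<pi> = v"
  by (simp add: saws_to_def saws_def)

lemma card_pedges_saws_to: "\<pi> \<in> saws_to u n v \<Longrightarrow> card (pedges \<pi>) = n"
  by (simp add: saws_to_def saws_def card_pedges)

lemma len_mono:
  "(\<And>e. e \<in> S \<Longrightarrow> \<bar>w e\<bar> \<le> \<bar>w' e\<bar>) \<Longrightarrow> len w S \<le> len w' S"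
  unfolding len_def by (intro sum_mono)

lemma len_cong:
  "(\<And>e. e \<in> S \<Longrightarrow> \<bar>w e\<bar> = \<bar>w' e\<bar>) \<Longrightarrow> len w S = len w' S"
  unfolding len_def by (intro sum.cong) auto

lemma geo_mono:
  assumes "w \<in> geo P \<rho>" "\<And>e. \<bar>w e\<bar> \<le> \<bar>w' e\<bar>" "\<And>e. e \<in> pedges \<rho> \<Longrightarrow> \<bar>w e\<bar> = \<bar>w' e\<bar>"
  shows "w' \<in> geo P \<rho>"
proof -
  have "len w' (pedges \<rho>) = len w (pedges \<rho>)" using assms(3) by (intro len_cong) simp
  moreover have "len w (pedges \<pi>) \<le> len w' (pedges \<pi>)" for \<pi> using assms(2) by (intro len_mono)
  ultimately show ?thesis
    using assms(1) unfolding geo_def first_min_def mem_Collect_eq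
    by (smt (verit, best))
qed

lemma excess_nonneg: "finite P \<Longrightarrow> \<pi> \<in> P \<Longrightarrow> 0 \<le> excess P \<pi> w"
  unfolding excess_def by simp

text \<open>A weight off \<pi> enters only through the minimum. Hence
  \<open>exp (- \<beta> * excess P \<pi> w)\<close> increases in it, as the comparison of killed and
  tame spots requires.\<close>

lemma excess_antimono:
  assumes "finite P" "P \<noteq> {}" "e \<notin> pedges \<pi>" "\<bar>v\<bar> \<le> \<bar>v'\<bar>"
  shows "excess P \<pi> (w(e := v')) \<le> excess P \<pi> (w(e := v))"
proof -
  have "len (w(e := v')) (pedges \<pi>) = len (w(e := v)) (pedges \<pi>)"
    using assms by (intro len_cong) auto
  moreover have "Min ((\<lambda>\<rho>. len (w(e := v)) (pedges \<rho>)) ` P) \<le> Min ((\<lambda>\<rho>. len (w(e := v')) (pedges \<rho>)) ` P)"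
  proof -
    have "Min ((\<lambda>\<rho>. len (w(e := v)) (pedges \<rho>)) ` P) \<le> len (w(e := v')) (pedges \<rho>)" if "\<rho> \<in> P" for \<rho>
    proof -
      have "Min ((\<lambda>\<rho>. len (w(e := v)) (pedges \<rho>)) ` P) \<le> len (w(e := v)) (pedges \<rho>)"
        using assms that by (intro Min_le) auto
      also have "\<dots> \<le> len (w(e := v')) (pedges \<rho>)" using assms by (intro len_mono) auto
      finally show ?thesis .
    qed
    then show ?thesis using assms by (subst Min_ge_iff) auto
  qed
  ultimately show ?thesis by (simp add: excess_def)
qed

definition scaled :: "real \<Rightarrow> edge set \<Rightarrow> (edge \<Rightarrow> real) \<Rightarrow> edge \<Rightarrow> real" where
  "scaled c A w e = (if e \<in> A then c * w e else w e)"

lemma len_scaled: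
  assumes "finite T" "0 \<le> c"
  shows "len (scaled c A w) T = len w (T - A) + c * len w (T \<inter> A)"
proof -
  have "len (scaled c A w) T = len (scaled c A w) (T - A) + len (scaled c A w) (T \<inter> A)"
    unfolding len_def using assms(1) by (subst sum.Int_Diff[of T _ A]) (auto simp: add.commute)
  also have "len (scaled c A w) (T - A) = len w (T - A)"
    by (rule len_cong) (simp add: scaled_def)
  also have "len (scaled c A w) (T \<inter> A) = c * len w (T \<inter> A)"
    unfolding len_def sum_distrib_left using assms(2) by (intro sum.cong) (auto simp: scaled_def abs_mult)
  finally show ?thesis .
qed

lemma len_split: "finite T \<Longrightarrow> len w T = len w (T - A) + len w (T \<inter> A)"
  unfolding len_def by (subst sum.Int_Diff[of T _ A]) (auto simp: add.commute)

text \<open>Shrinking the weights along \<open>\<pi>\<close> by the factor \<open>c\<close> favours \<open>\<pi>\<close>; the minimiser \<open>\<rho>\<close> of the shrunk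
  weights then shares all of \<open>\<pi>\<close> but a part that is paid for by the excess.\<close>

lemma excess_ge_scaled:
  assumes "finite P" "\<pi> \<in> P" "0 < c" "c \<le> 1" and geo: "scaled c (pedges \<pi>) w \<in> geo P \<rho>"
  shows "(1 - c) * len w (pedges \<pi> - pedges \<rho>) \<le> excess P \<pi> w"
    and "scaled c (pedges \<pi> \<inter> pedges \<rho>) w \<in> geo P \<rho>"
proof -
  let ?w = "scaled c (pedges \<pi>) w"
  have \<rho>: "\<rho> \<in> P" using geo by (simp add: geo_def first_min_def)
  have "len ?w (pedges \<rho>) \<le> len ?w (pedges \<pi>)"
    using geo \<open>\<pi> \<in> P\<close> unfolding geo_def first_min_def mem_Collect_eq by force
  then have 1: "len w (pedges \<rho> - pedges \<pi>) + c * len w (pedges \<rho> \<inter> pedges \<pi>) \<le> c * len w (pedges \<pi>)"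
    using assms(3) by (simp add: len_scaled) (simp add: len_def)
  have 2: "len w (pedges \<pi>) = len w (pedges \<pi> - pedges \<rho>) + len w (pedges \<rho> \<inter> pedges \<pi>)"
    by (subst len_split[of _ _ "pedges \<rho>"]) (auto simp: Int_commute)
  have 3: "len w (pedges \<rho>) = len w (pedges \<rho> - pedges \<pi>) + len w (pedges \<rho> \<inter> pedges \<pi>)"
    by (rule len_split) simp
  have "(1 - c) * len w (pedges \<pi> - pedges \<rho>) \<le> len w (pedges \<pi>) - len w (pedges \<rho>)"
    using 1 2 3 by (simp add: algebra_simps)
  also have "\<dots> \<le> excess P \<pi> w"
    unfolding excess_def using assms(1) \<rho> by (intro diff_left_mono Min_le) auto
  finally show "(1 - c) * len w (pedges \<pi> - pedges \<rho>) \<le> excess P \<pi> w" .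
  \<comment> \<open>Restoring the weights on \<pi> off \<rho> only lengthens competitors of \<rho>.
    The shrinking then leaves untouched those edges that carry the exponential penalty.\<close>
  show "scaled c (pedges \<pi> \<inter> pedges \<rho>) w \<in> geo P \<rho>"
    by (rule geo_mono[OF geo]) (use assms(3,4) in \<open>auto simp: scaled_def abs_mult intro: mult_left_le_one_le\<close>)
qed

text \<open>The penalty on \<pi> off \<rho> yields powers of \<psi>, since
  \<open>geo P \<rho>\<close> increases in those weights, and undoing the shrinking on the common
  edges costs at most \<open>(1 / c) ^ n\<close>. After exchanging the sums, the inner one over
  \<pi> is \<open>sum_saws_outside\<close>, and the outer one adds probabilities of disjoint
  events.\<close>

lemma sum_exp_excess:
  assumes c: "0 < c" "c \<le> 1" and \<psi>: "0 \<le> \<psi>" "\<psi> \<le> 1" and \<beta>: "0 \<le> \<beta>"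
    and G: "(\<integral>\<^sup>+x. ennreal (exp (- \<beta> * (1 - c) * \<bar>x\<bar>)) \<partial>normal) \<le> ennreal \<psi>"
  shows "(\<Sum>\<pi>\<in>saws_to u n v. \<integral>\<^sup>+w. ennreal (exp (- \<beta> * excess (saws_to u n v) \<pi> w)) \<partial>gauss)
    \<le> ennreal ((1 / c) ^ n * (8 * (1 + 6 * \<psi>) ^ n))"
proof -
  interpret prob_space gauss by (rule prob_space_gauss)
  let ?P = "saws_to u n v"
  let ?G = "\<lambda>x. ennreal (exp (- \<beta> * (1 - c) * \<bar>x\<bar>))"
  have G_mono: "?G y \<le> ?G x" if "\<bar>x\<bar> \<le> \<bar>y\<bar>" for x y
    using that c \<beta> by (intro ennreal_leI) (auto intro!: mult_left_mono)
  have one: "(\<integral>\<^sup>+w. ennreal (exp (- \<beta> * excess ?P \<pi> w)) \<partial>gauss)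
      \<le> (\<Sum>\<rho>\<in>?P. ennreal ((1 / c) ^ n) * (ennreal (\<psi> ^ card (pedges \<pi> - pedges \<rho>)) * emeasure gauss (geo ?P \<rho>)))"
    if \<pi>: "\<pi> \<in> ?P" for \<pi>
  proof -
    let ?f = "\<lambda>\<rho> w. (\<Prod>e\<in>pedges \<pi> - pedges \<rho>. ?G (w e)) * indicator (geo ?P \<rho>) w"
    have f[measurable]: "?f \<rho> \<in> borel_measurable W_space" for \<rho>
    proof -
      have "(\<lambda>w. ?G (w e)) \<in> borel_measurable W_space" for e
        by (rule measurable_compose[OF measurable_coord]) measurable
      then show ?thesis
        by (intro borel_measurable_times_ennreal borel_measurable_prod_ennreal borel_measurable_indicator sets_geo) auto
    qed
    have sc[measurable]: "scaled c A \<in> W_space \<rightarrow>\<^sub>M W_space" for A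
    proof (rule measurable_W_spaceI)
      fix e
      have [measurable]: "(\<lambda>w. w e) \<in> borel_measurable W_space" by (rule measurable_coord)
      show "(\<lambda>w. scaled c A w e) \<in> borel_measurable W_space"
        unfolding scaled_def by (cases "e \<in> A") simp_all
    qed
    have pt: "ennreal (exp (- \<beta> * excess ?P \<pi> w)) \<le> (\<Sum>\<rho>\<in>?P. ?f \<rho> (scaled c (pedges \<pi> \<inter> pedges \<rho>) w))" for w
    proof -
      obtain \<rho> where geo: "scaled c (pedges \<pi>) w \<in> geo ?P \<rho>"
        using ex_first_min[of ?P] \<pi> unfolding geo_def mem_Collect_eq by (metis finite_saws_to empty_iff)
      then have \<rho>: "\<rho> \<in> ?P" by (simp add: geo_def first_min_def)
      note ex = excess_ge_scaled[OF finite_saws_to \<pi> c geo]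
      have "exp (- \<beta> * excess ?P \<pi> w) \<le> exp (- \<beta> * ((1 - c) * len w (pedges \<pi> - pedges \<rho>)))"
        using ex(1) \<beta> by (auto intro: mult_left_mono)
      also have "\<dots> = (\<Prod>e\<in>pedges \<pi> - pedges \<rho>. exp (- \<beta> * (1 - c) * \<bar>w e\<bar>))"
        by (simp add: exp_sum[symmetric] len_def sum_distrib_left sum_negf mult.assoc)
      finally have "ennreal (exp (- \<beta> * excess ?P \<pi> w)) \<le> (\<Prod>e\<in>pedges \<pi> - pedges \<rho>. ?G (w e))"
        by (subst prod_ennreal) (auto intro: ennreal_leI)
      also have "\<dots> = ?f \<rho> (scaled c (pedges \<pi> \<inter> pedges \<rho>) w)"
      proof -
        have "(\<Prod>e\<in>pedges \<pi> - pedges \<rho>. ?G (scaled c (pedges \<pi> \<inter> pedges \<rho>) w e)) = (\<Prod>e\<in>pedges \<pi> - pedges \<rho>. ?G (w e))"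
          by (intro prod.cong) (auto simp: scaled_def)
        then show ?thesis using ex(2) by simp
      qed
      also have "\<dots> \<le> (\<Sum>\<rho>\<in>?P. ?f \<rho> (scaled c (pedges \<pi> \<inter> pedges \<rho>) w))"
        by (rule member_le_sum[OF \<rho>]) auto
      finally show ?thesis .
    qed
    have "(\<integral>\<^sup>+w. ennreal (exp (- \<beta> * excess ?P \<pi> w)) \<partial>gauss)
        \<le> (\<integral>\<^sup>+w. (\<Sum>\<rho>\<in>?P. ?f \<rho> (scaled c (pedges \<pi> \<inter> pedges \<rho>) w)) \<partial>gauss)"
      by (intro nn_integral_mono pt)
    also have "\<dots> = (\<Sum>\<rho>\<in>?P. \<integral>\<^sup>+w. ?f \<rho> (scaled c (pedges \<pi> \<inter> pedges \<rho>) w) \<partial>gauss)"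
      by (rule nn_integral_sum) (rule measurable_compose[OF _ f], simp add: measurable_cong_sets[OF sets_gauss refl] sc)
    also have "\<dots> \<le> (\<Sum>\<rho>\<in>?P. ennreal ((1 / c) ^ n) * (ennreal (\<psi> ^ card (pedges \<pi> - pedges \<rho>)) * emeasure gauss (geo ?P \<rho>)))"
    proof (rule sum_mono)
      fix \<rho> assume \<rho>: "\<rho> \<in> ?P"
      have "(\<integral>\<^sup>+w. ?f \<rho> (scaled c (pedges \<pi> \<inter> pedges \<rho>) w) \<partial>gauss)
          \<le> ennreal (1 / c) ^ card (pedges \<pi> \<inter> pedges \<rho>) * (\<integral>\<^sup>+w. ?f \<rho> w \<partial>gauss)"
        unfolding scaled_def by (rule nn_integral_gauss_scale[OF f _ c]) simp
      also have "\<dots> \<le> ennreal (1 / c) ^ n * ((\<integral>\<^sup>+x. ?G x \<partial>normal) ^ card (pedges \<pi> - pedges \<rho>) * emeasure gauss (geo ?P \<rho>))"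
      proof (intro mult_mono power_increasing)
        have "card (pedges \<pi> \<inter> pedges \<rho>) \<le> card (pedges \<pi>)" by (intro card_mono) auto
        then show "card (pedges \<pi> \<inter> pedges \<rho>) \<le> n" using card_pedges_saws_to[OF \<pi>] by simp
        show "1 \<le> ennreal (1 / c)" using c by simp
        show "(\<integral>\<^sup>+w. ?f \<rho> w \<partial>gauss) \<le> (\<integral>\<^sup>+x. ?G x \<partial>normal) ^ card (pedges \<pi> - pedges \<rho>) * emeasure gauss (geo ?P \<rho>)"
        proof (rule nn_integral_gauss_prod_le)
          show "?G \<in> borel_measurable borel" by measurable
          show "geo ?P \<rho> \<in> sets W_space" by (rule sets_geo) simp
          show "finite (pedges \<pi> - pedges \<rho>)" by simp
          show "?G y \<le> ?G x" if "\<bar>x\<bar> \<le> \<bar>y\<bar>" for x y by (rule G_mono[OF that])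
          fix w e y assume "w \<in> geo ?P \<rho>" "e \<in> pedges \<pi> - pedges \<rho>" "\<bar>w e\<bar> \<le> \<bar>y\<bar>"
          then show "w(e := y) \<in> geo ?P \<rho>" by (elim geo_mono) auto
        qed
      qed simp_all
      also have "\<dots> \<le> ennreal (1 / c) ^ n * (ennreal \<psi> ^ card (pedges \<pi> - pedges \<rho>) * emeasure gauss (geo ?P \<rho>))"
        by (intro mult_left_mono mult_right_mono power_mono G) auto
      finally show "(\<integral>\<^sup>+w. ?f \<rho> (scaled c (pedges \<pi> \<inter> pedges \<rho>) w) \<partial>gauss)
          \<le> ennreal ((1 / c) ^ n) * (ennreal (\<psi> ^ card (pedges \<pi> - pedges \<rho>)) * emeasure gauss (geo ?P \<rho>))"
        using c \<psi> by (simp add: ennreal_power)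
    qed
    finally show ?thesis .
  qed
  have "(\<Sum>\<pi>\<in>?P. \<integral>\<^sup>+w. ennreal (exp (- \<beta> * excess ?P \<pi> w)) \<partial>gauss)
      \<le> (\<Sum>\<pi>\<in>?P. \<Sum>\<rho>\<in>?P. ennreal ((1 / c) ^ n) * (ennreal (\<psi> ^ card (pedges \<pi> - pedges \<rho>)) * emeasure gauss (geo ?P \<rho>)))"
    by (intro sum_mono one)
  also have "\<dots> = (\<Sum>\<rho>\<in>?P. \<Sum>\<pi>\<in>?P. ennreal ((1 / c) ^ n) * (ennreal (\<psi> ^ card (pedges \<pi> - pedges \<rho>)) * emeasure gauss (geo ?P \<rho>)))"
    by (rule sum.swap)
  also have "\<dots> = (\<Sum>\<rho>\<in>?P. ennreal ((1 / c) ^ n) * (\<Sum>\<pi>\<in>?P. ennreal (\<psi> ^ card (pedges \<pi> - pedges \<rho>))) * emeasure gauss (geo ?P \<rho>))"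
    by (simp add: sum_distrib_left sum_distrib_right mult.assoc)
  also have "\<dots> \<le> (\<Sum>\<rho>\<in>?P. ennreal ((1 / c) ^ n) * ennreal (8 * (1 + 6 * \<psi>) ^ n) * emeasure gauss (geo ?P \<rho>))"
  proof (intro sum_mono mult_right_mono mult_left_mono)
    fix \<rho> assume \<rho>: "\<rho> \<in> ?P"
    have "(\<Sum>\<pi>\<in>?P. \<psi> ^ card (pedges \<pi> - pedges \<rho>)) \<le> (\<Sum>\<pi>\<in>saws u n. \<psi> ^ card (pedges \<pi> - pedges \<rho>))"
      by (intro sum_mono2) (use \<psi> in \<open>auto simp: saws_to_def\<close>)
    also have "\<dots> \<le> 8 * (1 + 6 * \<psi>) ^ n"
      using saws_to_dpath[OF \<rho>] \<psi> by (intro sum_saws_outside) auto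
    finally show "(\<Sum>\<pi>\<in>?P. ennreal (\<psi> ^ card (pedges \<pi> - pedges \<rho>))) \<le> ennreal (8 * (1 + 6 * \<psi>) ^ n)"
      using \<psi> by (subst sum_ennreal) (auto intro: ennreal_leI)
  qed auto
  also have "\<dots> = ennreal ((1 / c) ^ n) * ennreal (8 * (1 + 6 * \<psi>) ^ n) * (\<Sum>\<rho>\<in>?P. emeasure gauss (geo ?P \<rho>))"
    by (simp add: sum_distrib_left)
  also have "(\<Sum>\<rho>\<in>?P. emeasure gauss (geo ?P \<rho>)) = emeasure gauss (\<Union>\<rho>\<in>?P. geo ?P \<rho>)"
  proof (rule sum_emeasure)
    show "disjoint_family_on (geo ?P) ?P"
      using first_min_unique unfolding disjoint_family_on_def geo_def by blast
  qed (auto simp: sets_gauss intro: sets_geo)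
  also have "\<dots> \<le> 1" by (rule emeasure_le_1)
  finally show ?thesis
    using c \<psi> by (simp add: ennreal_mult[symmetric] mult_left_mono)
qed

section \<open>Placing disjoint spots along a path\<close>

fun corners :: "vert \<Rightarrow> vert set" where
  "corners (a, b) = {(a, b), (a + 1, b), (a, b + 1), (a + 1, b + 1)}"

definition block :: "vert \<Rightarrow> edge set" where
  "block p = (\<Union>x\<in>corners p. cut {x})"

lemma finite_corners [simp]: "finite (corners p)"
  by (cases p) simp

lemma finite_block: "finite (block p)"
  by (simp add: block_def)

lemma card_block: "card (block p) \<le> 16"
proof -
  have "card (block p) \<le> (\<Sum>x\<in>corners p. card (cut {x}))"
    unfolding block_def by (rule card_UN_le) simp
  also have "\<dots> = 4 * card (corners p)" by (simp add: card_cut_singleton)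
  also have "\<dots> \<le> 16" by (cases p) (simp add: card_insert_if)
  finally show ?thesis .
qed

text \<open>Distinct edges share at most one end, so \<open>g\<close> has an end that
  \<open>h\<close> lacks.\<close>

lemma plaq_corner:
  assumes "g \<in> plaq p" "h \<in> plaq p" "g \<noteq> h"
  shows "\<exists>x\<in>corners p. g \<in> cut {x} \<and> h \<notin> cut {x}"
proof -
  obtain a b where p: "p = (a, b)" by (cases p)
  show ?thesis using assms unfolding p plaq_eq corners.simps
    by (elim insertE emptyE) (simp_all add: cut_singleton)
qed

lemma plaq_subset_block: "plaq p \<subseteq> block p"
  by (cases p) (auto simp: plaq_eq block_def cut_singleton)

lemma card_plaq: "card (plaq p) = 4"
  by (cases p) (simp add: plaq_eq)

text \<open>An edge of \<open>block p\<close> has a base point within 1 of \<open>p\<close> in each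
  coordinate, so overlapping blocks have centres within 2; modulus 3 separates them.\<close>

definition residue :: "vert \<Rightarrow> int \<times> int" where
  "residue p = (fst p mod 3, snd p mod 3)"

lemma block_near:
  assumes "e \<in> block p"
  shows "fst (fst e) - fst p \<in> {-1, 0, 1}" "snd (fst e) - snd p \<in> {-1, 0, 1}"
  using assms by (cases p; auto simp: block_def cut_singleton)+

lemma block_disjoint:
  assumes "residue p = residue q" "p \<noteq> q"
  shows "block p \<inter> block q = {}"
proof (rule ccontr)
  assume "block p \<inter> block q \<noteq> {}"
  then obtain e where e: "e \<in> block p" "e \<in> block q" by blast
  have "\<bar>fst p - fst q\<bar> \<le> 2" "\<bar>snd p - snd q\<bar> \<le> 2"
    using block_near[OF e(1)] block_near[OF e(2)] by auto
  moreover have "3 dvd fst p - fst q" "3 dvd snd p - snd q"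
    using assms(1) by (auto simp: residue_def mod_eq_dvd_iff)
  ultimately have "fst p = fst q" "snd p = snd q" by presburger+
  then show False using assms(2) by (simp add: prod_eq_iff)
qed

lemma interior_plaq:
  assumes \<pi>: "dpath (xs @ p # ys)" and ne: "xs \<noteq> []" "ys \<noteq> []"
  shows "\<exists>g h. g \<noteq> h \<and> g \<in> plaq p \<and> h \<in> plaq p \<and> g \<notin> pedges (xs @ p # ys) \<and> h \<notin> pedges (xs @ p # ys)
    \<and> plaq p - {g, h} \<subseteq> pedges (xs @ p # ys) \<and> card (plaq p - {g, h}) = 2"
proof -
  let ?Q = "pedges (xs @ p # ys)"
  let ?a = "dedge (last xs) p" and ?b = "dedge p (hd ys)"
  have adj: "lat_adj (last xs) p" "lat_adj p (hd ys)"
    using assms by (auto simp: dpath_def successively_append_iff successively_Cons)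
  have "last xs \<noteq> hd ys"
  proof -
    have "set xs \<inter> set ys = {}" using \<pi> by (auto simp: dpath_def)
    then show ?thesis using last_in_set[OF ne(1)] hd_in_set[OF ne(2)] by (metis disjoint_iff)
  qed
  then have ab: "?a \<noteq> ?b"
    using adj dual_ends_dedge[OF adj(1)] dual_ends_dedge[OF adj(2)] lat_adj_neq
    by (auto simp: doubleton_eq_iff)
  have plaq: "?a \<in> plaq p" "?b \<in> plaq p"
    using dual_ends_dedge[OF adj(1)] dual_ends_dedge[OF adj(2)] by (auto simp: plaq_def)
  have Q: "?a \<in> ?Q" "?b \<in> ?Q"
  proof -
    obtain zs z where "xs = zs @ [z]" using ne(1) by (cases xs rule: rev_cases) auto
    then show "?a \<in> ?Q" using pedges_append[of zs z "p # ys"] by simp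
    obtain z' zs' where "ys = z' # zs'" using ne(2) by (cases ys) auto
    then show "?b \<in> ?Q" by (subst pedges_append) simp
  qed
  have only: "e = ?a \<or> e = ?b" if "e \<in> plaq p" "e \<in> ?Q" for e
    using pedges_incident[OF \<pi> that(2)] that(1) by (auto simp: plaq_def)
  have "card (plaq p - {?a, ?b}) = 2"
    using plaq ab by (subst card_Diff_subset) (auto simp: card_plaq)
  then obtain g h where gh: "plaq p - {?a, ?b} = {g, h}" "g \<noteq> h" unfolding card_2_iff by metis
  then have "plaq p - {g, h} = {?a, ?b}" using plaq by blast
  moreover have gh': "g \<in> plaq p" "h \<in> plaq p" "g \<notin> {?a, ?b}" "h \<notin> {?a, ?b}" using gh by blast+
  moreover have "g \<notin> ?Q" "h \<notin> ?Q" using only[of g] only[of h] gh' by blast+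
  moreover have "card {?a, ?b} = 2" using ab by simp
  ultimately show ?thesis
    using gh(2) Q by (intro exI[of _ g] exI[of _ h]) simp
qed

text \<open>Pigeonhole: there are nine classes, and 18 is 9 times 2.\<close>

lemma ex_residue_class:
  assumes "finite I" "card I = 18 * k"
  shows "\<exists>S\<subseteq>I. card S = 2 * k \<and> (\<forall>p\<in>S. \<forall>q\<in>S. residue p = residue q)"
proof -
  let ?R = "{0, 1, 2 :: int} \<times> {0, 1, 2 :: int}"
  have "\<exists>r\<in>?R. 2 * k \<le> card {p \<in> I. residue p = r}"
  proof (rule ccontr)
    assume "\<not> ?thesis"
    then have less: "card {p \<in> I. residue p = r} < 2 * k" if "r \<in> ?R" for r
      using that by (meson not_le)
    have "residue p \<in> ?R" for p
    proof -
      have "x mod 3 \<in> {0, 1, 2}" for x :: int by auto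
      then show ?thesis unfolding residue_def by blast
    qed
    then have "I = (\<Union>r\<in>?R. {p \<in> I. residue p = r})" by blast
    moreover have "card (\<Union>r\<in>?R. {p \<in> I. residue p = r}) \<le> (\<Sum>r\<in>?R. card {p \<in> I. residue p = r})"
      by (rule card_UN_le) simp
    ultimately have "card I \<le> (\<Sum>r\<in>?R. card {p \<in> I. residue p = r})" by metis
    also have "\<dots> < (\<Sum>r\<in>?R. 2 * k)" by (rule sum_strict_mono) (use less in auto)
    also have "\<dots> = 18 * k" by simp
    finally show False using assms by simp
  qed
  then obtain r where "2 * k \<le> card {p \<in> I. residue p = r}" by blast
  then obtain S where "S \<subseteq> {p \<in> I. residue p = r}" "card S = 2 * k"
    by (meson obtain_subset_with_card_n)
  then show ?thesis by (intro exI[of _ S]) auto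
qed

text \<open>A path of \<open>18 * k + 1\<close> steps has \<open>18 * k\<close> inner vertices, with
  indices 1 to \<open>18 * k\<close>. Only at inner vertices does the path use two sides of the
  plaquette.\<close>

lemma ex_spots:
  assumes \<pi>: "\<pi> \<in> saws u (18 * k + 1)" and t: "0 \<le> t"
  obtains S g h x y where "spots (pedges \<pi>) S g h x y block t" "card S = 2 * k"
proof -
  have dp: "dpath \<pi>" and len: "length \<pi> = 18 * k + 2" using \<pi> by (auto simp: saws_def)
  define I where "I = (\<lambda>i. \<pi> ! i) ` {1..18 * k}"
  have "card I = 18 * k"
    unfolding I_def using dp len by (subst card_image) (auto simp: dpath_def inj_on_def nth_eq_iff_index_eq)
  then obtain S where S: "S \<subseteq> I" "card S = 2 * k" "\<And>p q. p \<in> S \<Longrightarrow> q \<in> S \<Longrightarrow> residue p = residue q"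
    using ex_residue_class[of I k] by (auto simp: I_def)
  have "\<exists>g h. g \<noteq> h \<and> g \<in> plaq p \<and> h \<in> plaq p \<and> g \<notin> pedges \<pi> \<and> h \<notin> pedges \<pi>
      \<and> plaq p - {g, h} \<subseteq> pedges \<pi> \<and> card (plaq p - {g, h}) = 2" if p: "p \<in> S" for p
  proof -
    obtain i where "i \<in> {1..18 * k}" and i3: "p = \<pi> ! i" using p S(1) unfolding I_def by blast
    then have i: "1 \<le> i" "i \<le> 18 * k" by auto
    have "i < length \<pi>" using i len by simp
    then have eq: "\<pi> = take i \<pi> @ p # drop (Suc i) \<pi>" unfolding i3 by (rule id_take_nth_drop)
    have ne: "take i \<pi> \<noteq> []" "drop (Suc i) \<pi> \<noteq> []" using i len by auto
    from interior_plaq[OF subst[OF eq, of dpath, OF dp] ne]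
    show ?thesis by (simp only: eq[symmetric])
  qed
  then obtain g h where gh: "\<And>p. p \<in> S \<Longrightarrow> g p \<noteq> h p \<and> g p \<in> plaq p \<and> h p \<in> plaq p \<and> g p \<notin> pedges \<pi> \<and> h p \<notin> pedges \<pi>
      \<and> plaq p - {g p, h p} \<subseteq> pedges \<pi> \<and> card (plaq p - {g p, h p}) = 2" by metis
  have "\<exists>x\<in>corners p. g p \<in> cut {x} \<and> h p \<notin> cut {x}" if "p \<in> S" for p
    using gh[OF that] by (intro plaq_corner) auto
  then obtain x where x: "\<And>p. p \<in> S \<Longrightarrow> x p \<in> corners p \<and> g p \<in> cut {x p} \<and> h p \<notin> cut {x p}" by metis
  have "\<exists>y\<in>corners p. h p \<in> cut {y} \<and> g p \<notin> cut {y}" if "p \<in> S" for p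
    using gh[OF that] by (intro plaq_corner) auto
  then obtain y where y: "\<And>p. p \<in> S \<Longrightarrow> y p \<in> corners p \<and> h p \<in> cut {y p} \<and> g p \<notin> cut {y p}" by metis
  have "spots (pedges \<pi>) S g h x y block t"
  proof
    show "finite S" using S(1) by (rule finite_subset) (simp add: I_def)
    show "disjoint_family_on block S"
      using block_disjoint S(3) unfolding disjoint_family_on_def by blast
    fix p assume p: "p \<in> S"
    show "cut {x p} \<subseteq> block p" "cut {y p} \<subseteq> block p"
      using x[OF p] y[OF p] unfolding block_def by blast+
    show "even (card (plaq p - {g p, h p}))" using gh[OF p] by simp
  qed (use gh x y t plaq_subset_block finite_block card_block in \<open>simp_all\<close>)
  with S(2) show thesis by (intro that)
qed

lemma measurable_exp_excess:
  "finite P \<Longrightarrow> \<pi> \<in> P \<Longrightarrow> (\<lambda>w. ennreal (exp (- \<beta> * excess P \<pi> w))) \<in> borel_measurable W_space"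
proof -
  assume "finite P" "\<pi> \<in> P"
  then have [measurable]: "excess P \<pi> \<in> borel_measurable W_space" by (intro measurable_excess) auto
  show ?thesis by measurable
qed

text \<open>With \<open>a = exp (- \<beta> * excess)\<close> and
  \<open>b = (1 / 2) ^ card (kills w)\<close>, the two conditional bounds are at most
  \<open>a * a\<close> and \<open>b * b\<close>, so their minimum is at most \<open>a * b\<close>.
  The value 1/2 enters \<delta> as the outer division by 2, and \<beta> no longer does.\<close>

lemma unsat_path_bound:
  assumes flip: "flip_bound \<beta> \<nu>" and sets: "sets \<nu> = sets Omega" and \<beta>: "4 \<le> \<beta>" and t: "0 \<le> t"
    and \<pi>: "\<pi> \<in> saws_to u (18 * k + 1) v"
    and \<delta>: "\<delta> = (measure normal {x. 3 * t + 1 < \<bar>x\<bar>} / 2)\<^sup>2 / 2"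
  shows "emeasure \<nu> (unsat_event (pedges \<pi>)) \<le>
    ennreal (1 - \<delta>) ^ k * (\<integral>\<^sup>+w. ennreal (exp (- \<beta> * excess (saws_to u (18 * k + 1) v) \<pi> w)) \<partial>gauss)
      + ennreal (2 ^ (32 * k)) * emeasure normal {x. t < \<bar>x\<bar>} ^ k"
proof -
  let ?P = "saws_to u (18 * k + 1) v"
  have "\<pi> \<in> saws u (18 * k + 1)" using \<pi> by (simp add: saws_to_def)
  then obtain S g h x y where sp: "spots (pedges \<pi>) S g h x y block t" and card: "card S = 2 * k"
    by (rule ex_spots[OF _ t])
  interpret spots "pedges \<pi>" S g h x y block t by (rule sp)
  let ?F = "\<lambda>w. ennreal (exp (- \<beta> * excess ?P \<pi> w))"
  let ?u = "\<lambda>w. ennreal (exp (- 2 * \<beta> * excess ?P \<pi> w))"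
  let ?v = "\<lambda>w. ennreal ((2 * exp (- 2 * \<beta>)) ^ card (kills w))"
  \<comment> \<open>The hypothesis \<open>4 \<le> \<beta>\<close> is made for this: 1/4 is the
    square of the factor 1/2 kept per killed spot.\<close>
  have exp8: "2 * exp (- 2 * \<beta>) \<le> 1 / 4"
  proof -
    have "exp (- 2 * \<beta>) \<le> exp (- 8)" using \<beta> by simp
    also have "\<dots> \<le> 1 / 8"
      using exp_ge_add_one_self[of "8 :: real"] by (simp add: exp_minus field_simps)
    finally show ?thesis by simp
  qed
  have ex0: "0 \<le> excess ?P \<pi> w" for w using \<pi> by (intro excess_nonneg) auto
  have "cond_bound \<nu> (unsat_event (pedges \<pi>)) (\<lambda>w. min (?u w) (?v w))"
  proof (rule cond_bound_min[OF sets sets_unsat_event[OF finite_pedges]])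
    show "?u \<in> borel_measurable W_space" using measurable_exp_excess[of ?P \<pi> "2 * \<beta>"] \<pi> by simp
    show "?v \<in> borel_measurable W_space" by (rule measurable_kill_power)
    show "cond_bound \<nu> (unsat_event (pedges \<pi>)) ?u"
      by (rule cond_bound_path[OF flip sets _ \<pi>]) (use saws_to_dpath \<pi> in auto)
    show "cond_bound \<nu> (unsat_event (pedges \<pi>)) ?v"
      by (rule cond_bound_kills[OF flip sets])
  qed
  then have "emeasure \<nu> (unsat_event (pedges \<pi>) \<inter> {p \<in> space Omega. fst p \<in> UNIV})
      \<le> (\<integral>\<^sup>+w. min (?u w) (?v w) * indicator UNIV w \<partial>gauss)"
    unfolding cond_bound_def by (rule bspec) (metis space_W_space sets.top)
  moreover have "unsat_event (pedges \<pi>) \<inter> {p \<in> space Omega. fst p \<in> UNIV} = unsat_event (pedges \<pi>)"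
    by (auto simp: unsat_event_def)
  ultimately have "emeasure \<nu> (unsat_event (pedges \<pi>)) \<le> (\<integral>\<^sup>+w. min (?u w) (?v w) \<partial>gauss)"
    by simp
  also have "\<dots> \<le> (\<integral>\<^sup>+w. ?F w * ennreal (1 / 2) ^ card (kills w) \<partial>gauss)"
  proof (rule nn_integral_mono)
    fix w
    let ?a = "exp (- \<beta> * excess ?P \<pi> w)" and ?b = "(1 / 2 :: real) ^ card (kills w)"
    have "exp (- 2 * \<beta> * excess ?P \<pi> w) = ?a * ?a"
      by (simp add: exp_add[symmetric])
    moreover have "(2 * exp (- 2 * \<beta>)) ^ card (kills w) \<le> (1 / 4) ^ card (kills w)"
      using exp8 by (intro power_mono) auto
    moreover have "(1 / 4 :: real) ^ card (kills w) = ?b * ?b"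
      by (simp add: power_mult_distrib[symmetric])
    moreover have "min (?a * ?a) (?b * ?b) \<le> ?a * ?b"
    proof (cases "?a \<le> ?b")
      case True
      then have "?a * ?a \<le> ?a * ?b" by (intro mult_left_mono) auto
      then show ?thesis by (rule min.coboundedI1)
    next
      case False
      then have "?b * ?b \<le> ?a * ?b" by (intro mult_right_mono) auto
      then show ?thesis by (rule min.coboundedI2)
    qed
    ultimately have "min (exp (- 2 * \<beta> * excess ?P \<pi> w)) ((2 * exp (- 2 * \<beta>)) ^ card (kills w)) \<le> ?a * ?b"
      by linarith
    then have "ennreal (min (exp (- 2 * \<beta> * excess ?P \<pi> w)) ((2 * exp (- 2 * \<beta>)) ^ card (kills w))) \<le> ennreal (?a * ?b)"
      by (rule ennreal_leI)
    also have "\<dots> = ?F w * ennreal (1 / 2) ^ card (kills w)"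
      by (simp only: ennreal_mult'' ennreal_power zero_le_power zero_le_divide_1_iff zero_le_numeral)
    finally show "min (?u w) (?v w) \<le> ?F w * ennreal (1 / 2) ^ card (kills w)"
      by (simp add: min_def split: if_splits)
  qed
  also have "\<dots> \<le> (\<integral>\<^sup>+w. ?F w * (\<Prod>p\<in>S. tfac \<delta> p w) \<partial>gauss)"
  proof (rule kills_integral)
    show "?F \<in> borel_measurable W_space" by (rule measurable_exp_excess) (use \<pi> in auto)
    show "?F w \<le> 1" for w using ex0[of w] \<beta> by simp
    show "\<delta> = (1 - 1 / 2) * (tail / 2)\<^sup>2" by (simp add: \<delta> tail_def)
    fix w e and a b :: real assume "e \<notin> pedges \<pi>" "\<bar>a\<bar> \<le> \<bar>b\<bar>"
    then have "excess ?P \<pi> (w(e := b)) \<le> excess ?P \<pi> (w(e := a))"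
      using \<pi> by (intro excess_antimono) auto
    then show "?F (w(e := a)) \<le> ?F (w(e := b))"
      using \<beta> by (intro ennreal_leI) (simp add: mult_left_mono)
  qed auto
  also have "\<dots> \<le> ennreal (1 - \<delta>) ^ k * (\<integral>\<^sup>+w. ?F w \<partial>gauss)
      + ennreal (2 ^ (32 * k)) * emeasure normal {x. t < \<bar>x\<bar>} ^ k"
  proof (rule tame_integral[OF _ _ _ _ card])
    show "?F \<in> borel_measurable W_space" by (rule measurable_exp_excess) (use \<pi> in auto)
    show "?F w \<le> 1" for w using ex0[of w] \<beta> by simp
    have "(tail / 2)\<^sup>2 \<le> 1" using tail_bounds by (simp add: power_le_one)
    then show "\<delta> \<le> 1" by (simp add: \<delta> tail_def)
    show "0 \<le> \<delta>" by (simp add: \<delta>)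
  qed
  finally show ?thesis .
qed

subsection \<open>Conclusion\<close>

lemma normal_tail_small:
  assumes "0 < \<epsilon>"
  shows "\<exists>t\<ge>0. emeasure normal {x. t < \<bar>x\<bar>} \<le> ennreal \<epsilon>"
proof -
  interpret prob_space normal by (rule prob_space_normal)
  have "(\<lambda>i. emeasure normal {x. real i < \<bar>x\<bar>}) \<longlonglongrightarrow> emeasure normal (\<Inter>i. {x. real i < \<bar>x\<bar>})"
    by (rule Lim_emeasure_decseq) (auto simp: decseq_def)
  also have "(\<Inter>i. {x. real i < \<bar>x\<bar>}) = {}"
  proof -
    have "\<exists>i. \<not> real i < \<bar>x\<bar>" for x using real_arch_simple[of "\<bar>x\<bar>"] by (auto simp: not_less)
    then show ?thesis by blast
  qed
  finally have "(\<lambda>i. emeasure normal {x. real i < \<bar>x\<bar>}) \<longlonglongrightarrow> 0" by simp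
  then have "eventually (\<lambda>i. emeasure normal {x. real i < \<bar>x\<bar>} < ennreal \<epsilon>) sequentially"
    by (rule order_tendstoD) (use assms in simp)
  then obtain i where "emeasure normal {x. real i < \<bar>x\<bar>} < ennreal \<epsilon>"
    by (auto simp: eventually_sequentially)
  then show ?thesis by (intro exI[of _ "real i"]) auto
qed

lemma normal_tail_pos:
  assumes "0 \<le> T"
  shows "0 < measure normal {x. T < \<bar>x\<bar>}"
proof -
  interpret prob_space normal by (rule prob_space_normal)
  have "emeasure normal {x. T < \<bar>x\<bar>} \<noteq> 0"
  proof
    assume "emeasure normal {x. T < \<bar>x\<bar>} = 0"
    then have "AE x in normal. \<not> T < \<bar>x\<bar>"
      by (subst AE_iff_measurable[of "{x. T < \<bar>x\<bar>}"]) auto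
    then have "AE x in lborel. \<not> T < \<bar>x\<bar>"
      by (subst (asm) AE_density) (auto simp: normal_density_pos)
    then have "emeasure lborel {x. T < \<bar>x\<bar>} = 0"
      by (subst (asm) AE_iff_measurable[of "{x. T < \<bar>x\<bar>}"]) auto
    moreover have "emeasure lborel {T<..<T+1} \<le> emeasure lborel {x. T < \<bar>x\<bar>}"
      using assms by (intro emeasure_mono) auto
    ultimately show False by simp
  qed
  then show ?thesis by (simp add: emeasure_eq_measure zero_less_measure_iff)
qed

text \<open>As \<beta> grows the integrand tends to the indicator of the null set
  \<open>{0}\<close>.\<close>

lemma normal_laplace_small:
  assumes "0 < a" "0 < \<epsilon>"
  shows "\<exists>b\<ge>0. \<forall>\<beta>\<ge>b. (\<integral>\<^sup>+x. ennreal (exp (- \<beta> * a * \<bar>x\<bar>)) \<partial>normal) \<le> ennreal \<epsilon>"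
proof -
  interpret prob_space normal by (rule prob_space_normal)
  have "(\<lambda>i. \<integral>\<^sup>+x. ennreal (exp (- real i * a * \<bar>x\<bar>)) \<partial>normal) \<longlonglongrightarrow> (\<integral>\<^sup>+x. indicator {0} x \<partial>normal)"
  proof (rule nn_integral_dominated_convergence[where w = "\<lambda>_. 1"])
    show "AE x in normal. (\<lambda>i. ennreal (exp (- real i * a * \<bar>x\<bar>))) \<longlonglongrightarrow> indicator {0} x"
    proof (rule AE_I2)
      fix x :: real
      show "(\<lambda>i. ennreal (exp (- real i * a * \<bar>x\<bar>))) \<longlonglongrightarrow> indicator {0} x"
      proof (cases "x = 0")
        case False
        have "exp (- real i * a * \<bar>x\<bar>) = exp (- a * \<bar>x\<bar>) ^ i" for i
          by (simp add: exp_of_nat_mult[symmetric])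
        moreover have "(\<lambda>i. exp (- a * \<bar>x\<bar>) ^ i) \<longlonglongrightarrow> 0"
          using False assms by (intro LIMSEQ_realpow_zero) auto
        ultimately have "(\<lambda>i. exp (- real i * a * \<bar>x\<bar>)) \<longlonglongrightarrow> 0" by simp
        then have "(\<lambda>i. ennreal (exp (- real i * a * \<bar>x\<bar>))) \<longlonglongrightarrow> ennreal 0" by (rule tendsto_ennrealI)
        then show ?thesis using False by simp
      qed simp
    qed
    show "AE x in normal. ennreal (exp (- real i * a * \<bar>x\<bar>)) \<le> 1" for i
      using assms by (intro AE_I2) simp
    show "(\<integral>\<^sup>+x. 1 \<partial>normal) < \<infinity>" using emeasure_space_1 by simp
  qed auto
  moreover have "(\<integral>\<^sup>+x. indicator {0} x \<partial>normal) = 0"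
  proof -
    have "emeasure normal {0} = (\<integral>\<^sup>+x. ennreal (std_normal_density x) * indicator {0} x \<partial>lborel)"
      by (rule emeasure_density) auto
    also have "\<dots> = 0"
      by (rule nn_integral_null_set) (simp add: null_sets_def)
    finally show ?thesis by simp
  qed
  ultimately have "(\<lambda>i. \<integral>\<^sup>+x. ennreal (exp (- real i * a * \<bar>x\<bar>)) \<partial>normal) \<longlonglongrightarrow> 0" by simp
  then have "eventually (\<lambda>i. (\<integral>\<^sup>+x. ennreal (exp (- real i * a * \<bar>x\<bar>)) \<partial>normal) < ennreal \<epsilon>) sequentially"
    by (rule order_tendstoD) (use assms in simp)
  then obtain i where i: "(\<integral>\<^sup>+x. ennreal (exp (- real i * a * \<bar>x\<bar>)) \<partial>normal) < ennreal \<epsilon>"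
    by (auto simp: eventually_sequentially)
  have "(\<integral>\<^sup>+x. ennreal (exp (- \<beta> * a * \<bar>x\<bar>)) \<partial>normal) \<le> ennreal \<epsilon>" if "real i \<le> \<beta>" for \<beta>
  proof -
    have "(\<integral>\<^sup>+x. ennreal (exp (- \<beta> * a * \<bar>x\<bar>)) \<partial>normal) \<le> (\<integral>\<^sup>+x. ennreal (exp (- real i * a * \<bar>x\<bar>)) \<partial>normal)"
      using that assms by (intro nn_integral_mono ennreal_leI) (auto intro!: mult_right_mono)
    with i show ?thesis by auto
  qed
  then show ?thesis by (intro exI[of _ "real i"]) auto
qed

section \<open>From infinite components to long self-avoiding paths\<close>

lemma pedges_prefix: "pedges xs \<subseteq> pedges (xs @ ys)"
  by (induction xs rule: pedges.induct) auto

lemma dpath_prefix: "dpath (xs @ ys) \<Longrightarrow> xs \<noteq> [] \<Longrightarrow> dpath xs"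
  by (auto simp: dpath_def successively_append_iff)

lemma unsat_component_path:
  assumes "v \<in> unsat_component w \<sigma> u"
  shows "\<exists>\<pi>. dpath \<pi> \<and> hd \<pi> = u \<and> last \<pi> = v \<and> (\<forall>e\<in>pedges \<pi>. unsatisfied w \<sigma> e)"
proof -
  have "(u, v) \<in> (unsat_rel w \<sigma>)\<^sup>*" using assms by (simp add: unsat_component_def)
  then show ?thesis
  proof (induction rule: rtrancl_induct)
    case base
    then show ?case by (intro exI[of _ "[u]"]) (auto simp: dpath_def)
  next
    case (step y z)
    then obtain \<pi> where \<pi>: "dpath \<pi>" "hd \<pi> = u" "last \<pi> = y" "\<forall>e\<in>pedges \<pi>. unsatisfied w \<sigma> e" by blast
    have "lat_adj y z \<and> unsatisfied w \<sigma> (dedge y z)"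
    proof -
      obtain e where "unsatisfied w \<sigma> e" "dual_ends e = {y, z}"
        using step(2) unfolding unsat_rel_def by blast
      then show ?thesis using dual_ends_eqD by metis
    qed
    then have yz: "lat_adj y z" "unsatisfied w \<sigma> (dedge y z)" by auto
    show ?case
    proof (cases "z \<in> set \<pi>")
      \<comment> \<open>Loop erasure: the path is cut back to its earlier visit of
        \<open>z\<close>.\<close>
      case True
      then obtain xs ys where eq: "\<pi> = (xs @ [z]) @ ys" by (metis append.assoc append_Cons append_Nil split_list)
      have "dpath (xs @ [z])" using \<pi>(1) unfolding eq by (rule dpath_prefix) simp
      moreover have "hd (xs @ [z]) = u" using \<pi>(2) by (auto simp: eq hd_append)
      moreover have "\<forall>e\<in>pedges (xs @ [z]). unsatisfied w \<sigma> e"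
        using \<pi>(4) pedges_prefix[of "xs @ [z]" ys] unfolding eq by blast
      ultimately show ?thesis by (intro exI[of _ "xs @ [z]"]) simp
    next
      case False
      obtain zs where zs: "\<pi> = zs @ [y]"
        using \<pi>(1,3) by (metis append_butlast_last_id dpath_def)
      have "dpath (\<pi> @ [z])"
        using \<pi>(1,3) yz False by (auto simp: dpath_def successively_append_iff)
      moreover have "pedges (\<pi> @ [z]) = pedges \<pi> \<union> {dedge y z}"
        using pedges_append[of zs y "[z]"] by (simp add: zs)
      ultimately show ?thesis using \<pi> yz
        by (intro exI[of _ "\<pi> @ [z]"]) (auto simp: dpath_def)
    qed
  qed
qed

text \<open>Without such a path every vertex of the component would be the end of one of finitely
  many shorter paths.\<close>

lemma infinite_component_path:
  assumes "infinite (unsat_component w \<sigma> u)"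
  shows "\<exists>\<pi>\<in>saws u n. \<forall>e\<in>pedges \<pi>. unsatisfied w \<sigma> e"
proof (rule ccontr)
  assume no: "\<not> ?thesis"
  have "unsat_component w \<sigma> u \<subseteq> (\<Union>m\<in>{..n}. last ` saws u m)"
  proof
    fix v assume "v \<in> unsat_component w \<sigma> u"
    then obtain \<pi> where \<pi>: "dpath \<pi>" "hd \<pi> = u" "last \<pi> = v" "\<forall>e\<in>pedges \<pi>. unsatisfied w \<sigma> e"
      using unsat_component_path by blast
    then have ne: "\<pi> \<noteq> []" by (simp add: dpath_def)
    have "length \<pi> \<le> n"
    proof (rule ccontr)
      assume "\<not> length \<pi> \<le> n"
      then have len: "length (take (Suc n) \<pi>) = Suc n" by simp
      have split: "\<pi> = take (Suc n) \<pi> @ drop (Suc n) \<pi>" by simp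
      have "dpath (take (Suc n) \<pi>)"
        by (rule dpath_prefix[of _ "drop (Suc n) \<pi>"]) (use \<pi>(1) ne in auto)
      moreover have "hd (take (Suc n) \<pi>) = u" using \<pi>(2) by simp
      ultimately have "take (Suc n) \<pi> \<in> saws u n" using len by (simp add: saws_def)
      moreover have "pedges (take (Suc n) \<pi>) \<subseteq> pedges \<pi>"
        using pedges_prefix[of "take (Suc n) \<pi>" "drop (Suc n) \<pi>"] by simp
      ultimately show False using no \<pi>(4) by blast
    qed
    moreover have "\<pi> \<in> saws u (length \<pi> - 1)" using \<pi> ne by (auto simp: saws_def)
    ultimately show "v \<in> (\<Union>m\<in>{..n}. last ` saws u m)"
      using \<pi>(3) by (intro UN_I[of "length \<pi> - 1"]) auto
  qed
  then have "finite (unsat_component w \<sigma> u)" by (rule finite_subset) simp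
  then show False using assms by simp
qed

section \<open>Summation over all paths and choice of the constants\<close>

lemma saws_partition: "saws u n = (\<Union>v\<in>last ` saws u n. saws_to u n v)"
  by (auto simp: saws_to_def)

lemma sum_exp_excess_all:
  assumes "0 < c" "c \<le> 1" "0 \<le> \<psi>" "\<psi> \<le> 1" "0 \<le> \<beta>"
    and "(\<integral>\<^sup>+x. ennreal (exp (- \<beta> * (1 - c) * \<bar>x\<bar>)) \<partial>normal) \<le> ennreal \<psi>"
  shows "(\<Sum>\<pi>\<in>saws u n. \<integral>\<^sup>+w. ennreal (exp (- \<beta> * excess (saws_to u n (last \<pi>)) \<pi> w)) \<partial>gauss)
    \<le> ennreal (real ((2 * n + 1)\<^sup>2) * ((1 / c) ^ n * (8 * (1 + 6 * \<psi>) ^ n)))"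
proof -
  let ?I = "\<lambda>v \<pi>. \<integral>\<^sup>+w. ennreal (exp (- \<beta> * excess (saws_to u n v) \<pi> w)) \<partial>gauss"
  let ?B = "(1 / c) ^ n * (8 * (1 + 6 * \<psi>) ^ n)"
  have "(\<Sum>\<pi>\<in>saws u n. ?I (last \<pi>) \<pi>) = (\<Sum>v\<in>last ` saws u n. \<Sum>\<pi>\<in>saws_to u n v. ?I (last \<pi>) \<pi>)"
    by (subst saws_partition, rule sum.UNION_disjoint) (auto simp: saws_to_def)
  also have "\<dots> = (\<Sum>v\<in>last ` saws u n. \<Sum>\<pi>\<in>saws_to u n v. ?I v \<pi>)"
    by (intro sum.cong refl) (simp add: saws_to_def)
  also have "\<dots> \<le> (\<Sum>v\<in>last ` saws u n. ennreal ?B)"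
    by (intro sum_mono sum_exp_excess assms)
  also have "\<dots> = ennreal (real (card (last ` saws u n))) * ennreal ?B"
    by (simp add: ennreal_of_nat_eq_real_of_nat)
  also have "\<dots> \<le> ennreal (real ((2 * n + 1)\<^sup>2)) * ennreal ?B"
    using card_saws_last[of u n] by (intro mult_right_mono ennreal_leI of_nat_mono) auto
  also have "\<dots> = ennreal (real ((2 * n + 1)\<^sup>2) * ?B)"
    using assms by (intro ennreal_mult[symmetric]) auto
  finally show ?thesis .
qed

text \<open>The main term is summed with the near-geodesic count; the exceptional term does not see
  the excess and is multiplied by the crude count \<open>4 ^ n\<close>.\<close>

lemma sum_unsat_paths:
  fixes k :: nat
  assumes flip: "flip_bound \<beta> \<nu>" and sets: "sets \<nu> = sets Omega" and \<beta>: "4 \<le> \<beta>" and t: "0 \<le> t"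
    and \<delta>: "\<delta> = (measure normal {x. 3 * t + 1 < \<bar>x\<bar>} / 2)\<^sup>2 / 2"
    and \<delta>01: "0 \<le> \<delta>" "\<delta> \<le> 1"
    and q: "0 \<le> q" "emeasure normal {x. t < \<bar>x\<bar>} \<le> ennreal q"
    and c: "0 < c" "c \<le> 1" and \<psi>: "0 \<le> \<psi>" "\<psi> \<le> 1"
    and G: "(\<integral>\<^sup>+x. ennreal (exp (- \<beta> * (1 - c) * \<bar>x\<bar>)) \<partial>normal) \<le> ennreal \<psi>"
    and n: "n = 18 * k + 1"
  shows "(\<Sum>\<pi>\<in>saws u n. emeasure \<nu> (unsat_event (pedges \<pi>)))
    \<le> ennreal ((1 - \<delta>) ^ k * (real ((2 * n + 1)\<^sup>2) * ((1 / c) ^ n * (8 * (1 + 6 * \<psi>) ^ n)))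
        + 4 ^ n * (2 ^ (32 * k) * q ^ k))"
proof -
  let ?I = "\<lambda>\<pi>. \<integral>\<^sup>+w. ennreal (exp (- \<beta> * excess (saws_to u n (last \<pi>)) \<pi> w)) \<partial>gauss"
  have "(\<Sum>\<pi>\<in>saws u n. emeasure \<nu> (unsat_event (pedges \<pi>)))
      \<le> (\<Sum>\<pi>\<in>saws u n. ennreal (1 - \<delta>) ^ k * ?I \<pi> + ennreal (2 ^ (32 * k) * q ^ k))"
  proof (rule sum_mono)
    fix \<pi> assume "\<pi> \<in> saws u n"
    then have "\<pi> \<in> saws_to u (18 * k + 1) (last \<pi>)" by (simp add: saws_to_def n)
    from unsat_path_bound[OF flip sets \<beta> t this \<delta>]
    have "emeasure \<nu> (unsat_event (pedges \<pi>)) \<le> ennreal (1 - \<delta>) ^ k * ?I \<pi>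
      + ennreal (2 ^ (32 * k)) * emeasure normal {x. t < \<bar>x\<bar>} ^ k" unfolding n .
    also have "\<dots> \<le> ennreal (1 - \<delta>) ^ k * ?I \<pi> + ennreal (2 ^ (32 * k)) * ennreal q ^ k"
      by (intro add_left_mono mult_left_mono power_mono q) auto
    also have "ennreal (2 ^ (32 * k)) * ennreal q ^ k = ennreal (2 ^ (32 * k) * q ^ k)"
      using q by (subst ennreal_power, simp, subst ennreal_mult) auto
    finally show "emeasure \<nu> (unsat_event (pedges \<pi>)) \<le> ennreal (1 - \<delta>) ^ k * ?I \<pi> + ennreal (2 ^ (32 * k) * q ^ k)" .
  qed
  also have "\<dots> = ennreal (1 - \<delta>) ^ k * (\<Sum>\<pi>\<in>saws u n. ?I \<pi>)
      + ennreal (real (card (saws u n))) * ennreal (2 ^ (32 * k) * q ^ k)"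
    by (simp add: sum.distrib sum_distrib_left ennreal_of_nat_eq_real_of_nat)
  also have "\<dots> \<le> ennreal (1 - \<delta>) ^ k * ennreal (real ((2 * n + 1)\<^sup>2) * ((1 / c) ^ n * (8 * (1 + 6 * \<psi>) ^ n)))
      + ennreal (4 ^ n) * ennreal (2 ^ (32 * k) * q ^ k)"
  proof (intro add_mono mult_left_mono mult_right_mono ennreal_leI)
    show "(\<Sum>\<pi>\<in>saws u n. ?I \<pi>) \<le> ennreal (real ((2 * n + 1)\<^sup>2) * ((1 / c) ^ n * (8 * (1 + 6 * \<psi>) ^ n)))"
      using \<beta> by (intro sum_exp_excess_all c \<psi> G) auto
    show "real (card (saws u n)) \<le> 4 ^ n"
      using of_nat_mono[OF card_saws[of u n], where ?'a = real] by simp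
  qed auto
  also have "\<dots> = ennreal ((1 - \<delta>) ^ k * (real ((2 * n + 1)\<^sup>2) * ((1 / c) ^ n * (8 * (1 + 6 * \<psi>) ^ n)))
        + 4 ^ n * (2 ^ (32 * k) * q ^ k))"
    using \<delta>01 c \<psi> q
    by (subst ennreal_plus) (auto simp: ennreal_power ennreal_mult[symmetric])
  finally show ?thesis .
qed

lemma square_times_power_tendsto_0:
  fixes r a b :: real
  assumes "0 \<le> r" "r < 1"
  shows "(\<lambda>k. (a * real k + b)\<^sup>2 * r ^ k) \<longlonglongrightarrow> 0"
proof -
  \<comment> \<open>The root makes the sequence a square of linear times geometric terms, each
    tending to 0.\<close>
  define s where "s = sqrt r"
  have s: "0 \<le> s" "s < 1" "r = s\<^sup>2" using assms by (auto simp: s_def)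
  have "(\<lambda>k. real k * s ^ k) \<longlonglongrightarrow> 0" using s by (intro powser_times_n_limit_0) auto
  moreover have "(\<lambda>k. s ^ k) \<longlonglongrightarrow> 0" using s by (intro LIMSEQ_realpow_zero) auto
  ultimately have "(\<lambda>k. a * (real k * s ^ k) + b * s ^ k) \<longlonglongrightarrow> a * 0 + b * 0"
    by (intro tendsto_add tendsto_mult tendsto_const)
  then have "(\<lambda>k. (a * (real k * s ^ k) + b * s ^ k)\<^sup>2) \<longlonglongrightarrow> 0"
    using tendsto_power[of _ 0 _ 2] by fastforce
  moreover have "(a * (real k * s ^ k) + b * s ^ k)\<^sup>2 = (a * real k + b)\<^sup>2 * r ^ k" for k
  proof -
    have "a * (real k * s ^ k) + b * s ^ k = (a * real k + b) * s ^ k" by (simp add: algebra_simps)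
    then show ?thesis by (simp add: s(3) power_mult_distrib power_mult[symmetric] mult.commute)
  qed
  ultimately show ?thesis by simp
qed

lemma finite_components_of_flip_bound:
  "\<exists>\<beta>s\<ge>0. \<forall>\<beta>>\<beta>s. \<forall>\<nu>. flip_bound \<beta> \<nu> \<longrightarrow> sets \<nu> = sets Omega \<longrightarrow>
     (AE p in \<nu>. \<forall>u. finite (unsat_component (fst p) (snd p) u))"
proof -
  \<comment> \<open>Chosen so that \<open>4 ^ 18 * 2 ^ 32 * q = 1 / 2\<close>: the exceptional term
    then decays despite the number of paths and of edge sets.\<close>
  define q :: real where "q = 1 / 2 ^ 69"
  obtain t where t: "0 \<le> t" "emeasure normal {x. t < \<bar>x\<bar>} \<le> ennreal q"
    using normal_tail_small[of q] by (auto simp: q_def)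
  define \<delta> where "\<delta> = (measure normal {x. 3 * t + 1 < \<bar>x\<bar>} / 2)\<^sup>2 / 2"
  have \<delta>: "0 < \<delta>" "\<delta> \<le> 1"
  proof -
    interpret prob_space normal by (rule prob_space_normal)
    have "0 < measure normal {x. 3 * t + 1 < \<bar>x\<bar>}" using t by (intro normal_tail_pos) auto
    then show "0 < \<delta>" by (simp add: \<delta>_def)
    have "(measure normal {x. 3 * t + 1 < \<bar>x\<bar>} / 2)\<^sup>2 \<le> 1"
      by (rule power_le_one) (auto intro: order_trans[OF prob_le_1])
    then show "\<delta> \<le> 1" by (simp add: \<delta>_def)
  qed
  \<comment> \<open>Shrinking and counting will each cost \<eta> per step, hence
    \<open>\<eta> ^ 36\<close> for the 18 steps that gain one factor \<open>1 - \<delta>\<close>.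
    The bound 7 ensures \<open>\<psi> \<le> 1\<close>.\<close>
  obtain \<eta> :: real where \<eta>: "1 < \<eta>" "\<eta> < 7" "\<eta> ^ 36 * (1 - \<delta>) < 1"
  proof -
    have "((\<lambda>x :: real. x ^ 36 * (1 - \<delta>)) \<longlongrightarrow> 1 ^ 36 * (1 - \<delta>)) (at_right 1)"
      by (intro tendsto_intros)
    then have "eventually (\<lambda>x :: real. x ^ 36 * (1 - \<delta>) < 1) (at_right 1)"
      by (rule order_tendstoD) (use \<delta> in simp)
    moreover have "eventually (\<lambda>x :: real. x \<in> {1<..<7}) (at_right 1)"
      by (rule eventually_at_right_real) simp
    ultimately have "eventually (\<lambda>x :: real. x ^ 36 * (1 - \<delta>) < 1 \<and> x \<in> {1<..<7}) (at_right 1)"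
      by (rule eventually_conj)
    then have "\<exists>x :: real. x ^ 36 * (1 - \<delta>) < 1 \<and> x \<in> {1<..<7}"
      by (rule eventually_happens'[rotated]) simp
    then show thesis using that by auto
  qed
  \<comment> \<open>Both growth factors, \<open>1 / c\<close> and \<open>1 + 6 * \<psi>\<close>,
    equal \<eta>.\<close>
  define c where "c = 1 / \<eta>"
  define \<psi> where "\<psi> = (\<eta> - 1) / 6"
  have c: "0 < c" "c < 1" and \<psi>: "0 < \<psi>" "\<psi> \<le> 1" using \<eta> by (auto simp: c_def \<psi>_def)
  obtain b where b: "0 \<le> b" "\<And>\<beta>. b \<le> \<beta> \<Longrightarrow> (\<integral>\<^sup>+x. ennreal (exp (- \<beta> * (1 - c) * \<bar>x\<bar>)) \<partial>normal) \<le> ennreal \<psi>"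
    using normal_laplace_small[of "1 - c" \<psi>] c \<psi> by auto
  define B where "B k = (1 - \<delta>) ^ k * (real ((2 * (18 * k + 1) + 1)\<^sup>2) * ((1 / c) ^ (18 * k + 1) * (8 * (1 + 6 * \<psi>) ^ (18 * k + 1))))
        + 4 ^ (18 * k + 1) * (2 ^ (32 * k) * q ^ k)" for k :: nat
  have B_lim: "B \<longlonglongrightarrow> 0"
  proof -
    let ?r = "\<eta> ^ 36 * (1 - \<delta>)"
    have "B = (\<lambda>k. 8 * \<eta>\<^sup>2 * ((36 * real k + 3)\<^sup>2 * ?r ^ k) + 4 * (1 / 2) ^ k)"
    proof
      fix k
      have "1 / c = \<eta>" "1 + 6 * \<psi> = \<eta>" by (simp_all add: c_def \<psi>_def field_simps)
      moreover have "\<eta> ^ (18 * k + 1) * (8 * \<eta> ^ (18 * k + 1)) = 8 * \<eta>\<^sup>2 * (\<eta> ^ 36) ^ k"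
      proof -
        have "(\<eta> ^ 36) ^ k = \<eta> ^ (18 * k) * \<eta> ^ (18 * k)"
          by (simp add: power_mult[symmetric] power_add[symmetric])
        then show ?thesis by (simp add: power2_eq_square)
      qed
      moreover have "real ((2 * (18 * k + 1) + 1)\<^sup>2) = (36 * real k + 3)\<^sup>2" by simp
      moreover have "4 ^ (18 * k + 1) * (2 ^ (32 * k) * q ^ k) = 4 * (1 / 2) ^ k"
      proof -
        have "(4 :: real) ^ (18 * k + 1) * (2 ^ (32 * k) * q ^ k) = 4 * (4 ^ 18 * 2 ^ 32 * q) ^ k"
        proof -
          have "(4 :: real) ^ (18 * k + 1) = 4 * (4 ^ 18) ^ k" "(2 :: real) ^ (32 * k) = (2 ^ 32) ^ k"
            using power_mult[of "4 :: real" 18 k] power_mult[of "2 :: real" 32 k]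
            by (simp_all only: Suc_eq_plus1[symmetric] power_Suc)
          then show ?thesis by (simp only: power_mult_distrib mult.assoc)
        qed
        also have "(4 :: real) ^ 18 * 2 ^ 32 * q = 1 / 2" by (simp add: q_def)
        finally show ?thesis .
      qed
      ultimately show "B k = 8 * \<eta>\<^sup>2 * ((36 * real k + 3)\<^sup>2 * ?r ^ k) + 4 * (1 / 2) ^ k"
        unfolding B_def by (simp only: power_mult_distrib ac_simps)
    qed
    moreover have "(\<lambda>k. 8 * \<eta>\<^sup>2 * ((36 * real k + 3)\<^sup>2 * ?r ^ k) + 4 * (1 / 2) ^ k) \<longlonglongrightarrow> 8 * \<eta>\<^sup>2 * 0 + 4 * 0"
      using \<eta> \<delta> by (intro tendsto_intros square_times_power_tendsto_0 LIMSEQ_realpow_zero) auto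
    ultimately show ?thesis by simp
  qed
  have "AE p in \<nu>. \<forall>u. finite (unsat_component (fst p) (snd p) u)"
    if \<beta>: "max 4 b < \<beta>" and flip: "flip_bound \<beta> \<nu>" and sets: "sets \<nu> = sets Omega" for \<beta> \<nu>
  proof (subst AE_all_countable, rule allI)
    fix u
    define U where "U k = (\<Union>\<pi>\<in>saws u (18 * k + 1). unsat_event (pedges \<pi>))" for k
    have U_sets: "U k \<in> sets \<nu>" for k
      unfolding U_def sets by (intro sets.finite_UN finite_saws sets_unsat_event finite_pedges)
    have U_le: "emeasure \<nu> (U k) \<le> ennreal (B k)" for k
    proof -
      have "emeasure \<nu> (U k) \<le> (\<Sum>\<pi>\<in>saws u (18 * k + 1). emeasure \<nu> (unsat_event (pedges \<pi>)))"
        unfolding U_def by (intro emeasure_subadditive_finite) (auto simp: sets sets_unsat_event)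
      also have "\<dots> \<le> ennreal (B k)"
        unfolding B_def
        by (rule sum_unsat_paths[OF flip sets _ t(1) \<delta>_def _ _ _ t(2) _ _ _ _ b(2)])
          (use \<beta> \<delta> c \<psi> in \<open>auto simp: q_def\<close>)
      finally show ?thesis .
    qed
    have null: "emeasure \<nu> (\<Inter>k. U k) = 0"
    proof -
      have "emeasure \<nu> (\<Inter>k. U k) \<le> ennreal (B k)" for k
        by (rule order_trans[OF emeasure_mono U_le[of k]]) (use U_sets in auto)
      moreover have "(\<lambda>k. ennreal (B k)) \<longlonglongrightarrow> ennreal 0" by (rule tendsto_ennrealI[OF B_lim])
      ultimately have "emeasure \<nu> (\<Inter>k. U k) \<le> ennreal 0"
        by (intro LIMSEQ_le_const) auto
      then show ?thesis by simp
    qed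
    show "AE p in \<nu>. finite (unsat_component (fst p) (snd p) u)"
    proof (rule AE_I')
      show "(\<Inter>k. U k) \<in> null_sets \<nu>"
        using null U_sets by (intro null_setsI sets.countable_INT) auto
      show "{p \<in> space \<nu>. \<not> finite (unsat_component (fst p) (snd p) u)} \<subseteq> (\<Inter>k. U k)"
      proof
        fix p assume "p \<in> {p \<in> space \<nu>. \<not> finite (unsat_component (fst p) (snd p) u)}"
        then have p: "p \<in> space Omega" and inf: "infinite (unsat_component (fst p) (snd p) u)"
          using sets_eq_imp_space_eq[OF sets] by auto
        have "p \<in> U k" for k
          using infinite_component_path[OF inf, of "18 * k + 1"] p unfolding U_def unsat_event_def by blast
        then show "p \<in> (\<Inter>k. U k)" by blast
      qed
    qed
  qed
  then show ?thesis by (intro exI[of _ "max 4 b"]) auto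
qed

theorem theorem1p4:
  shows "\<exists>\<beta>s::real. 0 \<le> \<beta>s \<and>
    (\<forall>\<beta>::real. \<forall>\<nu>. \<beta> > \<beta>s \<longrightarrow> EA_spin_glass \<beta> \<nu> \<longrightarrow> translation_invariant \<nu> \<longrightarrow>
        (AE p in \<nu>. \<forall>u. finite (unsat_component (fst p) (snd p) u))) \<and>
    (\<forall>\<nu>. ground_state \<nu> \<longrightarrow> translation_invariant \<nu> \<longrightarrow>
        (AE p in \<nu>. \<forall>u. finite (unsat_component (fst p) (snd p) u)))"
proof -
  obtain \<beta>s where \<beta>s: "0 \<le> \<beta>s" "\<And>\<beta> \<nu>. \<beta>s < \<beta> \<Longrightarrow> flip_bound \<beta> \<nu> \<Longrightarrow> sets \<nu> = sets Omega \<Longrightarrow>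
      (AE p in \<nu>. \<forall>u. finite (unsat_component (fst p) (snd p) u))"
    using finite_components_of_flip_bound by blast
  show ?thesis
  proof (intro exI[of _ \<beta>s] conjI allI impI)
    fix \<beta> :: real and \<nu>
    assume "\<beta>s < \<beta>" "EA_spin_glass \<beta> \<nu>"
    then show "AE p in \<nu>. \<forall>u. finite (unsat_component (fst p) (snd p) u)"
      by (intro \<beta>s(2)[of \<beta>] flip_bound_EA_spin_glass) (auto simp: EA_spin_glass_def iid_normal_law_def)
  next
    fix \<nu>
    assume "ground_state \<nu>"
    \<comment> \<open>A ground state satisfies the flip bound at every inverse temperature, so any
      value above the threshold serves.\<close>
    then show "AE p in \<nu>. \<forall>u. finite (unsat_component (fst p) (snd p) u)"
      using \<beta>s(1)
      by (intro \<beta>s(2)[of "\<beta>s + 1"] flip_bound_ground_state) (auto simp: ground_state_def iid_normal_law_def)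
  qed (rule \<beta>s(1))
qed

end
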